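(* Let $(k,\ell)$ be a pair of normalized diagonal holomorphic kernels on an open disc in $\mathbb{C}$ centered at $0$, so that $$k(z,w)=1+\sum_{j\ge1}k_j(z\overline{w})^j,\qquad \ell(z,w)=1+\sum_{j\ge1}\ell_j(z\overline{w})^j,$$ with all $k_j,\ell_j>0$. Then $(k,\ell)$ is a complete Pick pair if and only if $$\frac{\ell}{k}\succeq0$$ and also the following conditions are satisfied: for every strictly increasing infinite sequence of integers $0\le m_0<m_1<m_2<\cdots$ and for all $j\ge0$, $$\frac{\ell_{(m_0,m_1,\dots,m_j)}}{k}\succeq0,$$ where $\ell_{(m_0,\dots,m_j)}$ is defined inductively by $$\ell_{(m_0)}(z,w)=\ell(z,w)-\Big(\frac{\ell}{k}\Big)_{m_0}(z\overline{w})^{m_0},$$ $$\ell_{(m_0,\dots,m_{j+1})}(z,w)=\ell_{(m_0,\dots,m_j)}(z,w)-\Big(\frac{\ell_{(m_0,\dots,m_j)}}{k}\Big)_{m_{j+1}}(z\overline{w})^{m_{j+1}}.$$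
   Context: A kernel on a non-empty set $X$ is a function $k:X\times X\to\mathbb{C}$ such that $[k(z_i,z_j)]_{i,j=1}^n$ is positive semi-definite for all finite choices of points; $\mathcal{H}_k$ is the reproducing kernel Hilbert space. $\mathrm{Mult}(\mathcal{H}_k\otimes\mathbb{C}^N,\mathcal{H}_\ell\otimes\mathbb{C}^N)$ is the set of $\Phi:X\to\mathbb{M}_N$ (complex $N\times N$ matrices) with $\Phi f\in\mathcal{H}_\ell\otimes\mathbb{C}^N$ for all $f\in\mathcal{H}_k\otimes\mathbb{C}^N$, normed by the operator norm of $f\mapsto\Phi f$. $(k,\ell)$ is a complete Pick pair on $X$ if for all $n,N\ge1$, all $z_1,\dots,z_n\in X$ and all $W_1,\dots,W_n\in\mathbb{M}_N$ with $[\ell(z_i,z_j)I_{N\times N}-k(z_i,z_j)W_iW_j^*]_{i,j=1}^n$ positive semi-definite, there is $\Phi\in\mathrm{Mult}(\mathcal{H}_k\otimes\mathbb{C}^N,\mathcal{H}_\ell\otimes\mathbb{C}^N)$ of norm at most one with $\Phi(z_i)=W_i$ for all $i$. A normalized diagonal holomorphic kernel in one variable is a kernel, holomorphic in $z$ and conjugate holomorphic in $w$, whose power series at $0$ is a series in $z\overline{w}$ with strictly positive coefficients and constant term $1$. For a (formal) power series $f=\sum_mf_m(z\overline{w})^m$, $(f)_m=f_m$ is the coefficient of $(z\overline{w})^m$; the quotient by $k$ is computed as power series in $z\overline{w}$. For such an $f$, $\frac{f}{k}\succeq0$ means that the quotient is a positive kernel, i.e. $f=qk$ for a kernel $q=\sum_mq_m(z\overline{w})^m$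 on the disc (equivalently, all coefficients $(f/k)_m$ are non-negative). *)

theory Defs
  imports
    "HOL-Complex_Analysis.Complex_Analysis"
    "HOL-Computational_Algebra.Formal_Power_Series"
    "Jordan_Normal_Form.Schur_Decomposition"
begin

(* The order on the complex numbers is the one of HOL-Library.Complex_Order: 0 \<le> c means that c is
   real and non-negative.  Over the complex numbers this forces the matrix to be Hermitian. *)
definition psd_mat :: "nat \<Rightarrow> complex mat \<Rightarrow> bool" where
  "psd_mat n A \<longleftrightarrow> A \<in> carrier_mat n n \<and> (\<forall>v \<in> carrier_vec n. 0 \<le> (A *\<^sub>v v) \<bullet>c v)"

definition is_kernel :: "'x set \<Rightarrow> ('x \<Rightarrow> 'x \<Rightarrow> complex) \<Rightarrow> bool" where
  "is_kernel X k \<longleftrightarrow> X \<noteq> {} \<and>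
     (\<forall>n. \<forall>z :: nat \<Rightarrow> 'x. (\<forall>i<n. z i \<in> X) \<longrightarrow>
        psd_mat n (Matrix.mat n n (\<lambda>(i, j). k (z i) (z j))))"

(* The (n N) x (n N) matrix with N x N blocks B i j, where i, j < n. *)
definition block_matrix :: "nat \<Rightarrow> nat \<Rightarrow> (nat \<Rightarrow> nat \<Rightarrow> complex mat) \<Rightarrow> complex mat" where
  "block_matrix n N B =
     Matrix.mat (n * N) (n * N) (\<lambda>(a, b). B (a div N) (b div N) $$ (a mod N, b mod N))"

(* A Hilbert space of functions on X is a pair of a set of functions and an inner product, linear in
   the first argument.  A function on X is represented by its extension by 0 to the whole type.
   The inner product is unspecified outside the space. *)
type_synonym 'x hilbert_fun =
  "('x \<Rightarrow> complex) set \<times> (('x \<Rightarrow> complex) \<Rightarrow> ('x \<Rightarrow> complex) \<Rightarrow> complex)"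

definition hf_norm :: "'x hilbert_fun \<Rightarrow> ('x \<Rightarrow> complex) \<Rightarrow> real" where
  "hf_norm H f = sqrt (Re (snd H f f))"

definition is_function_space :: "'x set \<Rightarrow> ('x \<Rightarrow> complex) set \<Rightarrow> bool" where
  "is_function_space X V \<longleftrightarrow>
     (\<forall>f\<in>V. \<forall>x. x \<notin> X \<longrightarrow> f x = 0) \<and>
     (\<lambda>x. 0) \<in> V \<and>
     (\<forall>f\<in>V. \<forall>g\<in>V. (\<lambda>x. f x + g x) \<in> V) \<and>
     (\<forall>c. \<forall>f\<in>V. (\<lambda>x. c * f x) \<in> V)"

definition is_inner_product ::
  "('x \<Rightarrow> complex) set \<Rightarrow> (('x \<Rightarrow> complex) \<Rightarrow> ('x \<Rightarrow> complex) \<Rightarrow> complex) \<Rightarrow> bool" where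
  "is_inner_product V ip \<longleftrightarrow>
     (\<forall>f\<in>V. \<forall>g\<in>V. \<forall>h\<in>V. ip (\<lambda>x. f x + g x) h = ip f h + ip g h) \<and>
     (\<forall>c. \<forall>f\<in>V. \<forall>h\<in>V. ip (\<lambda>x. c * f x) h = c * ip f h) \<and>
     (\<forall>f\<in>V. \<forall>g\<in>V. ip g f = cnj (ip f g)) \<and>
     (\<forall>f\<in>V. 0 \<le> ip f f) \<and>
     (\<forall>f\<in>V. ip f f = 0 \<longrightarrow> f = (\<lambda>x. 0))"

definition is_norm_complete :: "'x hilbert_fun \<Rightarrow> bool" where
  "is_norm_complete H \<longleftrightarrow>
     (\<forall>F :: nat \<Rightarrow> 'x \<Rightarrow> complex.
        (\<forall>n. F n \<in> fst H) \<and>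
        (\<forall>e>0. \<exists>M. \<forall>m\<ge>M. \<forall>n\<ge>M. hf_norm H (\<lambda>x. F m x - F n x) < e) \<longrightarrow>
        (\<exists>f \<in> fst H. (\<lambda>n. hf_norm H (\<lambda>x. F n x - f x)) \<longlonglongrightarrow> 0))"

definition kernel_fun :: "'x set \<Rightarrow> ('x \<Rightarrow> 'x \<Rightarrow> complex) \<Rightarrow> 'x \<Rightarrow> 'x \<Rightarrow> complex" where
  "kernel_fun X k w = (\<lambda>z. if z \<in> X then k z w else 0)"

definition is_rkhs :: "'x set \<Rightarrow> ('x \<Rightarrow> 'x \<Rightarrow> complex) \<Rightarrow> 'x hilbert_fun \<Rightarrow> bool" where
  "is_rkhs X k H \<longleftrightarrow>
     is_function_space X (fst H) \<and> is_inner_product (fst H) (snd H) \<and> is_norm_complete H \<and>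
     (\<forall>w\<in>X. kernel_fun X k w \<in> fst H) \<and>
     (\<forall>w\<in>X. \<forall>f \<in> fst H. f w = snd H f (kernel_fun X k w))"

(* By the Moore-Aronszajn theorem, for a kernel k on X such a space exists, and its underlying set
   and the inner product on that set are unique. *)
definition rkhs :: "'x set \<Rightarrow> ('x \<Rightarrow> 'x \<Rightarrow> complex) \<Rightarrow> 'x hilbert_fun" where
  "rkhs X k = (SOME H. is_rkhs X k H)"

(* H \<otimes> C^N, identified with the C^N-valued functions all of whose components lie in H; the squared
   norm is the sum of the squared norms of the components. *)
definition tensor_space :: "nat \<Rightarrow> 'x hilbert_fun \<Rightarrow> ('x \<Rightarrow> complex Matrix.vec) set" where
  "tensor_space N H =
     {f. (\<forall>x. f x \<in> carrier_vec N) \<and> (\<forall>i<N. (\<lambda>x. vec_index (f x) i) \<in> fst H)}"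

definition tensor_norm :: "nat \<Rightarrow> 'x hilbert_fun \<Rightarrow> ('x \<Rightarrow> complex Matrix.vec) \<Rightarrow> real" where
  "tensor_norm N H f = sqrt (\<Sum>i<N. (hf_norm H (\<lambda>x. vec_index (f x) i))\<^sup>2)"

(* The function \<Phi> f on X, extended by 0. *)
definition mult_op ::
  "'x set \<Rightarrow> nat \<Rightarrow> ('x \<Rightarrow> complex mat) \<Rightarrow> ('x \<Rightarrow> complex Matrix.vec) \<Rightarrow> 'x \<Rightarrow> complex Matrix.vec" where
  "mult_op X N \<Phi> f = (\<lambda>x. if x \<in> X then \<Phi> x *\<^sub>v f x else 0\<^sub>v N)"

definition Mult ::
  "'x set \<Rightarrow> nat \<Rightarrow> ('x \<Rightarrow> 'x \<Rightarrow> complex) \<Rightarrow> ('x \<Rightarrow> 'x \<Rightarrow> complex) \<Rightarrow> ('x \<Rightarrow> complex mat) set" where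
  "Mult X N k l =
     {\<Phi>. (\<forall>x\<in>X. \<Phi> x \<in> carrier_mat N N) \<and>
          (\<forall>f \<in> tensor_space N (rkhs X k). mult_op X N \<Phi> f \<in> tensor_space N (rkhs X l))}"

(* The operator norm, as an extended non-negative real so that the supremum always makes sense. *)
definition mult_norm ::
  "'x set \<Rightarrow> nat \<Rightarrow> ('x \<Rightarrow> 'x \<Rightarrow> complex) \<Rightarrow> ('x \<Rightarrow> 'x \<Rightarrow> complex) \<Rightarrow> ('x \<Rightarrow> complex mat) \<Rightarrow> ennreal" where
  "mult_norm X N k l \<Phi> =
     (SUP f \<in> {f \<in> tensor_space N (rkhs X k). tensor_norm N (rkhs X k) f \<le> 1}.
        ennreal (tensor_norm N (rkhs X l) (mult_op X N \<Phi> f)))"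

definition complete_pick_pair ::
  "'x set \<Rightarrow> ('x \<Rightarrow> 'x \<Rightarrow> complex) \<Rightarrow> ('x \<Rightarrow> 'x \<Rightarrow> complex) \<Rightarrow> bool" where
  "complete_pick_pair X k l \<longleftrightarrow>
     (\<forall>n\<ge>1. \<forall>N\<ge>1. \<forall>z :: nat \<Rightarrow> 'x. \<forall>W :: nat \<Rightarrow> complex mat.
        (\<forall>i<n. z i \<in> X) \<and> (\<forall>i<n. W i \<in> carrier_mat N N) \<and>
        psd_mat (n * N) (block_matrix n N (\<lambda>i j.
          l (z i) (z j) \<cdot>\<^sub>m 1\<^sub>m N - k (z i) (z j) \<cdot>\<^sub>m (W i * mat_adjoint (W j)))) \<longrightarrow>
        (\<exists>\<Phi> \<in> Mult X N k l. mult_norm X N k l \<Phi> \<le> 1 \<and> (\<forall>i<n. \<Phi> (z i) = W i)))"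

(* A formal power series in t stands for the series in t = z * cnj w. *)
definition diag_expansion ::
  "real \<Rightarrow> real fps \<Rightarrow> (complex \<Rightarrow> complex \<Rightarrow> complex) \<Rightarrow> bool" where
  "diag_expansion r F k \<longleftrightarrow>
     (\<forall>z \<in> ball 0 r. \<forall>w \<in> ball 0 r.
        (\<lambda>m. complex_of_real (fps_nth F m) * (z * cnj w) ^ m) sums k z w)"

definition normalized_diagonal_holomorphic_kernel ::
  "real \<Rightarrow> real fps \<Rightarrow> (complex \<Rightarrow> complex \<Rightarrow> complex) \<Rightarrow> bool" where
  "normalized_diagonal_holomorphic_kernel r F k \<longleftrightarrow>
     is_kernel (ball 0 r) k \<and>
     (\<forall>w \<in> ball 0 r. (\<lambda>z. k z w) holomorphic_on ball 0 r) \<and>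
     (\<forall>z \<in> ball 0 r. (\<lambda>w. cnj (k z w)) holomorphic_on ball 0 r) \<and>
     diag_expansion r F k \<and> fps_nth F 0 = 1 \<and> (\<forall>m. 0 < fps_nth F m)"

(* f / k \<succeq> 0 for formal power series f and k: the quotient, computed formally, is the expansion of
   a positive kernel on the disc of radius r. *)
definition quotient_positive :: "real \<Rightarrow> real fps \<Rightarrow> real fps \<Rightarrow> bool" where
  "quotient_positive r f k \<longleftrightarrow> (\<exists>q. is_kernel (ball 0 r) q \<and> diag_expansion r (f / k) q)"

(* reduced_series k l m j is the series l_{(m_0, ..., m_j)}. *)
primrec reduced_series :: "real fps \<Rightarrow> real fps \<Rightarrow> (nat \<Rightarrow> nat) \<Rightarrow> nat \<Rightarrow> real fps" where
  "reduced_series k l m 0 = l - fps_const (fps_nth (l / k) (m 0)) * fps_X ^ m 0"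
| "reduced_series k l m (Suc j) =
     reduced_series k l m j -
       fps_const (fps_nth (reduced_series k l m j / k) (m (Suc j))) * fps_X ^ m (Suc j)"

end

theory Submission
  imports Defs
begin

text \<open>
  Kernels in \<open>t = z * cnj w\<close> are identified with their coefficient sequences, and inequalities between
  series are read coefficientwise.  The Pick property and the coefficient conditions are both
  equivalent to the existence of a series \<open>p \<ge> 0\<close> without constant term such that
  \<open>k - 1 \<le> p * k\<close> and \<open>p * l \<le> l - 1\<close>.

  From \<open>p\<close> to the Pick property.  Put \<open>s = (1 - p) * l\<close> and \<open>q = 1 - (1 - p) * k\<close>; both have
  non-negative coefficients.  If \<open>L = l - k W W\<^sup>*\<close> is positive on the interpolation points, then
  \<open>L + W W\<^sup>* = s + p L + q W W\<^sup>*\<close> there.  A factorization \<open>L = G G\<^sup>*\<close> turns this into the equality of two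
  Gram matrices, hence into an isometry between spans of finitely many vectors, and the isometry
  extends to a contraction.  At each \<open>z\<close> of the disc the contraction gives a linear system for the
  row \<open>(G(z), \<Phi>(z))\<close>, which is uniquely solvable because \<open>p\<close> and \<open>q\<close> are less than 1 at
  \<open>\<bar>z\<bar>\<^sup>2\<close>.  The solution satisfies \<open>(1 - p) (l - k \<Phi> \<Phi>\<^sup>* - G G\<^sup>*) \<ge> 0\<close>, and \<open>1 / (1 - p)\<close> is a sum of
  powers of \<open>p\<close>, so \<open>l - k \<Phi> \<Phi>\<^sup>*\<close> is a positive kernel (lemma \<open>complete_pick_extension\<close>).  This
  positivity says that \<open>\<Phi>\<close> is a contractive multiplier (lemma \<open>contractive_multiplier_iff\<close>).

  From the coefficient conditions to \<open>p\<close>.  The quotient \<open>Q\<close> of a reduced series by \<open>k\<close> vanishes at the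
  removed exponents, while \<open>Q * k\<close> agrees with \<open>l\<close> at all others.  Choose the coefficients of \<open>p\<close>
  recursively, each as small as \<open>k - 1 \<le> p * k\<close> permits.  If the removed exponents are those
  \<open>m < n\<close> with \<open>p\<^sub>n\<^sub>-\<^sub>m = 0\<close>, then complementary slackness gives
  \<open>(l - p * l)\<^sub>n = Q\<^sub>n \<ge> 0\<close> (lemma \<open>greedy_fps_product_bound\<close>).

  From the Pick property to the coefficient conditions.  Let \<open>q\<^sub>0, \<dots>, q\<^sub>M\<^sub>-\<^sub>1 \<ge> 0\<close> satisfy
  \<open>(q * k)\<^sub>m \<le> l\<^sub>m\<close> for \<open>m < M\<close>.  The row \<open>(\<surd>q\<^sub>i z\<^sup>i)\<close> is admissible Pick data, up to a factor close to 1, on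
  \<open>M\<close> equidistant points of a small circle about 0.  An extension to the center, tested against the
  vector \<open>(1, \<dots>, 1, -M)\<close>, shows that \<open>q\<close> can be continued by 0, that is, \<open>(q * k)\<^sub>M \<le> l\<^sub>M\<close> for
  \<open>q\<^sub>M = 0\<close> (lemma \<open>complete_pick_pair_imp_coefficient_bound\<close>).  An induction over the
  exponents then yields the positivity of all quotients \<open>Q\<close> at once (lemma
  \<open>quotient_coefficients_bounds\<close>).
\<close>

section \<open>Positive kernels\<close>

text \<open>The points \<open>z i\<close> may repeat, so that positivity is inherited along arbitrary, also
  non-injective, maps of index sets.\<close>

definition pos_kernel :: "'j set \<Rightarrow> ('j \<Rightarrow> 'j \<Rightarrow> complex) \<Rightarrow> bool" where
  "pos_kernel J E \<longleftrightarrow> (\<forall>(n::nat) z c. (\<forall>i<n. z i \<in> J) \<longrightarrow>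
     0 \<le> (\<Sum>i<n. \<Sum>j<n. cnj (c i) * c j * E (z i) (z j)))"

lemma pos_kernelI:
  assumes "\<And>(n::nat) z c. (\<And>i. i < n \<Longrightarrow> z i \<in> J) \<Longrightarrow>
     0 \<le> (\<Sum>i<n. \<Sum>j<n. cnj (c i) * c j * E (z i) (z j))"
  shows "pos_kernel J E"
  using assms unfolding pos_kernel_def by blast

lemma pos_kernelD:
  fixes n :: nat
  assumes "pos_kernel J E" "\<And>i. i < n \<Longrightarrow> z i \<in> J"
  shows "0 \<le> (\<Sum>i<n. \<Sum>j<n. cnj (c i) * c j * E (z i) (z j))"
  using assms unfolding pos_kernel_def by blast

lemma pos_kernel_comp:
  assumes "pos_kernel J E" "\<And>i. i \<in> I \<Longrightarrow> g i \<in> J"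
  shows "pos_kernel I (\<lambda>i j. E (g i) (g j))"
proof (rule pos_kernelI)
  fix n :: nat and z c assume "\<And>i. i < n \<Longrightarrow> z i \<in> I"
  then show "0 \<le> (\<Sum>i<n. \<Sum>j<n. cnj (c i) * c j * E (g (z i)) (g (z j)))"
    using pos_kernelD[OF assms(1), where n=n and z="\<lambda>i. g (z i)" and c=c] assms(2) by simp
qed

lemma pos_kernel_cong:
  assumes "pos_kernel J E" "\<And>i j. i \<in> J \<Longrightarrow> j \<in> J \<Longrightarrow> E i j = F i j"
  shows "pos_kernel J F"
proof (rule pos_kernelI)
  fix n :: nat and z c assume z: "\<And>i. i < n \<Longrightarrow> z i \<in> J"
  have "(\<Sum>i<n. \<Sum>j<n. cnj (c i) * c j * F (z i) (z j)) = (\<Sum>i<n. \<Sum>j<n. cnj (c i) * c j * E (z i) (z j))"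
    by (intro sum.cong refl) (use assms(2) z in auto)
  then show "0 \<le> (\<Sum>i<n. \<Sum>j<n. cnj (c i) * c j * F (z i) (z j))"
    using pos_kernelD[OF assms(1), where n=n and z=z and c=c, OF z] by simp
qed

lemma pos_kernel_add:
  assumes "pos_kernel J E" "pos_kernel J F"
  shows "pos_kernel J (\<lambda>i j. E i j + F i j)"
proof (rule pos_kernelI)
  fix n :: nat and z c assume z: "\<And>i. i < n \<Longrightarrow> z i \<in> J"
  show "0 \<le> (\<Sum>i<n. \<Sum>j<n. cnj (c i) * c j * (E (z i) (z j) + F (z i) (z j)))"
    using add_nonneg_nonneg[OF pos_kernelD[OF assms(1), where n=n and z=z and c=c, OF z] pos_kernelD[OF assms(2), where n=n and z=z and c=c, OF z]]
    by (simp add: ring_distribs sum.distrib)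
qed

text \<open>The multiplication of a kernel by a rank one kernel is a change of the test vector.\<close>

lemma pos_kernel_conj:
  assumes "pos_kernel J E"
  shows "pos_kernel J (\<lambda>i j. f i * cnj (f j) * E i j)"
proof (rule pos_kernelI)
  fix n :: nat and z c assume z: "\<And>i. i < n \<Longrightarrow> z i \<in> J"
  show "0 \<le> (\<Sum>i<n. \<Sum>j<n. cnj (c i) * c j * (f (z i) * cnj (f (z j)) * E (z i) (z j)))"
    using pos_kernelD[OF assms, where n=n and z=z and c="\<lambda>i. c i * cnj (f (z i))", OF z]
    by (simp add: mult_ac)
qed

lemma complex_nonneg_mult_cnj: "0 \<le> z * cnj z"
  by (simp add: complex_mult_cnj less_eq_complex_def)

lemma quadratic_form_rank_one:
  "(\<Sum>i<n. \<Sum>j<n. cnj (c i) * c j * (f i * cnj (f j)))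
    = (\<Sum>i<(n::nat). cnj (c i) * f i) * cnj (\<Sum>i<n. cnj (c i) * f i)"
  unfolding cnj_sum sum_product by (simp add: mult_ac)

lemma pos_kernel_rank_one: "pos_kernel J (\<lambda>i j. f i * cnj (f j))"
  by (rule pos_kernelI) (unfold quadratic_form_rank_one, rule complex_nonneg_mult_cnj)

lemma pos_kernel_zero: "pos_kernel J (\<lambda>i j. 0)"
  by (rule pos_kernelI) simp

lemma pos_kernel_scale:
  assumes "pos_kernel J E" "0 \<le> a"
  shows "pos_kernel J (\<lambda>i j. complex_of_real a * E i j)"
  using pos_kernel_conj[OF assms(1), of "\<lambda>_. complex_of_real (sqrt a)"] assms(2)
  by (simp flip: of_real_mult)

lemma pos_kernel_sum:
  assumes "\<And>a. a \<in> A \<Longrightarrow> pos_kernel J (E a)"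
  shows "pos_kernel J (\<lambda>i j. \<Sum>a\<in>A. E a i j)"
  using assms
  by (induction A rule: infinite_finite_induct) (auto simp: pos_kernel_zero intro: pos_kernel_add)

lemma pos_kernel_limit:
  assumes "\<And>m. pos_kernel J (E m)"
    and "\<And>i j. i \<in> J \<Longrightarrow> j \<in> J \<Longrightarrow> (\<lambda>m. E m i j) \<longlonglongrightarrow> F i j"
  shows "pos_kernel J F"
proof (rule pos_kernelI)
  fix n :: nat and z c assume z: "\<And>i. i < n \<Longrightarrow> z i \<in> J"
  let ?Q = "\<lambda>E. \<Sum>i<n. \<Sum>j<n. cnj (c i) * c j * E (z i) (z j)"
  have lim: "(\<lambda>m. ?Q (E m)) \<longlonglongrightarrow> ?Q F"
    by (intro tendsto_intros assms(2)) (use z in auto)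
  have nn: "0 \<le> ?Q (E m)" for m
    using pos_kernelD[OF assms(1) z] .
  have "0 \<le> Re (?Q F)"
    by (rule LIMSEQ_le_const[OF tendsto_Re[OF lim]]) (use nn in \<open>auto simp: less_eq_complex_def\<close>)
  moreover have "(\<lambda>m. Im (?Q (E m))) = (\<lambda>m. 0)"
    using nn by (simp add: less_eq_complex_def fun_eq_iff)
  then have "Im (?Q F) = 0"
    using LIMSEQ_unique[OF tendsto_Im[OF lim], of 0] by simp
  ultimately show "0 \<le> ?Q F" by (simp add: less_eq_complex_def)
qed

lemma pos_kernel_subset:
  "pos_kernel J E \<Longrightarrow> I \<subseteq> J \<Longrightarrow> pos_kernel I E"
  unfolding pos_kernel_def by blast

lemma pos_kernel_diag:
  assumes "pos_kernel J E" "i \<in> J"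
  shows "0 \<le> E i i"
  using pos_kernelD[OF assms(1), of "Suc 0" "\<lambda>_. i" "\<lambda>_. 1"] assms(2) by simp

lemma pos_kernel_hermitian:
  assumes "pos_kernel J E" "i \<in> J" "j \<in> J"
  shows "E j i = cnj (E i j)"
proof -
  let ?z = "\<lambda>m::nat. if m = 0 then i else j"
  have Q: "0 \<le> (\<Sum>a<2. \<Sum>b<2. cnj (c a) * c b * E (?z a) (?z b))" for c
    by (rule pos_kernelD[OF assms(1)]) (use assms in auto)
  have ii: "Im (E i i) = 0" and jj: "Im (E j j) = 0"
    using pos_kernel_diag[OF assms(1,2)] pos_kernel_diag[OF assms(1,3)] by (auto simp: less_eq_complex_def)
  have "Im (E i j + E j i) = 0"
    using Q[of "\<lambda>_. 1"] ii jj by (simp add: numeral_2_eq_2 less_eq_complex_def)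
  moreover have "Re (E i j) - Re (E j i) = 0"
    using Q[of "\<lambda>m. if m = 0 then 1 else \<i>"] ii jj by (simp add: numeral_2_eq_2 less_eq_complex_def)
  ultimately show ?thesis by (simp add: complex_eq_iff)
qed

text \<open>Cauchy-Schwarz in its weakest form: an element of norm zero is orthogonal to everything.\<close>

lemma pos_kernel_null:
  assumes "pos_kernel J E" "i \<in> J" "j \<in> J" "E j j = 0"
  shows "E i j = 0"
proof (rule ccontr)
  assume ne: "E i j \<noteq> 0"
  define s where "s = (Re (E i i) + 1) / (2 * (cmod (E i j))\<^sup>2)"
  let ?z = "\<lambda>m::nat. if m = 0 then i else j"
  let ?c = "\<lambda>m::nat. if m = 0 then 1 else - complex_of_real s * cnj (E i j)"
  have "0 \<le> (\<Sum>a<2. \<Sum>b<2. cnj (?c a) * ?c b * E (?z a) (?z b))"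
    by (rule pos_kernelD[OF assms(1)]) (use assms in auto)
  then have "0 \<le> Re (E i i) - 2 * s * (cmod (E i j))\<^sup>2"
    using assms(4) pos_kernel_hermitian[OF assms(1-3)]
    by (simp add: numeral_2_eq_2 less_eq_complex_def cmod_def algebra_simps)
  moreover have "2 * s * (cmod (E i j))\<^sup>2 = Re (E i i) + 1"
    using ne by (simp add: s_def)
  ultimately show False by linarith
qed

text \<open>One step of the Cholesky algorithm: the Schur complement with respect to one point.  The test
  vector is completed by the coefficient at the pivot that minimizes the quadratic form.\<close>

lemma pos_kernel_schur_complement:
  assumes E: "pos_kernel J E" and b: "b \<in> J" and ne: "E b b \<noteq> 0"
  shows "pos_kernel J (\<lambda>i j. E i j - E i b * E b j / E b b)"
proof (rule pos_kernelI)
  fix n :: nat and z c assume z: "\<And>i. i < n \<Longrightarrow> z i \<in> J"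
  define s where "s = (\<Sum>j<n. c j * E b (z j))"
  have s': "cnj s = (\<Sum>i<n. cnj (c i) * E (z i) b)"
    unfolding s_def cnj_sum complex_cnj_mult
    by (intro sum.cong refl) (use pos_kernel_hermitian[OF E b z] in auto)
  define e where "e = E b b"
  have e: "cnj e = e" "e \<noteq> 0"
    using pos_kernel_hermitian[OF E b b] ne by (simp_all add: e_def)
  define z' where "z' = z(n := b)"
  define c' where "c' = c(n := - s / e)"
  have "0 \<le> (\<Sum>i<Suc n. \<Sum>j<Suc n. cnj (c' i) * c' j * E (z' i) (z' j))"
    by (rule pos_kernelD[OF E]) (use z b in \<open>auto simp: z'_def less_Suc_eq\<close>)
  also have "\<dots> = (\<Sum>i<n. \<Sum>j<n. cnj (c i) * c j * E (z i) (z j))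
      + (\<Sum>i<n. cnj (c i) * (- s / e) * E (z i) b) + (\<Sum>j<n. cnj (- s / e) * c j * E b (z j))
      + cnj (- s / e) * (- s / e) * e"
    by (simp add: z'_def c'_def sum.distrib sum_subtractf sum_negf e_def)
  also have "(\<Sum>i<n. cnj (c i) * (- s / e) * E (z i) b) = (- s / e) * cnj s"
    unfolding s' sum_distrib_left by (simp add: mult_ac)
  also have "(\<Sum>j<n. cnj (- s / e) * c j * E b (z j)) = cnj (- s / e) * s"
    unfolding s_def sum_distrib_left by (simp add: mult_ac)
  also have "(\<Sum>i<n. \<Sum>j<n. cnj (c i) * c j * E (z i) (z j)) + (- s / e) * cnj s + cnj (- s / e) * s
      + cnj (- s / e) * (- s / e) * e
     = (\<Sum>i<n. \<Sum>j<n. cnj (c i) * c j * E (z i) (z j)) - cnj s * s / e"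
    using e by (simp add: field_simps)
  also have "cnj s * s / e = (\<Sum>i<n. \<Sum>j<n. cnj (c i) * c j * (E (z i) b * E b (z j) / e))"
    unfolding s' unfolding s_def sum_product sum_divide_distrib by (simp add: mult_ac)
  finally show "0 \<le> (\<Sum>i<n. \<Sum>j<n. cnj (c i) * c j * (E (z i) (z j) - E (z i) b * E b (z j) / E b b))"
    by (simp add: e_def right_diff_distrib sum_subtractf)
qed

text \<open>The Cholesky algorithm: every point of \<open>B\<close> splits off one coordinate by a Schur complement, and a
  point of norm zero splits off the coordinate zero.\<close>

lemma pos_kernel_gram_factorization:
  assumes "finite B" "pos_kernel B E"
  shows "\<exists>G :: 'j \<Rightarrow> nat \<Rightarrow> complex. \<forall>b\<in>B. \<forall>b'\<in>B. E b b' = (\<Sum>g<card B. G b g * cnj (G b' g))"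
  using assms
proof (induction B arbitrary: E rule: finite_induct)
  case empty
  then show ?case by simp
next
  case (insert b0 B)
  define e where "e = E b0 b0"
  have herm: "E b b' = cnj (E b' b)" if "b \<in> insert b0 B" "b' \<in> insert b0 B" for b b'
    using pos_kernel_hermitian[OF insert.prems] that by blast
  show ?case
  proof (cases "e = 0")
    case True
    have "E b b0 = 0" "E b0 b = 0" if "b \<in> insert b0 B" for b
      using pos_kernel_null[OF insert.prems that insertI1] True herm[OF insertI1 that] by (auto simp: e_def)
    moreover obtain G where "\<forall>b\<in>B. \<forall>b'\<in>B. E b b' = (\<Sum>g<card B. G b g * cnj (G b' g))"
      using insert.IH pos_kernel_subset[OF insert.prems] by blast
    ultimately show ?thesis
      using insert.hyps
      by (intro exI[of _ "\<lambda>b g. if b = b0 \<or> g = card B then 0 else G b g"]) (auto intro!: sum.cong)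
  next
    case False
    define th where "th b = E b b0 / complex_of_real (sqrt (Re e))" for b
    have e0: "0 \<le> e"
      unfolding e_def by (rule pos_kernel_diag[OF insert.prems]) simp
    then have e: "complex_of_real (sqrt (Re e)) * complex_of_real (sqrt (Re e)) = e"
      by (simp add: less_eq_complex_def complex_eq_iff)
    have th: "th b * cnj (th b') = E b b0 * E b0 b' / e" if "b \<in> insert b0 B" "b' \<in> insert b0 B" for b b'
      using herm[OF insertI1 that(2)] e by (simp add: th_def)
    obtain G where G: "\<forall>b\<in>B. \<forall>b'\<in>B. E b b' - E b b0 * E b0 b' / E b0 b0 = (\<Sum>g<card B. G b g * cnj (G b' g))"
      using insert.IH pos_kernel_subset[OF pos_kernel_schur_complement[OF insert.prems insertI1]] False
      unfolding e_def by blast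
    have "E b b' = (\<Sum>g<Suc (card B). (if g = card B then th b else if b = b0 then 0 else G b g)
              * cnj (if g = card B then th b' else if b' = b0 then 0 else G b' g))"
      if b: "b \<in> insert b0 B" and b': "b' \<in> insert b0 B" for b b'
    proof (cases "b = b0 \<or> b' = b0")
      case True
      then show ?thesis using th[OF b b'] False by (auto simp: e_def)
    next
      case f: False
      then have "E b b' - E b b0 * E b0 b' / e = (\<Sum>g<card B. G b g * cnj (G b' g))"
        using G b b' by (simp add: e_def)
      then show ?thesis
        using f th[OF b b'] by (simp add: algebra_simps)
    qed
    then show ?thesis
      using insert.hyps by (intro exI[of _ "\<lambda>b g. if g = card B then th b else if b = b0 then 0 else G b g"]) auto
  qed
qed

section \<open>Extension of isometries\<close>

definition herm :: "nat \<Rightarrow> (nat \<Rightarrow> complex) \<Rightarrow> (nat \<Rightarrow> complex) \<Rightarrow> complex" where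
  "herm d x y = (\<Sum>g<d. x g * cnj (y g))"

lemma herm_add_left: "herm d (\<lambda>g. x g + y g) z = herm d x z + herm d y z"
  and herm_diff_left: "herm d (\<lambda>g. x g - y g) z = herm d x z - herm d y z"
  and herm_scale_left: "herm d (\<lambda>g. a * x g) z = a * herm d x z"
  and herm_add_right: "herm d z (\<lambda>g. x g + y g) = herm d z x + herm d z y"
  and herm_diff_right: "herm d z (\<lambda>g. x g - y g) = herm d z x - herm d z y"
  and herm_scale_right: "herm d z (\<lambda>g. a * x g) = cnj a * herm d z x"
  by (simp_all add: herm_def algebra_simps sum.distrib sum_subtractf sum_distrib_left)

lemma herm_divide_left: "herm d (\<lambda>g. x g / a) z = herm d x z / a"
  and herm_divide_right: "herm d z (\<lambda>g. x g / a) = herm d z x / cnj a"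
  by (simp_all add: herm_def sum_divide_distrib)

lemma herm_sum_left: "herm d (\<lambda>g. \<Sum>b\<in>B. f b g) z = (\<Sum>b\<in>B. herm d (f b) z)"
  unfolding herm_def by (subst sum.swap) (simp add: sum_distrib_right)

lemma herm_cong: "(\<And>g. g < d \<Longrightarrow> x g = x' g) \<Longrightarrow> (\<And>g. g < d \<Longrightarrow> y g = y' g) \<Longrightarrow> herm d x y = herm d x' y'"
  unfolding herm_def by simp

lemma cnj_herm: "cnj (herm d x y) = herm d y x"
  by (simp add: herm_def mult_ac)

lemma herm_self: "herm d x x = complex_of_real (\<Sum>g<d. (cmod (x g))\<^sup>2)"
  by (simp add: herm_def complex_norm_square del: of_real_power)

lemma herm_self_eq_0_iff: "herm d x x = 0 \<longleftrightarrow> (\<forall>g<d. x g = 0)"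
  unfolding herm_self of_real_eq_0_iff by (subst sum_nonneg_eq_0_iff) auto

lemma pos_kernel_herm: "pos_kernel J (\<lambda>i j. herm d (f i) (f j))"
  unfolding herm_def by (intro pos_kernel_sum pos_kernel_rank_one)

text \<open>The kernel \<open>E\<close> is read as the Gram kernel of vectors \<open>e i\<close> of a Hilbert space that stays in the
  background.  Equality of Gram matrices on \<open>B\<close> makes \<open>e b \<mapsto> X b\<close> isometric on the span of
  these vectors; preceded by the orthogonal projection onto the span it becomes a contraction, whose
  value at \<open>e i\<close> is \<open>\<Sum>b\<in>B. E i b * \<beta> b\<close>.  This formula exhibits the value as a linear function of
  \<open>e i\<close>, which serves to solve equations for it.

  The proof is a Gram-Schmidt induction over \<open>B\<close>.  The last conclusion places the vectors \<open>\<beta> b\<close> in the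
  span of the vectors \<open>X b\<close>; it makes the mixed terms vanish when a new direction is added.\<close>

lemma isometry_extension:
  fixes X :: "'j \<Rightarrow> nat \<Rightarrow> complex"
  assumes "finite B" "B \<subseteq> J" "pos_kernel J E"
    and "\<And>b b'. b \<in> B \<Longrightarrow> b' \<in> B \<Longrightarrow> herm d (X b) (X b') = E b b'"
  shows "\<exists>\<beta>. (\<forall>b\<in>B. \<forall>g<d. (\<Sum>b'\<in>B. E b b' * \<beta> b' g) = X b g)
    \<and> pos_kernel J (\<lambda>i j. E i j - herm d (\<lambda>g. \<Sum>b\<in>B. E i b * \<beta> b g) (\<lambda>g. \<Sum>b\<in>B. E j b * \<beta> b g))
    \<and> (\<forall>v. (\<forall>b\<in>B. herm d (X b) v = 0) \<longrightarrow> (\<forall>b\<in>B. herm d (\<beta> b) v = 0))"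
  using assms
proof (induction B arbitrary: E X rule: finite_induct)
  case empty
  then show ?case by (simp add: herm_def)
next
  case (insert b0 B)
  note E = insert.prems(2) and gram = insert.prems(3)
  have BJ: "B \<subseteq> J" and b0: "b0 \<in> J" using insert.prems(1) by auto
  define e where "e = E b0 b0"
  have adj: "E b b' = cnj (E b' b)" if "b \<in> J" "b' \<in> J" for b b'
    using pos_kernel_hermitian[OF E that(2,1)] .
  show ?case
  proof (cases "e = 0")
    case True
    have col: "E j b0 = 0" "E b0 j = 0" if "j \<in> J" for j
      using pos_kernel_null[OF E that b0] True adj[OF b0 that] by (auto simp: e_def)
    have Xb0: "X b0 g = 0" if "g < d" for g
      using gram[of b0 b0] True that herm_self_eq_0_iff[of d "X b0"] by (auto simp: e_def)
    obtain \<beta> where \<beta>: "\<forall>b\<in>B. \<forall>g<d. (\<Sum>b'\<in>B. E b b' * \<beta> b' g) = X b g"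
      "pos_kernel J (\<lambda>i j. E i j - herm d (\<lambda>g. \<Sum>b\<in>B. E i b * \<beta> b g) (\<lambda>g. \<Sum>b\<in>B. E j b * \<beta> b g))"
      "\<And>v. \<forall>b\<in>B. herm d (X b) v = 0 \<Longrightarrow> \<forall>b\<in>B. herm d (\<beta> b) v = 0"
      using insert.IH[of E X, OF BJ E] gram by blast
    define \<beta>' where "\<beta>' b = (if b = b0 then (\<lambda>_. 0) else \<beta> b)" for b
    have red: "(\<Sum>b\<in>insert b0 B. E i b * \<beta>' b g) = (\<Sum>b\<in>B. E i b * \<beta> b g)" for i g
    proof -
      have "(\<Sum>b\<in>B. E i b * \<beta>' b g) = (\<Sum>b\<in>B. E i b * \<beta> b g)"
        by (intro sum.cong refl) (use insert.hyps in \<open>auto simp: \<beta>'_def\<close>)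
      then show ?thesis using insert.hyps by (simp add: \<beta>'_def)
    qed
    have "(\<Sum>b'\<in>B. E b0 b' * \<beta> b' g) = 0" for g
      by (intro sum.neutral) (use col BJ in auto)
    then have 1: "\<forall>b\<in>insert b0 B. \<forall>g<d. (\<Sum>b'\<in>insert b0 B. E b b' * \<beta>' b' g) = X b g"
      unfolding red using \<beta>(1) Xb0 by auto
    have 3: "herm d (\<beta>' b) v = 0" if "\<forall>b\<in>insert b0 B. herm d (X b) v = 0" "b \<in> insert b0 B" for v b
      using \<beta>(3)[of v] that by (auto simp: \<beta>'_def herm_def)
    show ?thesis
      by (rule exI[of _ \<beta>']) (use 1 3 \<beta>(2) red in auto)
  next
    case False
    define s where "s = complex_of_real (sqrt (Re e))"
    have "0 \<le> e"
      unfolding e_def by (rule pos_kernel_diag[OF E b0])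
    then have ss: "s * s = e"
      by (simp add: s_def less_eq_complex_def complex_eq_iff)
    then have s: "cnj s = s" "s \<noteq> 0" using False by (auto simp: s_def)
    define u where "u g = X b0 g / s" for g
    define \<theta> where "\<theta> j = E j b0 / s" for j
    have \<theta>\<theta>: "\<theta> i * cnj (\<theta> j) = E i b0 * E b0 j / e" if "j \<in> J" for i j
      using adj[OF b0 that] s by (simp add: \<theta>_def flip: ss)
    have Xu: "herm d (X b) u = \<theta> b" if "b \<in> insert b0 B" for b
      using gram[OF that insertI1] s by (simp add: u_def[abs_def] herm_divide_right \<theta>_def)
    have uu: "herm d u u = 1"
      using gram[of b0 b0] s(1) False unfolding u_def[abs_def] herm_divide_left herm_divide_right
      by (simp add: e_def[symmetric] ss)
    \<comment> \<open>\<open>E'\<close> is the Gram kernel of the components of the \<open>e i\<close> orthogonal to \<open>e b0\<close>, which corresponds to \<open>u\<close>.\<close>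
    define E' where "E' i j = E i j - E i b0 * E b0 j / E b0 b0" for i j
    have E': "pos_kernel J E'"
      unfolding E'_def[abs_def] using pos_kernel_schur_complement[OF E b0] False by (simp add: e_def)
    have E'_eq: "E' i j = E i j - \<theta> i * cnj (\<theta> j)" if "j \<in> J" for i j
      using \<theta>\<theta>[OF that] by (simp add: E'_def e_def)
    define X' where "X' b g = X b g - \<theta> b * u g" for b g
    have uX: "herm d u (X b) = cnj (\<theta> b)" if "b \<in> insert b0 B" for b
      using Xu[OF that] cnj_herm by metis
    have gram': "herm d (X' b) (X' b') = E' b b'" if "b \<in> B" "b' \<in> B" for b b'
      unfolding X'_def[abs_def] herm_diff_left herm_diff_right herm_scale_left herm_scale_right
      using that gram[of b b'] Xu[of b] uX[of b'] uu BJ by (simp add: E'_eq subset_iff)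
    obtain \<beta> where \<beta>: "\<forall>b\<in>B. \<forall>g<d. (\<Sum>b'\<in>B. E' b b' * \<beta> b' g) = X' b g"
      "pos_kernel J (\<lambda>i j. E' i j - herm d (\<lambda>g. \<Sum>b\<in>B. E' i b * \<beta> b g) (\<lambda>g. \<Sum>b\<in>B. E' j b * \<beta> b g))"
      "\<And>v. \<forall>b\<in>B. herm d (X' b) v = 0 \<Longrightarrow> \<forall>b\<in>B. herm d (\<beta> b) v = 0"
      using insert.IH[of E' X', OF BJ E' gram'] by blast
    have \<beta>u: "herm d (\<beta> b) u = 0" if "b \<in> B" for b
      using \<beta>(3)[of u] that
      by (simp add: X'_def[abs_def] herm_diff_left herm_scale_left Xu uu)
    define Y' where "Y' i g = (\<Sum>b\<in>B. E' i b * \<beta> b g)" for i g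
    define \<beta>' where "\<beta>' b = (if b = b0 then (\<lambda>g. u g / s - (\<Sum>b\<in>B. E b0 b / e * \<beta> b g)) else \<beta> b)" for b
    have Y: "(\<Sum>b\<in>insert b0 B. E i b * \<beta>' b g) = Y' i g + \<theta> i * u g" for i g
    proof -
      have "(\<Sum>b\<in>B. E i b * \<beta>' b g) = (\<Sum>b\<in>B. E i b * \<beta> b g)"
        by (intro sum.cong refl) (use insert.hyps in \<open>auto simp: \<beta>'_def\<close>)
      then have "(\<Sum>b\<in>insert b0 B. E i b * \<beta>' b g)
          = \<theta> i * u g + ((\<Sum>b\<in>B. E i b * \<beta> b g) - E i b0 * (\<Sum>b\<in>B. E b0 b / e * \<beta> b g))"
        using insert.hyps by (simp add: \<beta>'_def \<theta>_def algebra_simps)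
      also have "(\<Sum>b\<in>B. E i b * \<beta> b g) - E i b0 * (\<Sum>b\<in>B. E b0 b / e * \<beta> b g) = Y' i g"
        unfolding Y'_def E'_def sum_distrib_left sum_subtractf[symmetric] e_def
        by (intro sum.cong refl) (simp add: algebra_simps)
      finally show ?thesis by simp
    qed
    have Y'u: "herm d (Y' i) u = 0" for i
      unfolding Y'_def[abs_def] herm_sum_left herm_scale_left by (simp add: \<beta>u)
    have uY': "herm d u (Y' i) = 0" for i
      using Y'u[of i] cnj_herm[of d "Y' i" u] by simp
    have 1: "(\<Sum>b'\<in>insert b0 B. E b b' * \<beta>' b' g) = X b g" if b: "b \<in> insert b0 B" and g: "g < d" for b g
    proof (cases "b = b0")
      case True
      have "E' b0 b' = 0" for b' using False by (simp add: E'_def e_def)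
      then have "Y' b0 g = 0" by (simp add: Y'_def)
      moreover have "\<theta> b0 * u g = X b0 g" using s(2) by (simp add: \<theta>_def u_def e_def[symmetric] flip: ss)
      ultimately show ?thesis unfolding Y True by simp
    next
      case f: False
      then have "Y' b g = X' b g" using \<beta>(1) b g by (simp add: Y'_def)
      then show ?thesis unfolding Y by (simp add: X'_def)
    qed
    have "pos_kernel J (\<lambda>i j. E i j - herm d (\<lambda>g. Y' i g + \<theta> i * u g) (\<lambda>g. Y' j g + \<theta> j * u g))"
    proof (rule pos_kernel_cong[OF \<beta>(2)])
      fix i j assume "i \<in> J" "j \<in> J"
      then show "E' i j - herm d (\<lambda>g. \<Sum>b\<in>B. E' i b * \<beta> b g) (\<lambda>g. \<Sum>b\<in>B. E' j b * \<beta> b g)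
          = E i j - herm d (\<lambda>g. Y' i g + \<theta> i * u g) (\<lambda>g. Y' j g + \<theta> j * u g)"
        by (simp add: E'_eq herm_add_left herm_add_right herm_scale_left herm_scale_right Y'u uY' uu
              flip: Y'_def)
    qed
    then have 2: "pos_kernel J (\<lambda>i j. E i j - herm d (\<lambda>g. \<Sum>b\<in>insert b0 B. E i b * \<beta>' b g)
        (\<lambda>g. \<Sum>b\<in>insert b0 B. E j b * \<beta>' b g))"
      unfolding Y .
    have 3: "herm d (\<beta>' b) v = 0" if v: "\<forall>b\<in>insert b0 B. herm d (X b) v = 0" and b: "b \<in> insert b0 B" for v b
    proof -
      have uv: "herm d u v = 0" using v by (simp add: u_def[abs_def] herm_divide_left)
      have \<beta>v: "herm d (\<beta> b) v = 0" if "b \<in> B" for b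
        using \<beta>(3)[of v] v uv that by (simp add: X'_def[abs_def] herm_diff_left herm_scale_left)
      have "herm d (\<beta>' b0) v = herm d u v / s - (\<Sum>b\<in>B. E b0 b / e * herm d (\<beta> b) v)"
        unfolding \<beta>'_def by (simp only: simp_thms if_True herm_diff_left herm_sum_left herm_scale_left herm_divide_left)
      then have "herm d (\<beta>' b0) v = 0"
        using uv \<beta>v by simp
      then show ?thesis using \<beta>v b insert.hyps by (cases "b = b0") (auto simp: \<beta>'_def)
    qed
    show ?thesis
      by (rule exI[of _ \<beta>']) (use 1 2 3 in blast)
  qed
qed

section \<open>Power series in one diagonal variable\<close>

text \<open>The coefficients are real, whereas the functions are evaluated at complex \<open>t\<close>.\<close>

definition complex_fps :: "real fps \<Rightarrow> complex fps" where
  "complex_fps F = Abs_fps (\<lambda>m. complex_of_real (fps_nth F m))"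

definition diag_eval :: "real fps \<Rightarrow> complex \<Rightarrow> complex" where
  "diag_eval F t = eval_fps (complex_fps F) t"

text \<open>The products \<open>z * cnj w\<close> with \<open>z\<close> and \<open>w\<close> in the disc of radius \<open>r\<close> fill the disc of radius \<open>r\<^sup>2\<close>.\<close>

definition converges_on :: "real \<Rightarrow> real fps \<Rightarrow> bool" where
  "converges_on r F \<longleftrightarrow> (\<forall>x. 0 \<le> x \<longrightarrow> x < r\<^sup>2 \<longrightarrow> summable (\<lambda>m. \<bar>fps_nth F m\<bar> * x ^ m))"

lemma converges_on_dominated:
  assumes "converges_on r F" "\<And>m. \<bar>fps_nth G m\<bar> \<le> \<bar>fps_nth F m\<bar>"
  shows "converges_on r G"
  unfolding converges_on_def
proof (intro allI impI)
  fix x :: real assume x: "0 \<le> x" "x < r\<^sup>2"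
  show "summable (\<lambda>m. \<bar>fps_nth G m\<bar> * x ^ m)"
    by (rule summable_comparison_test'[of "\<lambda>m. \<bar>fps_nth F m\<bar> * x ^ m" 0])
      (use assms x in \<open>auto simp: converges_on_def intro!: mult_right_mono\<close>)
qed

lemma converges_on_conv_radius:
  assumes "converges_on r F" "0 < r"
  shows "ereal (r\<^sup>2) \<le> fps_conv_radius (complex_fps F)"
  unfolding fps_conv_radius_def
proof (rule conv_radius_geI_ex')
  fix x assume x: "0 < x" "ereal x < ereal (r\<^sup>2)"
  then have "summable (\<lambda>m. \<bar>fps_nth F m\<bar> * x ^ m)"
    using assms by (auto simp: converges_on_def)
  then have "summable (\<lambda>n. norm (fps_nth (complex_fps F) n * complex_of_real x ^ n))"
    using x by (simp add: complex_fps_def norm_mult norm_power)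
  then show "summable (\<lambda>n. fps_nth (complex_fps F) n * complex_of_real x ^ n)"
    by (rule summable_norm_cancel)
qed

lemma converges_onI_conv_radius:
  assumes "ereal (r\<^sup>2) \<le> fps_conv_radius (complex_fps F)"
  shows "converges_on r F"
  unfolding converges_on_def
proof (intro allI impI)
  fix x :: real assume x: "0 \<le> x" "x < r\<^sup>2"
  have "ereal (cmod (complex_of_real x)) < fps_conv_radius (complex_fps F)"
    by (rule less_le_trans[OF _ assms]) (use x in auto)
  then have "summable (\<lambda>n. norm (fps_nth (complex_fps F) n * complex_of_real x ^ n))"
    unfolding fps_conv_radius_def by (rule abs_summable_in_conv_radius)
  then show "summable (\<lambda>m. \<bar>fps_nth F m\<bar> * x ^ m)"
    using x by (simp add: complex_fps_def norm_mult norm_power)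
qed

lemma complex_fps_mult: "complex_fps (F * G) = complex_fps F * complex_fps G"
  by (rule fps_ext) (simp add: complex_fps_def fps_mult_nth)

lemma complex_fps_diff: "complex_fps (F - G) = complex_fps F - complex_fps G"
  and complex_fps_1: "complex_fps 1 = 1"
  by (rule fps_ext, simp add: complex_fps_def)+

lemma converges_on_mult:
  assumes "converges_on r F" "converges_on r G" "0 < r"
  shows "converges_on r (F * G)"
  by (rule converges_onI_conv_radius, unfold complex_fps_mult, rule order.trans[OF _ fps_conv_radius_mult])
    (use assms converges_on_conv_radius in auto)

lemma converges_on_diff:
  assumes "converges_on r F" "converges_on r G" "0 < r"
  shows "converges_on r (F - G)"
  by (rule converges_onI_conv_radius, unfold complex_fps_diff, rule order.trans[OF _ fps_conv_radius_diff])
    (use assms converges_on_conv_radius in auto)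

lemma converges_on_1: "converges_on r 1"
  by (rule converges_onI_conv_radius) (simp add: complex_fps_1)

lemma norm_diag_less:
  assumes "z \<in> ball 0 r" "w \<in> ball 0 r"
  shows "cmod (z * cnj w) < r\<^sup>2"
  using mult_strict_mono'[of "cmod z" r "cmod w" r] assms by (simp add: norm_mult power2_eq_square)

lemma diag_eval_sums:
  assumes "converges_on r F" "0 < r" "cmod t < r\<^sup>2"
  shows "(\<lambda>m. complex_of_real (fps_nth F m) * t ^ m) sums diag_eval F t"
proof -
  have "ereal (cmod t) < fps_conv_radius (complex_fps F)"
    using converges_on_conv_radius[OF assms(1,2)] assms(3) by (meson ereal_less_le less_ereal.simps(1) less_le_trans)
  from sums_eval_fps[OF this] show ?thesis by (simp add: complex_fps_def diag_eval_def)
qed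

lemma diag_eval_mult:
  assumes "converges_on r F" "converges_on r G" "0 < r" "cmod t < r\<^sup>2"
  shows "diag_eval (F * G) t = diag_eval F t * diag_eval G t"
  unfolding diag_eval_def complex_fps_mult
  by (rule eval_fps_mult; rule less_le_trans[of _ "ereal (r\<^sup>2)"])
    (use assms converges_on_conv_radius in auto)

lemma diag_eval_diff:
  assumes "converges_on r F" "converges_on r G" "0 < r" "cmod t < r\<^sup>2"
  shows "diag_eval (F - G) t = diag_eval F t - diag_eval G t"
  unfolding diag_eval_def complex_fps_diff
  by (rule eval_fps_diff; rule less_le_trans[of _ "ereal (r\<^sup>2)"])
    (use assms converges_on_conv_radius in auto)

lemma diag_eval_1: "diag_eval 1 t = 1"
  by (simp add: diag_eval_def complex_fps_1)

lemma diag_expansion_eval: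
  assumes "diag_expansion r F k" "converges_on r F" "0 < r" "z \<in> ball 0 r" "w \<in> ball 0 r"
  shows "k z w = diag_eval F (z * cnj w)"
  using diag_eval_sums[OF assms(2,3) norm_diag_less[OF assms(4,5)]] assms(1,4,5) sums_unique2
  unfolding diag_expansion_def by blast

text \<open>Convergence at \<open>z = w = \<surd>y\<close> implies absolute convergence at all smaller \<open>x\<close>.\<close>

lemma diag_expansion_converges:
  assumes "diag_expansion r F k" "0 < r"
  shows "converges_on r F"
  unfolding converges_on_def
proof (intro allI impI)
  fix x :: real assume x: "0 \<le> x" "x < r\<^sup>2"
  obtain y where y: "x < y" "y < r\<^sup>2" using dense x(2) by blast
  have "sqrt y < r" using y x assms(2) by (metis abs_of_pos real_sqrt_abs real_sqrt_less_iff)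
  then have "complex_of_real (sqrt y) \<in> ball 0 r" using x y by simp
  moreover have "complex_of_real (sqrt y) * cnj (complex_of_real (sqrt y)) = complex_of_real y"
    using x y by (simp flip: of_real_mult)
  ultimately have "summable (\<lambda>m. complex_of_real (fps_nth F m) * complex_of_real y ^ m)"
    using assms(1) unfolding diag_expansion_def by (metis sums_summable)
  then have "summable (\<lambda>m. norm (complex_of_real (fps_nth F m) * complex_of_real x ^ m))"
    by (rule powser_insidea) (use x y in auto)
  then show "summable (\<lambda>m. \<bar>fps_nth F m\<bar> * x ^ m)"
    using x by (simp add: norm_mult norm_power)
qed

text \<open>Multiplication by a monomial \<open>(z * cnj w) ^ m\<close> is a congruence; non-negative combinations and limits
  of congruences preserve positivity.\<close>

lemma pos_kernel_diag_mult:
  assumes "converges_on r F" "0 < r" "\<And>m. 0 \<le> fps_nth F m" "pos_kernel J A"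
    and "\<And>i. i \<in> J \<Longrightarrow> \<zeta> i \<in> ball 0 r"
  shows "pos_kernel J (\<lambda>i j. diag_eval F (\<zeta> i * cnj (\<zeta> j)) * A i j)"
proof (rule pos_kernel_limit)
  fix M
  have "pos_kernel J (\<lambda>i j. \<Sum>m<M. complex_of_real (fps_nth F m) * (\<zeta> i ^ m * cnj (\<zeta> j ^ m) * A i j))"
    by (intro pos_kernel_sum pos_kernel_scale pos_kernel_conj assms)
  then show "pos_kernel J (\<lambda>i j. (\<Sum>m<M. complex_of_real (fps_nth F m) * (\<zeta> i * cnj (\<zeta> j)) ^ m) * A i j)"
    unfolding sum_distrib_right power_mult_distrib by (simp add: mult_ac)
next
  fix i j assume "i \<in> J" "j \<in> J"
  then show "(\<lambda>M. (\<Sum>m<M. complex_of_real (fps_nth F m) * (\<zeta> i * cnj (\<zeta> j)) ^ m) * A i j)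
      \<longlonglongrightarrow> diag_eval F (\<zeta> i * cnj (\<zeta> j)) * A i j"
    using diag_eval_sums[OF assms(1,2) norm_diag_less] assms(5)
    by (intro tendsto_mult tendsto_const) (simp add: sums_def)
qed

lemma norm_diag_eval_le:
  assumes "converges_on r F" "0 < r" "\<And>m. 0 \<le> fps_nth F m" "cmod t < r\<^sup>2"
  shows "cmod (diag_eval F t) \<le> Re (diag_eval F (complex_of_real (cmod t)))"
proof -
  have s: "summable (\<lambda>m. fps_nth F m * cmod t ^ m)"
    using assms(1)[unfolded converges_on_def, rule_format, OF norm_ge_zero assms(4)]
    by (simp add: abs_of_nonneg[OF assms(3)])
  have "(\<lambda>m. complex_of_real (fps_nth F m * cmod t ^ m)) sums diag_eval F (complex_of_real (cmod t))"
    using diag_eval_sums[OF assms(1,2), of "complex_of_real (cmod t)"] assms(4) by simp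
  moreover have "(\<lambda>m. complex_of_real (fps_nth F m * cmod t ^ m)) sums complex_of_real (\<Sum>m. fps_nth F m * cmod t ^ m)"
    using s by (intro sums_of_real summable_sums)
  ultimately have *: "diag_eval F (complex_of_real (cmod t)) = complex_of_real (\<Sum>m. fps_nth F m * cmod t ^ m)"
    by (rule sums_unique2)
  have "diag_eval F t = (\<Sum>m. complex_of_real (fps_nth F m) * t ^ m)"
    using diag_eval_sums[OF assms(1,2,4)] by (simp add: sums_iff)
  also have "cmod \<dots> \<le> (\<Sum>m. fps_nth F m * cmod t ^ m)"
    by (rule norm_suminf_le[OF _ s]) (use assms(3) in \<open>simp add: norm_mult norm_power\<close>)
  finally show ?thesis using * by simp
qed

text \<open>If the norm of the multiplier is below one, then \<open>1 / (1 - f)\<close> is a geometric series.\<close>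

lemma pos_kernel_divide_one_minus:
  assumes "converges_on r F" "0 < r" "\<And>m. 0 \<le> fps_nth F m" "pos_kernel J A"
    and "\<And>i. i \<in> J \<Longrightarrow> \<zeta> i \<in> ball 0 r"
    and "\<And>i j. i \<in> J \<Longrightarrow> j \<in> J \<Longrightarrow> cmod (diag_eval F (\<zeta> i * cnj (\<zeta> j))) < 1"
  shows "pos_kernel J (\<lambda>i j. A i j / (1 - diag_eval F (\<zeta> i * cnj (\<zeta> j))))"
proof (rule pos_kernel_limit)
  fix M
  have pw: "pos_kernel J (\<lambda>i j. diag_eval F (\<zeta> i * cnj (\<zeta> j)) ^ m * A i j)" for m
  proof (induction m)
    case (Suc m)
    show ?case
      using pos_kernel_diag_mult[OF assms(1-3) Suc, where \<zeta> = \<zeta>] assms(5) by (simp add: mult_ac)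
  qed (simp add: assms(4))
  show "pos_kernel J (\<lambda>i j. \<Sum>m<M. diag_eval F (\<zeta> i * cnj (\<zeta> j)) ^ m * A i j)"
    by (intro pos_kernel_sum pw)
next
  fix i j assume ij: "i \<in> J" "j \<in> J"
  have "(\<lambda>M. \<Sum>m<M. diag_eval F (\<zeta> i * cnj (\<zeta> j)) ^ m) \<longlonglongrightarrow> 1 / (1 - diag_eval F (\<zeta> i * cnj (\<zeta> j)))"
    using geometric_sums[OF assms(6)[OF ij]] by (simp add: sums_def)
  from tendsto_mult_right[OF this, of "A i j"]
  show "(\<lambda>M. \<Sum>m<M. diag_eval F (\<zeta> i * cnj (\<zeta> j)) ^ m * A i j)
      \<longlonglongrightarrow> A i j / (1 - diag_eval F (\<zeta> i * cnj (\<zeta> j)))"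
    by (simp add: sum_distrib_right)
qed

lemma diag_eval_of_real:
  assumes "converges_on r F" "0 < r" "0 \<le> x" "x < r\<^sup>2"
  shows "diag_eval F (complex_of_real x) = complex_of_real (\<Sum>m. fps_nth F m * x ^ m)"
    and "summable (\<lambda>m. fps_nth F m * x ^ m)"
proof -
  show s: "summable (\<lambda>m. fps_nth F m * x ^ m)"
    by (rule summable_norm_cancel)
      (use assms(1)[unfolded converges_on_def, rule_format, OF assms(3,4)] assms(3) in \<open>simp add: abs_mult\<close>)
  have "(\<lambda>m. complex_of_real (fps_nth F m * x ^ m)) sums diag_eval F (complex_of_real x)"
    using diag_eval_sums[OF assms(1,2), of "complex_of_real x"] assms(3,4) by simp
  moreover have "(\<lambda>m. complex_of_real (fps_nth F m * x ^ m)) sums complex_of_real (\<Sum>m. fps_nth F m * x ^ m)"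
    by (rule sums_of_real[OF summable_sums[OF s]])
  ultimately show "diag_eval F (complex_of_real x) = complex_of_real (\<Sum>m. fps_nth F m * x ^ m)"
    by (rule sums_unique2)
qed

lemma diag_eval_ge_constant_term:
  assumes "converges_on r F" "0 < r" "\<And>m. 0 \<le> fps_nth F m" "0 \<le> x" "x < r\<^sup>2"
  shows "fps_nth F 0 \<le> Re (diag_eval F (complex_of_real x))" "Im (diag_eval F (complex_of_real x)) = 0"
proof -
  have "(\<Sum>m<1. fps_nth F m * x ^ m) \<le> (\<Sum>m. fps_nth F m * x ^ m)"
    by (rule sum_le_suminf[OF diag_eval_of_real(2)[OF assms(1,2,4,5)]]) (use assms(3,4) in auto)
  then show "fps_nth F 0 \<le> Re (diag_eval F (complex_of_real x))"
    using diag_eval_of_real(1)[OF assms(1,2,4,5)] by simp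
  show "Im (diag_eval F (complex_of_real x)) = 0"
    using diag_eval_of_real(1)[OF assms(1,2,4,5)] by simp
qed

lemma converges_on_finite_support:
  assumes "\<And>m. M \<le> m \<Longrightarrow> fps_nth F m = 0"
  shows "converges_on r F"
  unfolding converges_on_def
  by (intro allI impI summable_finite[of "{..<M}"]) (auto simp: assms)

lemma pos_kernel_diag_eval:
  assumes "converges_on r F" "0 < r" "\<And>m. 0 \<le> fps_nth F m" "\<And>i. i \<in> J \<Longrightarrow> \<zeta> i \<in> ball 0 r"
  shows "pos_kernel J (\<lambda>i j. diag_eval F (\<zeta> i * cnj (\<zeta> j)))"
proof -
  have one: "pos_kernel J (\<lambda>i j. 1)" using pos_kernel_rank_one[of J "\<lambda>_. 1"] by simp
  show ?thesis using pos_kernel_diag_mult[OF assms(1-3) one assms(4)] by simp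
qed

lemma diag_eval_polynomial:
  assumes "\<And>m. M \<le> m \<Longrightarrow> fps_nth F m = 0" "0 < r" "cmod t < r\<^sup>2"
  shows "diag_eval F t = (\<Sum>m<M. complex_of_real (fps_nth F m) * t ^ m)"
proof -
  have "(\<lambda>m. complex_of_real (fps_nth F m) * t ^ m) sums (\<Sum>m<M. complex_of_real (fps_nth F m) * t ^ m)"
    by (rule sums_finite) (auto simp: assms(1))
  then show ?thesis
    using diag_eval_sums[OF converges_on_finite_support[OF assms(1)] assms(2,3)] sums_unique2 by blast
qed

section \<open>Extension of Pick data to the disc\<close>

text \<open>The system is square, so uniqueness of solutions entails their existence.\<close>

lemma affine_fixed_point_exists:
  fixes M :: "nat \<Rightarrow> nat \<Rightarrow> complex"
  assumes inj: "\<And>x. (\<And>g. g < e \<Longrightarrow> x g = (\<Sum>h<e. x h * M h g)) \<Longrightarrow> (\<And>g. g < e \<Longrightarrow> x g = 0)"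
  shows "\<exists>x. \<forall>g<e. x g = c g + (\<Sum>h<e. x h * M h g)"
proof -
  define A where "A = Matrix.mat e e (\<lambda>(g, h). (if g = h then 1 else 0) - M h g)"
  have A: "A \<in> carrier_mat e e" by (simp add: A_def)
  have A_mult: "vec_index (A *\<^sub>v v) g = vec_index v g - (\<Sum>h<e. vec_index v h * M h g)"
    if "v \<in> carrier_vec e" "g < e" for v g
  proof -
    have "vec_index (A *\<^sub>v v) g = (\<Sum>h<e. ((if g = h then 1 else 0) - M h g) * vec_index v h)"
      using that by (simp add: A_def scalar_prod_def lessThan_atLeast0)
    also have "\<dots> = (\<Sum>h<e. (if g = h then vec_index v h else 0)) - (\<Sum>h<e. vec_index v h * M h g)"
      unfolding sum_subtractf[symmetric] by (intro sum.cong refl) (simp add: algebra_simps)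
    finally show ?thesis using that by simp
  qed
  have "det A \<noteq> 0"
  proof
    assume "det A = 0"
    then obtain v where v: "v \<in> carrier_vec e" "v \<noteq> 0\<^sub>v e" "A *\<^sub>v v = 0\<^sub>v e"
      using det_0_iff_vec_prod_zero_field[OF A] by blast
    have "vec_index v g = (\<Sum>h<e. vec_index v h * M h g)" if "g < e" for g
      using A_mult[OF v(1) that] v(3) that by simp
    then have "vec_index v g = 0" if "g < e" for g
      using inj[of "vec_index v"] that by blast
    then have "v = 0\<^sub>v e" using v(1) by auto
    with v(2) show False by simp
  qed
  define x where "x = (1 / det A) \<cdot>\<^sub>v (adj_mat A *\<^sub>v Matrix.vec e c)"
  have adj: "adj_mat A \<in> carrier_mat e e" "A * adj_mat A = det A \<cdot>\<^sub>m 1\<^sub>m e"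
    using adj_mat[OF A] by auto
  have "A *\<^sub>v x = (1 / det A) \<cdot>\<^sub>v (A *\<^sub>v (adj_mat A *\<^sub>v Matrix.vec e c))"
    unfolding x_def by (rule mult_mat_vec[OF A]) (use adj in auto)
  also have "A *\<^sub>v (adj_mat A *\<^sub>v Matrix.vec e c) = (A * adj_mat A) *\<^sub>v Matrix.vec e c"
    by (rule assoc_mult_mat_vec[symmetric, OF A adj(1)]) simp
  also have "\<dots> = det A \<cdot>\<^sub>v Matrix.vec e c"
    unfolding adj(2) by (intro eq_vecI) (auto simp: scalar_prod_def if_distrib if_distribR sum.delta cong: if_cong)
  finally have Ax: "A *\<^sub>v x = Matrix.vec e c"
    using \<open>det A \<noteq> 0\<close> by (simp add: smult_smult_assoc)
  have x: "x \<in> carrier_vec e" using adj by (auto simp: x_def)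
  have "vec_index x g = c g + (\<Sum>h<e. vec_index x h * M h g)" if "g < e" for g
    using A_mult[OF x that] Ax that by (simp add: algebra_simps)
  then show ?thesis by blast
qed

lemma sum_lessThan_add: "(\<Sum>i<m + n. f i) = (\<Sum>i<m. f i) + (\<Sum>i<n. f (m + i))" for f :: "nat \<Rightarrow> 'a::comm_monoid_add"
  by (induction n) (simp_all add: add.assoc)

definition unit_vector :: "nat \<Rightarrow> nat \<Rightarrow> complex" where
  "unit_vector a = (\<lambda>c. if c = a then 1 else 0)"

lemma herm_unit_vector:
  "a < N \<Longrightarrow> herm N (unit_vector a) (unit_vector a') = (if a = a' then 1 else 0)"
proof -
  assume a: "a < N"
  have "herm N (unit_vector a) (unit_vector a') = (\<Sum>c<N. if c = a then (if a = a' then 1 else 0) else 0)"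
    unfolding herm_def by (intro sum.cong refl) (auto simp: unit_vector_def)
  then show ?thesis using a by simp
qed

text \<open>The lurking isometry argument.  The hypothesis on the data is positivity of \<open>L = l - k w w\<^sup>*\<close>.  With a
  factorization \<open>L = G G\<^sup>*\<close> the definitions of \<open>s\<close> and \<open>q\<close> give
  \<open>G G\<^sup>* + w w\<^sup>* = s + p G G\<^sup>* + q w w\<^sup>*\<close> on the points of the data.  The left side is the Gram matrix of
  the rows \<open>X = (G, w)\<close>; the right side is the Gram matrix of vectors that depend linearly on a unit
  vector and on \<open>X\<close> itself, with coefficients that are functions of the point.  The contraction which
  carries the second family to the first therefore prescribes, at every point of the disc, an affine
  equation for \<open>X\<close>.\<close>

lemma complete_pick_extension:
  fixes k l p :: "real fps" and \<zeta> :: "'b \<Rightarrow> complex" and \<alpha> :: "'b \<Rightarrow> nat" and w :: "'b \<Rightarrow> nat \<Rightarrow> complex"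
  defines "s \<equiv> (1 - p) * l" and "q \<equiv> 1 - (1 - p) * k"
  assumes r: "0 < r" and conv: "converges_on r k" "converges_on r l" "converges_on r p"
    and nonneg: "\<And>m. 0 \<le> fps_nth k m" "\<And>m. 0 \<le> fps_nth l m" "\<And>m. 0 \<le> fps_nth p m"
      "\<And>m. 0 \<le> fps_nth s m" "\<And>m. 0 \<le> fps_nth q m"
    and const: "fps_nth k 0 = 1" "fps_nth l 0 = 1" "fps_nth p 0 = 0"
    and B: "finite B" "\<And>b. b \<in> B \<Longrightarrow> \<zeta> b \<in> ball 0 r" "\<And>b. b \<in> B \<Longrightarrow> \<alpha> b < N"
    and data: "pos_kernel B (\<lambda>b b'. (if \<alpha> b = \<alpha> b' then diag_eval l (\<zeta> b * cnj (\<zeta> b')) else 0)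
       - diag_eval k (\<zeta> b * cnj (\<zeta> b')) * herm N (w b) (w b'))"
  shows "\<exists>\<phi>. (\<forall>b\<in>B. \<forall>c<N. \<phi> (\<zeta> b) (\<alpha> b) c = w b c)
    \<and> pos_kernel (ball 0 r \<times> {..<N}) (\<lambda>(z, a) (z', a'). (if a = a' then diag_eval l (z * cnj z') else 0)
       - diag_eval k (z * cnj z') * herm N (\<phi> z a) (\<phi> z' a'))"
proof -
  have conv': "converges_on r s" "converges_on r q"
    unfolding s_def q_def by (intro converges_on_diff converges_on_mult converges_on_1 conv r)+
  have conv1: "converges_on r (1 - p)"
    by (rule converges_on_diff[OF converges_on_1 conv(3) r])
  have ev1: "diag_eval (1 - p) t = 1 - diag_eval p t" if "cmod t < r\<^sup>2" for t
    using diag_eval_diff[OF converges_on_1 conv(3) r that] by (simp add: diag_eval_1)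
  have ev_s: "diag_eval s t = (1 - diag_eval p t) * diag_eval l t" if "cmod t < r\<^sup>2" for t
    unfolding s_def diag_eval_mult[OF conv1 conv(2) r that] ev1[OF that] ..
  have ev_q: "diag_eval q t = 1 - (1 - diag_eval p t) * diag_eval k t" if "cmod t < r\<^sup>2" for t
    unfolding q_def diag_eval_diff[OF converges_on_1 converges_on_mult[OF conv1 conv(1) r] r that]
      diag_eval_mult[OF conv1 conv(1) r that] ev1[OF that] diag_eval_1 ..
  note ev = ev_s ev_q
  have small: "Re (diag_eval p (complex_of_real x)) < 1" "Re (diag_eval q (complex_of_real x)) < 1"
    if x: "0 \<le> x" "x < r\<^sup>2" for x
  proof -
    let ?x = "complex_of_real x"
    have t: "cmod ?x < r\<^sup>2" using x by simp
    note l = diag_eval_ge_constant_term[OF conv(2) r nonneg(2) x, unfolded const]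
    note k = diag_eval_ge_constant_term[OF conv(1) r nonneg(1) x, unfolded const]
    note p = diag_eval_ge_constant_term(2)[OF conv(3) r nonneg(3) x]
    have "fps_nth s 0 = 1" using const by (simp add: s_def)
    then have "1 \<le> Re (diag_eval s ?x)"
      using diag_eval_ge_constant_term(1)[OF conv'(1) r nonneg(4) x] by simp
    then have 1: "0 < (1 - Re (diag_eval p ?x)) * Re (diag_eval l ?x)"
      using p l(2) by (simp add: ev_s[OF t])
    then have "0 < 1 - Re (diag_eval p ?x)" using l(1) by (simp add: zero_less_mult_iff)
    moreover then have "0 < (1 - Re (diag_eval p ?x)) * Re (diag_eval k ?x)" using k(1) by simp
    ultimately show "Re (diag_eval p ?x) < 1" "Re (diag_eval q ?x) < 1"
      using p k(2) by (simp_all add: ev_q[OF t])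
  qed
  define L where "L b b' = (if \<alpha> b = \<alpha> b' then diag_eval l (\<zeta> b * cnj (\<zeta> b')) else 0)
       - diag_eval k (\<zeta> b * cnj (\<zeta> b')) * herm N (w b) (w b')" for b b'
  define d where "d = card B"
  obtain G where G: "\<And>b b'. b \<in> B \<Longrightarrow> b' \<in> B \<Longrightarrow> L b b' = herm d (G b) (G b')"
    using pos_kernel_gram_factorization[OF B(1) data] unfolding L_def d_def herm_def by blast
  define sh where "sh x = (\<lambda>c. x (d + c))" for x :: "nat \<Rightarrow> complex"
  have herm_split: "herm (d + N) x y = herm d x y + herm N (sh x) (sh y)" for x y
    by (simp add: herm_def sum_lessThan_add sh_def)
  define X where "X b g = (if g < d then G b g else w b (g - d))" for b g
  have X_parts: "herm d (X b) (X b') = herm d (G b) (G b')" "sh (X b) = w b" for b b'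
    by (auto simp: X_def sh_def intro!: herm_cong)
  \<comment> \<open>The element \<open>(z, a, x)\<close> of \<open>J\<close> stands for the vector with components \<open>\<surd>s\<^sub>m z\<^sup>m a\<close>,
    \<open>\<surd>p\<^sub>m z\<^sup>m x\<^sub>G\<close> and \<open>\<surd>q\<^sub>m z\<^sup>m x\<^sub>w\<close>, where \<open>m\<close> ranges over the natural numbers; \<open>E\<close> is the Gram
    kernel of these vectors.\<close>
  define J where "J = ball (0::complex) r \<times> (UNIV :: (nat \<Rightarrow> complex) set) \<times> (UNIV :: (nat \<Rightarrow> complex) set)"
  define E where "E = (\<lambda>(z, a, x) (z', a', x'). diag_eval s (z * cnj z') * herm N a a'
      + diag_eval p (z * cnj z') * herm d x x' + diag_eval q (z * cnj z') * herm N (sh x) (sh x'))"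
  have E: "pos_kernel J E"
  proof -
    have ball: "\<And>i. i \<in> J \<Longrightarrow> fst i \<in> ball 0 r" by (auto simp: J_def)
    have 1: "pos_kernel J (\<lambda>i j. diag_eval s (fst i * cnj (fst j)) * herm N (fst (snd i)) (fst (snd j)))"
      by (rule pos_kernel_diag_mult[OF conv'(1) r nonneg(4) pos_kernel_herm ball])
    have 2: "pos_kernel J (\<lambda>i j. diag_eval p (fst i * cnj (fst j)) * herm d (snd (snd i)) (snd (snd j)))"
      by (rule pos_kernel_diag_mult[OF conv(3) r nonneg(3) pos_kernel_herm ball])
    have 3: "pos_kernel J (\<lambda>i j. diag_eval q (fst i * cnj (fst j)) * herm N (sh (snd (snd i))) (sh (snd (snd j))))"
      by (rule pos_kernel_diag_mult[OF conv'(2) r nonneg(5) pos_kernel_herm ball])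
    show ?thesis
      by (rule pos_kernel_cong[OF pos_kernel_add[OF pos_kernel_add[OF 1 2] 3]]) (auto simp: E_def)
  qed
  define \<iota> where "\<iota> b = (\<zeta> b, unit_vector (\<alpha> b), X b)" for b
  have \<iota>J: "\<iota> ` B \<subseteq> J" using B(2) by (auto simp: \<iota>_def J_def)
  have gram: "herm (d + N) (snd (snd i)) (snd (snd j)) = E i j" if ij: "i \<in> \<iota> ` B" "j \<in> \<iota> ` B" for i j
  proof -
    obtain b b' where b: "b \<in> B" "b' \<in> B" "i = \<iota> b" "j = \<iota> b'" using ij by blast
    have t: "cmod (\<zeta> b * cnj (\<zeta> b')) < r\<^sup>2" using norm_diag_less B(2) b by blast
    show ?thesis
      using b(1,2) B(3)[OF b(1)] unfolding b(3,4) herm_split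
      by (simp add: \<iota>_def E_def X_parts herm_unit_vector ev[OF t] G[symmetric])
        (simp add: L_def algebra_simps)
  qed
  let ?Y = "\<lambda>\<beta> i g. \<Sum>b\<in>\<iota> ` B. E i b * \<beta> b g"
  have "\<exists>\<beta>. (\<forall>i\<in>\<iota> ` B. \<forall>g<d + N. ?Y \<beta> i g = snd (snd i) g)
      \<and> pos_kernel J (\<lambda>i j. E i j - herm (d + N) (?Y \<beta> i) (?Y \<beta> j))
      \<and> (\<forall>v. (\<forall>b\<in>\<iota> ` B. herm (d + N) (snd (snd b)) v = 0) \<longrightarrow> (\<forall>b\<in>\<iota> ` B. herm (d + N) (\<beta> b) v = 0))"
    by (rule isometry_extension[OF finite_imageI[OF B(1)] \<iota>J E gram])
  then obtain \<beta> where \<beta>1: "\<forall>i\<in>\<iota> ` B. \<forall>g<d + N. ?Y \<beta> i g = snd (snd i) g"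
    and \<beta>2: "pos_kernel J (\<lambda>i j. E i j - herm (d + N) (?Y \<beta> i) (?Y \<beta> j))"
    by (elim exE conjE) (rule that)
  note \<beta> = \<beta>1[rule_format] \<beta>2
  define Y where "Y i g = (\<Sum>b\<in>\<iota> ` B. E i b * \<beta> b g)" for i g
  define M where "M z h g = (\<Sum>b\<in>\<iota> ` B. diag_eval (if h < d then p else q) (z * cnj (fst b)) * cnj (snd (snd b) h) * \<beta> b g)"
    for z h g
  have Y_linear: "Y (z, a, x) g = Y (z, a, \<lambda>_. 0) g + (\<Sum>h<d + N. x h * M z h g)" for z a x g
  proof -
    have "(\<Sum>h<d + N. x h * M z h g)
        = (\<Sum>b\<in>\<iota> ` B. (\<Sum>h<d + N. x h * diag_eval (if h < d then p else q) (z * cnj (fst b)) * cnj (snd (snd b) h)) * \<beta> b g)"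
      unfolding M_def sum_distrib_left sum_distrib_right by (subst sum.swap) (simp add: mult_ac)
    moreover have "E (z, a, x) b = E (z, a, \<lambda>_. 0) b
        + (\<Sum>h<d + N. x h * diag_eval (if h < d then p else q) (z * cnj (fst b)) * cnj (snd (snd b) h))" for b
      by (cases b) (simp add: E_def sum_lessThan_add herm_def sh_def sum_distrib_left mult_ac)
    ultimately show ?thesis
      unfolding Y_def by (simp add: ring_distribs sum.distrib)
  qed
  \<comment> \<open>A solution of the homogeneous equation is at most as long as the vector \<open>(\<surd>p x\<^sub>G, \<surd>q x\<^sub>w)\<close>, where
    \<open>p\<close> and \<open>q\<close> are evaluated at \<open>\<bar>z\<bar>\<^sup>2\<close> and are less than 1.\<close>
  have inj: "x g = 0" if z: "z \<in> ball 0 r" and fixp: "\<And>g. g < d + N \<Longrightarrow> x g = (\<Sum>h<d + N. x h * M z h g)" and g: "g < d + N"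
    for z x g
  proof -
    have "Y (z, (\<lambda>_. 0), (\<lambda>_. 0)) g = 0" for g
      unfolding Y_def by (rule sum.neutral) (auto simp: E_def herm_def sh_def)
    then have Yx: "Y (z, (\<lambda>_. 0), x) g = x g" if "g < d + N" for g
      using fixp[OF that] Y_linear[of z "\<lambda>_. 0" x g] by simp
    define i where "i = (z, (\<lambda>_::nat. 0::complex), x)"
    have "i \<in> J" using z by (simp add: i_def J_def)
    from pos_kernel_diag[OF \<beta>(2) this] have "0 \<le> E i i - herm (d + N) (Y i) (Y i)"
      by (simp add: Y_def[abs_def])
    also have "herm (d + N) (Y i) (Y i) = herm d x x + herm N (sh x) (sh x)"
      unfolding herm_split[symmetric] using Yx by (intro herm_cong) (simp_all add: i_def)
    finally have nn: "0 \<le> E i i - (herm d x x + herm N (sh x) (sh x))" .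
    define A B where "A = (\<Sum>g<d. (cmod (x g))\<^sup>2)" and "B = (\<Sum>g<N. (cmod (sh x g))\<^sup>2)"
    have t: "z * cnj z = complex_of_real ((cmod z)\<^sup>2)" by (rule complex_norm_square[symmetric])
    have zr: "(cmod z)\<^sup>2 < r\<^sup>2" using z by (simp add: power_strict_mono)
    have "E i i = diag_eval p (z * cnj z) * complex_of_real A + diag_eval q (z * cnj z) * complex_of_real B"
      by (simp add: i_def E_def herm_self A_def B_def)
    then have "0 \<le> (Re (diag_eval p (z * cnj z)) - 1) * A + (Re (diag_eval q (z * cnj z)) - 1) * B"
      using nn by (simp add: herm_self A_def[symmetric] B_def[symmetric] less_eq_complex_def algebra_simps)
    moreover have "0 \<le> A" "0 \<le> B" by (auto simp: A_def B_def sum_nonneg)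
    moreover have "Re (diag_eval p (z * cnj z)) - 1 < 0" "Re (diag_eval q (z * cnj z)) - 1 < 0"
      unfolding t using small[OF zero_le_power2 zr] by simp_all
    ultimately have AB: "A = 0 \<and> B = 0"
      by (smt (verit) mult_neg_pos mult_nonneg_nonpos2 mult_nonneg_nonpos mult.commute)
    have "herm (d + N) x x = complex_of_real A + complex_of_real B"
      unfolding A_def B_def herm_self[symmetric] herm_split ..
    then have "herm (d + N) x x = 0" using AB by simp
    then show ?thesis using g herm_self_eq_0_iff by blast
  qed
  have "\<exists>x. \<forall>g<d + N. x g = Y (z, unit_vector a, x) g" if z: "z \<in> ball 0 r" for z a
  proof -
    have "\<exists>x. \<forall>g<d + N. x g = Y (z, unit_vector a, \<lambda>_. 0) g + (\<Sum>h<d + N. x h * M z h g)"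
      by (rule affine_fixed_point_exists) (rule inj[OF z])
    then obtain x where "\<forall>g<d + N. x g = Y (z, unit_vector a, \<lambda>_. 0) g + (\<Sum>h<d + N. x h * M z h g)" ..
    then have "\<forall>g<d + N. x g = Y (z, unit_vector a, x) g"
      unfolding Y_linear[of z "unit_vector a" x] .
    then show ?thesis by blast
  qed
  then obtain \<xi> where \<xi>: "\<And>z a g. z \<in> ball 0 r \<Longrightarrow> g < d + N \<Longrightarrow> \<xi> z a g = Y (z, unit_vector a, \<xi> z a) g"
    by metis
  define \<phi> where "\<phi> z a = sh (\<xi> z a)" for z a
  \<comment> \<open>The given rows \<open>X\<close> solve the same equation, which has only one solution.\<close>
  have interp: "\<phi> (\<zeta> b) (\<alpha> b) c = w b c" if b: "b \<in> B" and c: "c < N" for b c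
  proof -
    have X: "X b g = Y (\<zeta> b, unit_vector (\<alpha> b), X b) g" if "g < d + N" for g
      using \<beta>(1)[OF imageI[OF b] that] by (simp add: Y_def \<iota>_def)
    have "\<xi> (\<zeta> b) (\<alpha> b) g - X b g = 0" if g: "g < d + N" for g
    proof (rule inj[OF B(2)[OF b] _ g])
      fix g assume g: "g < d + N"
      show "\<xi> (\<zeta> b) (\<alpha> b) g - X b g = (\<Sum>h<d + N. (\<xi> (\<zeta> b) (\<alpha> b) h - X b h) * M (\<zeta> b) h g)"
        using \<xi>[OF B(2)[OF b] g, of "\<alpha> b"] X[OF g] unfolding Y_linear[of "\<zeta> b" "unit_vector (\<alpha> b)" "\<xi> (\<zeta> b) (\<alpha> b)"]
          Y_linear[of "\<zeta> b" "unit_vector (\<alpha> b)" "X b"]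
        by (simp add: left_diff_distrib sum_subtractf)
    qed
    from this[of "d + c"] c show ?thesis
      by (simp add: \<phi>_def sh_def X_def)
  qed
  define P where "P = ball (0::complex) r \<times> {..<N}"
  define K where "K i j = herm N (\<phi> (fst i) (snd i)) (\<phi> (fst j) (snd j))" for i j
  define \<Gamma> where "\<Gamma> i j = herm d (\<xi> (fst i) (snd i)) (\<xi> (fst j) (snd j))" for i j
  define \<Lambda> where "\<Lambda> i j = (if snd i = snd j then diag_eval l (fst i * cnj (fst j)) else 0)
      - diag_eval k (fst i * cnj (fst j)) * K i j" for i j :: "complex \<times> nat"
  define t where "t i j = fst i * cnj (fst j)" for i j :: "complex \<times> nat"
  have t_less: "cmod (t i j) < r\<^sup>2" if "i \<in> P" "j \<in> P" for i j
    using that norm_diag_less unfolding t_def P_def by (metis mem_Times_iff)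
  have p_less: "cmod (diag_eval p (t i j)) < 1" if "i \<in> P" "j \<in> P" for i j
    using norm_diag_eval_le[OF conv(3) r nonneg(3) t_less[OF that]] small(1)[OF norm_ge_zero t_less[OF that]]
    by linarith
  \<comment> \<open>Contractivity at the points \<open>(z, \<delta>\<^sub>a, X(z))\<close>, rewritten by the definitions of \<open>s\<close> and \<open>q\<close>.\<close>
  have "pos_kernel P (\<lambda>i j. (1 - diag_eval p (t i j)) * (\<Lambda> i j - \<Gamma> i j))"
  proof (rule pos_kernel_cong[OF pos_kernel_comp[OF \<beta>(2)]])
    show "(fst i, unit_vector (snd i), \<xi> (fst i) (snd i)) \<in> J" if "i \<in> P" for i
      using that by (auto simp: P_def J_def)
  next
    fix i j assume ij: "i \<in> P" "j \<in> P"
    let ?e = "\<lambda>i. (fst i, unit_vector (snd i), \<xi> (fst i) (snd i))"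
    have "herm (d + N) (Y (?e i)) (Y (?e j)) = herm (d + N) (\<xi> (fst i) (snd i)) (\<xi> (fst j) (snd j))"
      by (intro herm_cong) (use \<xi> ij in \<open>auto simp: P_def\<close>)
    also have "\<dots> = \<Gamma> i j + K i j" by (simp add: herm_split \<Gamma>_def K_def \<phi>_def)
    finally have h: "herm (d + N) (Y (?e i)) (Y (?e j)) = \<Gamma> i j + K i j" .
    have hE: "E (?e i) (?e j) = diag_eval s (t i j) * (if snd i = snd j then 1 else 0)
        + diag_eval p (t i j) * \<Gamma> i j + diag_eval q (t i j) * K i j"
      using ij by (simp add: E_def herm_unit_vector P_def mem_Times_iff t_def \<Gamma>_def K_def \<phi>_def)
    have "E (?e i) (?e j) - herm (d + N) (Y (?e i)) (Y (?e j)) = (1 - diag_eval p (t i j)) * (\<Lambda> i j - \<Gamma> i j)"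
      unfolding h hE ev[OF t_less[OF ij]] \<Lambda>_def t_def[symmetric] by (simp add: algebra_simps)
    then show "E (?e i) (?e j) - herm (d + N) (\<lambda>g. \<Sum>b\<in>\<iota> ` B. E (?e i) b * \<beta> b g) (\<lambda>g. \<Sum>b\<in>\<iota> ` B. E (?e j) b * \<beta> b g)
       = (1 - diag_eval p (t i j)) * (\<Lambda> i j - \<Gamma> i j)"
      by (simp add: Y_def[abs_def])
  qed
  from pos_kernel_divide_one_minus[OF conv(3) r nonneg(3) this, of fst] p_less
  have 1: "pos_kernel P (\<lambda>i j. (1 - diag_eval p (t i j)) * (\<Lambda> i j - \<Gamma> i j) / (1 - diag_eval p (t i j)))"
    unfolding t_def P_def by auto
  have "pos_kernel P (\<lambda>i j. \<Lambda> i j - \<Gamma> i j)"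
  proof (rule pos_kernel_cong[OF 1])
    fix i j assume "i \<in> P" "j \<in> P"
    then have "cmod (diag_eval p (t i j)) < 1" by (rule p_less)
    then have "diag_eval p (t i j) \<noteq> 1" by auto
    then show "(1 - diag_eval p (t i j)) * (\<Lambda> i j - \<Gamma> i j) / (1 - diag_eval p (t i j)) = \<Lambda> i j - \<Gamma> i j"
      by simp
  qed
  moreover have "pos_kernel P \<Gamma>"
    unfolding \<Gamma>_def[abs_def] by (rule pos_kernel_herm)
  ultimately have "pos_kernel P (\<lambda>i j. (\<Lambda> i j - \<Gamma> i j) + \<Gamma> i j)"
    by (rule pos_kernel_add)
  then have "pos_kernel P (\<lambda>(z, a) (z', a'). (if a = a' then diag_eval l (z * cnj z') else 0)
       - diag_eval k (z * cnj z') * herm N (\<phi> z a) (\<phi> z' a'))"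
    by (rule pos_kernel_cong) (auto simp: \<Lambda>_def K_def)
  then show ?thesis
    using interp unfolding P_def by blast
qed

section \<open>Reproducing kernel Hilbert spaces\<close>

locale rkhs_on =
  fixes X :: "'x set" and k :: "'x \<Rightarrow> 'x \<Rightarrow> complex" and H :: "'x hilbert_fun"
  assumes rkhs: "is_rkhs X k H"
begin

abbreviation "V \<equiv> fst H"
abbreviation "ip \<equiv> snd H"
abbreviation "kf \<equiv> kernel_fun X k"

lemma function_space: "is_function_space X V"
  and inner_product: "is_inner_product V ip"
  using rkhs by (simp_all add: is_rkhs_def)

lemma off: "f \<in> V \<Longrightarrow> x \<notin> X \<Longrightarrow> f x = 0"
  and zero_mem: "(\<lambda>x. 0) \<in> V"
  and add_mem: "f \<in> V \<Longrightarrow> g \<in> V \<Longrightarrow> (\<lambda>x. f x + g x) \<in> V"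
  and scale_mem: "f \<in> V \<Longrightarrow> (\<lambda>x. c * f x) \<in> V"
  using function_space by (simp_all add: is_function_space_def)

lemmas inner_product_axioms = inner_product[unfolded is_inner_product_def]
lemmas ip_add_left = inner_product_axioms[THEN conjunct1, rule_format]
lemmas ip_scale_left = inner_product_axioms[THEN conjunct2, THEN conjunct1, rule_format]
lemmas ip_cnj = inner_product_axioms[THEN conjunct2, THEN conjunct2, THEN conjunct1, rule_format]
lemmas ip_nonneg = inner_product_axioms[THEN conjunct2, THEN conjunct2, THEN conjunct2, THEN conjunct1, rule_format]
lemmas ip_definite = inner_product_axioms[THEN conjunct2, THEN conjunct2, THEN conjunct2, THEN conjunct2, rule_format]

lemma kf_mem: "w \<in> X \<Longrightarrow> kf w \<in> V"
  and reproducing: "w \<in> X \<Longrightarrow> f \<in> V \<Longrightarrow> f w = ip f (kf w)"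
  using rkhs by (simp_all add: is_rkhs_def)

lemma ip_add_right:
  assumes f: "f \<in> V" and g: "g \<in> V" and h: "h \<in> V"
  shows "ip h (\<lambda>x. f x + g x) = ip h f + ip h g"
  unfolding ip_cnj[OF add_mem[OF f g] h] ip_add_left[OF f g h] ip_cnj[OF f h] ip_cnj[OF g h] by simp

lemma ip_scale_right:
  assumes f: "f \<in> V" and h: "h \<in> V"
  shows "ip h (\<lambda>x. c * f x) = cnj c * ip h f"
  unfolding ip_cnj[OF scale_mem[OF f] h] ip_scale_left[OF f h] ip_cnj[OF f h] by simp

lemma diff_mem: "f \<in> V \<Longrightarrow> g \<in> V \<Longrightarrow> (\<lambda>x. f x - g x) \<in> V"
  using add_mem[of f "\<lambda>x. -1 * g x"] scale_mem[of g "-1"] by simp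

lemma ip_diff_left: "f \<in> V \<Longrightarrow> g \<in> V \<Longrightarrow> h \<in> V \<Longrightarrow> ip (\<lambda>x. f x - g x) h = ip f h - ip g h"
  using ip_add_left[of f "\<lambda>x. -1 * g x" h] ip_scale_left[of g h "-1"] scale_mem[of g "-1"] by simp

lemma ip_diff_right:
  assumes f: "f \<in> V" and g: "g \<in> V" and h: "h \<in> V"
  shows "ip h (\<lambda>x. f x - g x) = ip h f - ip h g"
  unfolding ip_cnj[OF diff_mem[OF f g] h] ip_diff_left[OF f g h] ip_cnj[OF f h] ip_cnj[OF g h] by simp

lemma ip_zero_left: "h \<in> V \<Longrightarrow> ip (\<lambda>x. 0) h = 0"
  using ip_scale_left[of h h 0] by simp

lemma ip_zero_right: "h \<in> V \<Longrightarrow> ip h (\<lambda>x. 0) = 0"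
  using ip_scale_right[of h h 0] by simp

lemma sum_mem: "(\<And>i. i \<in> A \<Longrightarrow> f i \<in> V) \<Longrightarrow> (\<lambda>x. \<Sum>i\<in>A. f i x) \<in> V"
  by (induction A rule: infinite_finite_induct) (auto simp: zero_mem intro: add_mem)

lemma ip_sum_right:
  "(\<And>i. i \<in> A \<Longrightarrow> f i \<in> V) \<Longrightarrow> h \<in> V \<Longrightarrow> ip h (\<lambda>x. \<Sum>i\<in>A. f i x) = (\<Sum>i\<in>A. ip h (f i))"
  by (induction A rule: infinite_finite_induct) (auto simp: ip_zero_right ip_add_right sum_mem)

definition nsq :: "('x \<Rightarrow> complex) \<Rightarrow> real" where "nsq f = Re (ip f f)"

lemma nsq_nonneg: "f \<in> V \<Longrightarrow> 0 \<le> nsq f"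
  using ip_nonneg[of f] by (simp add: nsq_def less_eq_complex_def)

lemma ip_self: "f \<in> V \<Longrightarrow> ip f f = complex_of_real (nsq f)"
  using ip_nonneg[of f] by (simp add: nsq_def less_eq_complex_def complex_eq_iff)

lemma hf_norm_nsq: "f \<in> V \<Longrightarrow> (hf_norm H f)\<^sup>2 = nsq f"
  using nsq_nonneg[of f] by (simp add: hf_norm_def nsq_def)

lemma hf_norm_nonneg: "f \<in> V \<Longrightarrow> 0 \<le> hf_norm H f"
  using nsq_nonneg[of f] by (simp add: hf_norm_def nsq_def)

lemma nsq_add: "f \<in> V \<Longrightarrow> g \<in> V \<Longrightarrow> nsq (\<lambda>x. f x + g x) = nsq f + nsq g + 2 * Re (ip f g)"
  using ip_cnj[of f g] by (simp add: nsq_def ip_add_left ip_add_right add_mem)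

lemma nsq_diff: "f \<in> V \<Longrightarrow> g \<in> V \<Longrightarrow> nsq (\<lambda>x. f x - g x) = nsq f + nsq g - 2 * Re (ip f g)"
  using ip_cnj[of f g] by (simp add: nsq_def ip_diff_left ip_diff_right diff_mem)

lemma nsq_scale:
  assumes f: "f \<in> V"
  shows "nsq (\<lambda>x. c * f x) = (cmod c)\<^sup>2 * nsq f"
proof -
  have "ip (\<lambda>x. c * f x) (\<lambda>x. c * f x) = complex_of_real ((cmod c)\<^sup>2) * ip f f"
    unfolding complex_norm_square ip_scale_left[OF f scale_mem[OF f]] ip_scale_right[OF f f] by (simp only: mult.assoc)
  then show ?thesis by (simp add: nsq_def del: of_real_power)
qed

lemma cauchy_schwarz:
  assumes f: "f \<in> V" and g: "g \<in> V"
  shows "cmod (ip f g) \<le> hf_norm H f * hf_norm H g"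
proof (cases "nsq g = 0")
  case True
  then have "g = (\<lambda>x. 0)" using ip_definite[OF g] ip_self[OF g] by simp
  then show ?thesis using ip_zero_right[OF f] hf_norm_nonneg[OF f] hf_norm_nonneg[OF g] by simp
next
  case False
  define c where "c = ip f g / complex_of_real (nsq g)"
  have cg: "(\<lambda>x. c * g x) \<in> V" using g by (rule scale_mem)
  have "ip f (\<lambda>x. c * g x) = complex_of_real ((cmod (ip f g))\<^sup>2 / nsq g)"
    unfolding ip_scale_right[OF g f] c_def of_real_divide complex_norm_square by simp
  then have "Re (ip f (\<lambda>x. c * g x)) = (cmod (ip f g))\<^sup>2 / nsq g"
    by (simp only: Re_complex_of_real)
  moreover have "nsq (\<lambda>x. c * g x) = (cmod (ip f g))\<^sup>2 / nsq g"
    using False nsq_nonneg[OF g] unfolding nsq_scale[OF g]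
    by (simp add: c_def norm_divide power_divide power2_eq_square)
  ultimately have "0 \<le> nsq f - (cmod (ip f g))\<^sup>2 / nsq g"
    using nsq_nonneg[OF diff_mem[OF f cg]] by (simp add: nsq_diff f cg)
  then have "(cmod (ip f g))\<^sup>2 \<le> nsq f * nsq g"
    using False nsq_nonneg[OF g] by (simp add: field_simps)
  also have "\<dots> = (hf_norm H f * hf_norm H g)\<^sup>2"
    by (simp add: power_mult_distrib hf_norm_nsq f g)
  finally show ?thesis
    by (rule power2_le_imp_le) (use hf_norm_nonneg[OF f] hf_norm_nonneg[OF g] in simp)
qed

lemma hf_norm_triangle:
  assumes f: "f \<in> V" and g: "g \<in> V"
  shows "hf_norm H f \<le> hf_norm H g + hf_norm H (\<lambda>x. f x - g x)"
proof -
  define h where "h = (\<lambda>x. f x - g x)"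
  have h: "h \<in> V" unfolding h_def using f g by (rule diff_mem)
  have "f = (\<lambda>x. g x + h x)" by (simp add: h_def)
  then have "nsq f = nsq g + nsq h + 2 * Re (ip g h)" using nsq_add[OF g h] by simp
  also have "Re (ip g h) \<le> hf_norm H g * hf_norm H h"
    using cauchy_schwarz[OF g h] complex_Re_le_cmod order_trans by blast
  finally have "(hf_norm H f)\<^sup>2 \<le> (hf_norm H g + hf_norm H h)\<^sup>2"
    by (simp add: hf_norm_nsq f g h power2_sum)
  then have "hf_norm H f \<le> hf_norm H g + hf_norm H h"
    by (rule power2_le_imp_le) (use hf_norm_nonneg[OF g] hf_norm_nonneg[OF h] in simp)
  then show ?thesis by (simp only: h_def)
qed

lemma complete:
  assumes "\<And>n. F n \<in> V"
    and "\<And>e. 0 < e \<Longrightarrow> \<exists>M. \<forall>m\<ge>M. \<forall>n\<ge>M. hf_norm H (\<lambda>x. F m x - F n x) < e"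
  shows "\<exists>f\<in>V. (\<lambda>n. hf_norm H (\<lambda>x. F n x - f x)) \<longlonglongrightarrow> 0"
  using rkhs assms unfolding is_rkhs_def is_norm_complete_def by blast

definition combo :: "nat \<Rightarrow> (nat \<Rightarrow> 'x) \<Rightarrow> (nat \<Rightarrow> complex) \<Rightarrow> 'x \<Rightarrow> complex" where
  "combo n x a = (\<lambda>y. \<Sum>i<n. a i * kf (x i) y)"

lemma combo_mem: "\<forall>i<n. x i \<in> X \<Longrightarrow> combo n x a \<in> V"
  unfolding combo_def by (intro sum_mem scale_mem kf_mem) auto

lemma ip_combo_right:
  assumes "\<forall>i<n. x i \<in> X" "f \<in> V"
  shows "ip f (combo n x a) = (\<Sum>i<n. cnj (a i) * f (x i))"
proof -
  have "ip f (combo n x a) = (\<Sum>i<n. ip f (\<lambda>y. a i * kf (x i) y))"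
    unfolding combo_def by (rule ip_sum_right) (use assms in \<open>auto intro: scale_mem kf_mem\<close>)
  also have "\<dots> = (\<Sum>i<n. cnj (a i) * f (x i))"
    by (intro sum.cong refl) (use assms in \<open>auto simp: ip_scale_right kf_mem reproducing\<close>)
  finally show ?thesis .
qed

lemma ip_combo_self:
  assumes "\<forall>i<n. x i \<in> X"
  shows "ip (combo n x a) (combo n x a) = (\<Sum>i<n. \<Sum>j<n. cnj (a i) * a j * k (x i) (x j))"
proof -
  have "ip (combo n x a) (combo n x a) = (\<Sum>i<n. cnj (a i) * combo n x a (x i))"
    using assms by (intro ip_combo_right combo_mem)
  also have "\<dots> = (\<Sum>i<n. \<Sum>j<n. cnj (a i) * a j * k (x i) (x j))"
    unfolding combo_def sum_distrib_left
    by (intro sum.cong refl) (use assms in \<open>simp add: kernel_fun_def mult.assoc\<close>)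
  finally show ?thesis .
qed

text \<open>The Riesz representation theorem for a functional that is prescribed on the kernel functions by the
  values of \<open>g\<close> and bounded on their span.  The representing element minimizes
  \<open>\<parallel>f\<parallel>\<^sup>2 - 2 Re \<langle>g, f\<rangle>\<close>; by the parallelogram law minimizing sequences in the span are Cauchy, and
  the Euler equation of the limit says that it has the same values as \<open>g\<close>.\<close>

lemma bounded_functional_represented:
  assumes goff: "\<And>x. x \<notin> X \<Longrightarrow> g x = 0" and C: "0 \<le> C"
    and bound: "\<And>(n::nat) x a. \<forall>i<n. x i \<in> X \<Longrightarrow>
       cmod (\<Sum>i<n. cnj (a i) * g (x i)) \<le> C * hf_norm H (combo n x a)"
  shows "g \<in> V" "hf_norm H g \<le> C"
proof -
  \<comment> \<open>The graph of the functional.  It is a relation, since one function may be a combination in several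
    ways.\<close>
  define P where "P = {(combo n x a, \<Sum>i<n. cnj (a i) * g (x i)) | n x a. \<forall>i<n. x i \<in> X}"
  have P_mem: "f \<in> V" and P_bound: "cmod s \<le> C * hf_norm H f" if "(f, s) \<in> P" for f s
    using that bound combo_mem unfolding P_def by auto
  have P_kf: "(kf x, g x) \<in> P" if "x \<in> X" for x
    unfolding P_def using that
    by (auto intro!: exI[of _ 1] exI[of _ "\<lambda>_. x"] exI[of _ "\<lambda>_. 1"] simp: combo_def)
  have P_zero: "((\<lambda>x. 0), 0) \<in> P"
    unfolding P_def by (auto intro!: exI[of _ 0] simp: combo_def)
  have P_scale: "((\<lambda>x. c * f x), cnj c * s) \<in> P" if fs: "(f, s) \<in> P" for f s c
  proof -
    obtain n x a where "f = combo n x a" "s = (\<Sum>i<n. cnj (a i) * g (x i))" "\<forall>i<n. x i \<in> X"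
      using fs unfolding P_def by blast
    then show ?thesis
      unfolding P_def
      by (auto intro!: exI[of _ n] exI[of _ x] exI[of _ "\<lambda>i. c * a i"] simp: combo_def sum_distrib_left mult_ac)
  qed
  have P_add: "((\<lambda>x. f x + f' x), s + s') \<in> P" if fs: "(f, s) \<in> P" "(f', s') \<in> P" for f s f' s'
  proof -
    obtain n x a where 1: "f = combo n x a" "s = (\<Sum>i<n. cnj (a i) * g (x i))" "\<forall>i<n. x i \<in> X"
      using fs(1) unfolding P_def by blast
    obtain n' x' a' where 2: "f' = combo n' x' a'" "s' = (\<Sum>i<n'. cnj (a' i) * g (x' i))" "\<forall>i<n'. x' i \<in> X"
      using fs(2) unfolding P_def by blast
    have split: "(\<Sum>i<n + n'. F (if i < n then x i else x' (i - n)) (if i < n then a i else a' (i - n)))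
        = (\<Sum>i<n. F (x i) (a i)) + (\<Sum>i<n'. F (x' i) (a' i))" for F :: "'x \<Rightarrow> complex \<Rightarrow> complex"
      by (induction n') (simp_all add: add.assoc)
    show ?thesis
      unfolding P_def 1(1,2) 2(1,2) mem_Collect_eq
      using 1(3) 2(3)
      by (intro exI[of _ "n + n'"] exI[of _ "\<lambda>i. if i < n then x i else x' (i - n)"]
          exI[of _ "\<lambda>i. if i < n then a i else a' (i - n)"])
        (auto simp: combo_def split[of "\<lambda>x a. a * kf x _"] split[of "\<lambda>x a. cnj a * g x"])
  qed
  define Q where "Q = (\<lambda>(f, s). nsq f - 2 * Re s)"
  have Q_ge: "- C\<^sup>2 \<le> Q p" if "p \<in> P" for p
  proof -
    obtain f s where p: "p = (f, s)" by fastforce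
    then have f: "f \<in> V" and s: "cmod s \<le> C * hf_norm H f" using that P_mem P_bound by auto
    have "Re s \<le> C * hf_norm H f" using s complex_Re_le_cmod order_trans by blast
    moreover have "0 \<le> (hf_norm H f - C)\<^sup>2" by simp
    ultimately show ?thesis
      using hf_norm_nsq[OF f] by (simp add: Q_def p power2_diff mult.commute[of C])
  qed
  define I where "I = Inf (Q ` P)"
  have bdd: "bdd_below (Q ` P)" by (rule bdd_belowI2[OF Q_ge])
  have I_le: "I \<le> Q p" if "p \<in> P" for p
    unfolding I_def by (rule cInf_lower[OF imageI[OF that] bdd])
  have "\<exists>p\<in>P. Q p < I + 1 / Suc n" for n
  proof -
    have "Inf (Q ` P) < I + 1 / Suc n" by (simp add: I_def)
    then show ?thesis using P_zero bdd cInf_less_iff[of "Q ` P" "I + 1 / Suc n"] by blast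
  qed
  then obtain p where p: "\<And>n. p n \<in> P" "\<And>n. Q (p n) < I + 1 / Suc n" by metis
  define F S where "F n = fst (p n)" and "S n = snd (p n)" for n
  have FS: "(F n, S n) \<in> P" for n using p(1) by (simp add: F_def S_def)
  have FV: "F n \<in> V" for n using P_mem[OF FS] .
  have QF: "Q (F n, S n) < I + 1 / Suc n" for n using p(2) by (simp add: F_def S_def)
  have close: "nsq (\<lambda>x. F m x - F n x) \<le> 2 / Suc m + 2 / Suc n" for m n
  proof -
    have mid: "((\<lambda>x. (1/2) * (F m x + F n x)), cnj (1/2) * (S m + S n)) \<in> P"
      by (rule P_scale[OF P_add[OF FS FS]])
    have "nsq (\<lambda>x. (1/2) * (F m x + F n x)) = (nsq (F m) + nsq (F n) + 2 * Re (ip (F m) (F n))) / 4"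
      by (subst nsq_scale) (simp_all add: add_mem FV nsq_add power2_eq_square)
    then have "4 * I \<le> nsq (F m) + nsq (F n) + 2 * Re (ip (F m) (F n)) - 4 * (Re (S m) + Re (S n))"
      using I_le[OF mid] by (simp add: Q_def field_simps)
    then show ?thesis
      using QF[of m] QF[of n] by (simp add: Q_def nsq_diff FV)
  qed
  have "\<exists>h\<in>V. (\<lambda>n. hf_norm H (\<lambda>x. F n x - h x)) \<longlonglongrightarrow> 0"
  proof (rule complete[OF FV])
    fix e :: real assume e: "0 < e"
    obtain M :: nat where M: "4 / e\<^sup>2 < M" using reals_Archimedean2 by blast
    have "hf_norm H (\<lambda>x. F m x - F n x) < e" if mn: "m \<ge> M" "n \<ge> M" for m n
    proof -
      have "0 < real M" using M e by (smt (verit) divide_pos_pos zero_less_power)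
      have "2 / Suc m \<le> 2 / M" "2 / Suc n \<le> 2 / M"
        using mn \<open>0 < real M\<close> by (auto intro!: divide_left_mono)
      then have "nsq (\<lambda>x. F m x - F n x) \<le> 4 / M" using close[of m n] by simp
      also have "4 / M < e\<^sup>2" using M e \<open>0 < real M\<close> by (simp add: field_simps)
      finally have "(hf_norm H (\<lambda>x. F m x - F n x))\<^sup>2 < e\<^sup>2"
        by (simp add: hf_norm_nsq diff_mem FV)
      then show ?thesis by (rule power2_less_imp_less) (use e in simp)
    qed
    then show "\<exists>M. \<forall>m\<ge>M. \<forall>n\<ge>M. hf_norm H (\<lambda>x. F m x - F n x) < e" by blast
  qed
  then obtain h where h: "h \<in> V" and lim: "(\<lambda>n. hf_norm H (\<lambda>x. F n x - h x)) \<longlonglongrightarrow> 0" by blast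
  have ip_lim: "(\<lambda>n. ip (F n) f) \<longlonglongrightarrow> ip h f" if f: "f \<in> V" for f
  proof -
    have b: "cmod (ip (F n) f - ip h f) \<le> hf_norm H (\<lambda>x. F n x - h x) * hf_norm H f" for n
      using cauchy_schwarz[OF diff_mem[OF FV h] f] by (simp add: ip_diff_left FV h f)
    have l: "(\<lambda>n. hf_norm H (\<lambda>x. F n x - h x) * hf_norm H f) \<longlonglongrightarrow> 0"
      using tendsto_mult_left_zero[OF lim] .
    have "(\<lambda>n. ip (F n) f - ip h f) \<longlonglongrightarrow> 0"
      by (rule Lim_null_comparison[OF always_eventually l]) (use b in blast)
    then show ?thesis by (simp add: LIM_zero_iff)
  qed
  \<comment> \<open>Variation of the minimizing sequence in the direction \<open>f\<close>, with the step \<open>c\<close> below.\<close>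
  have euler: "ip h f = t" if ft: "(f, t) \<in> P" for f t
  proof -
    have f: "f \<in> V" using P_mem[OF ft] .
    define d where "d n = ip (F n) f - t" for n
    define \<tau> where "\<tau> = 1 / (nsq f + 1)"
    have \<tau>: "0 < \<tau>" "\<tau> * nsq f \<le> 1" using nsq_nonneg[OF f] by (auto simp: \<tau>_def)
    have b: "(cmod (d n))\<^sup>2 \<le> (1 / \<tau>) * (1 / Suc n)" for n
    proof -
      define c where "c = - complex_of_real \<tau> * d n"
      have "I \<le> Q ((\<lambda>x. F n x + c * f x), S n + cnj c * t)"
        by (rule I_le[OF P_add[OF FS P_scale[OF ft]]])
      also have "\<dots> = Q (F n, S n) + (cmod c)\<^sup>2 * nsq f + 2 * Re (cnj c * d n)"
        by (simp add: Q_def nsq_add nsq_scale ip_scale_right scale_mem FV f d_def algebra_simps)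
      also have "(cmod c)\<^sup>2 = \<tau>\<^sup>2 * (cmod (d n))\<^sup>2"
        by (simp add: c_def norm_mult power_mult_distrib)
      also have "Re (cnj c * d n) = - \<tau> * (cmod (d n))\<^sup>2"
        unfolding cmod_power2 by (simp add: c_def power2_eq_square algebra_simps)
      finally have "2 * \<tau> * (cmod (d n))\<^sup>2 - \<tau> * (\<tau> * nsq f) * (cmod (d n))\<^sup>2 \<le> 1 / Suc n"
        using QF[of n] by (simp add: power2_eq_square algebra_simps)
      moreover have "\<tau> * (\<tau> * nsq f) * (cmod (d n))\<^sup>2 \<le> \<tau> * 1 * (cmod (d n))\<^sup>2"
        using \<tau> by (intro mult_right_mono mult_left_mono) auto
      ultimately have "\<tau> * (cmod (d n))\<^sup>2 \<le> 1 / Suc n" by linarith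
      then have "(1 / \<tau>) * (\<tau> * (cmod (d n))\<^sup>2) \<le> (1 / \<tau>) * (1 / Suc n)"
        by (rule mult_left_mono) (use \<tau>(1) in simp)
      then show ?thesis using \<tau>(1) by simp
    qed
    have l: "(\<lambda>n. (1 / \<tau>) * (1 / Suc n)) \<longlonglongrightarrow> 0"
      by (rule tendsto_mult_right_zero) (rule LIMSEQ_Suc[OF lim_1_over_n])
    have "(\<lambda>n. (cmod (d n))\<^sup>2) \<longlonglongrightarrow> 0"
      by (rule Lim_null_comparison[OF always_eventually l]) (use b in simp)
    then have "(\<lambda>n. sqrt ((cmod (d n))\<^sup>2)) \<longlonglongrightarrow> sqrt 0" by (rule tendsto_real_sqrt)
    then have "d \<longlonglongrightarrow> 0" by (simp add: tendsto_norm_zero_iff)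
    then have "(\<lambda>n. ip (F n) f) \<longlonglongrightarrow> t" by (simp add: d_def[abs_def] LIM_zero_iff)
    then show ?thesis using ip_lim[OF f] LIMSEQ_unique by blast
  qed
  have "h = g"
  proof
    fix x show "h x = g x"
      using euler[OF P_kf] reproducing[OF _ h] off[OF h] goff by (cases "x \<in> X") auto
  qed
  then show gV: "g \<in> V" using h by simp
  note lim = lim[unfolded \<open>h = g\<close>] and euler = euler[unfolded \<open>h = g\<close>]
  have "nsq g \<le> C * (hf_norm H g + hf_norm H (\<lambda>x. F n x - g x)) + hf_norm H g * hf_norm H (\<lambda>x. F n x - g x)" for n
  proof -
    have "ip g g = ip g (F n) - ip g (\<lambda>x. F n x - g x)"
      by (simp add: ip_diff_right gV FV)
    then have "cmod (ip g g) \<le> cmod (ip g (F n)) + cmod (ip g (\<lambda>x. F n x - g x))"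
      by (simp add: norm_triangle_ineq4)
    also have "cmod (ip g (F n)) \<le> C * hf_norm H (F n)"
      unfolding euler[OF FS] by (rule P_bound[OF FS])
    also have "\<dots> \<le> C * (hf_norm H g + hf_norm H (\<lambda>x. F n x - g x))"
      using C by (intro mult_left_mono hf_norm_triangle FV gV)
    also have "cmod (ip g (\<lambda>x. F n x - g x)) \<le> hf_norm H g * hf_norm H (\<lambda>x. F n x - g x)"
      by (intro cauchy_schwarz gV diff_mem FV)
    finally show ?thesis using nsq_nonneg[OF gV] by (simp add: ip_self gV)
  qed
  note 1 = this
  have 2: "(\<lambda>n. C * (hf_norm H g + hf_norm H (\<lambda>x. F n x - g x)) + hf_norm H g * hf_norm H (\<lambda>x. F n x - g x))
      \<longlonglongrightarrow> C * (hf_norm H g + 0) + hf_norm H g * 0"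
    by (intro tendsto_intros lim)
  have "nsq g \<le> C * (hf_norm H g + 0) + hf_norm H g * 0"
    by (rule LIMSEQ_le_const[OF 2]) (use 1 in blast)
  then have "hf_norm H g * hf_norm H g \<le> C * hf_norm H g"
    using hf_norm_nsq[OF gV] by (simp add: power2_eq_square)
  then show "hf_norm H g \<le> C"
    using hf_norm_nonneg[OF gV] C by (cases "hf_norm H g = 0") auto
qed

end

section \<open>Existence of the space of a diagonal kernel\<close>

definition l2 :: "(nat \<Rightarrow> complex) set" where
  "l2 = {b. summable (\<lambda>m. (cmod (b m))\<^sup>2)}"

definition l2_ip :: "(nat \<Rightarrow> complex) \<Rightarrow> (nat \<Rightarrow> complex) \<Rightarrow> complex" where
  "l2_ip a b = (\<Sum>m. a m * cnj (b m))"

lemma l2_summable_mult: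
  assumes "a \<in> l2" "b \<in> l2"
  shows "summable (\<lambda>m. a m * b m)"
proof (rule summable_comparison_test'[of "\<lambda>m. (cmod (a m))\<^sup>2 + (cmod (b m))\<^sup>2" 0])
  show "summable (\<lambda>m. (cmod (a m))\<^sup>2 + (cmod (b m))\<^sup>2)"
    using assms unfolding l2_def by (auto intro: summable_add)
  fix m
  have "2 * (cmod (a m) * cmod (b m)) \<le> (cmod (a m))\<^sup>2 + (cmod (b m))\<^sup>2"
    using sum_squares_bound[of "cmod (a m)" "cmod (b m)"] by (simp add: mult.assoc)
  moreover have "0 \<le> cmod (a m) * cmod (b m)" by simp
  ultimately show "norm (a m * b m) \<le> (cmod (a m))\<^sup>2 + (cmod (b m))\<^sup>2"
    unfolding norm_mult by linarith
qed

lemma l2_cnj: "b \<in> l2 \<Longrightarrow> (\<lambda>m. cnj (b m)) \<in> l2"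
  by (simp add: l2_def)

lemma l2_scale: "b \<in> l2 \<Longrightarrow> (\<lambda>m. c * b m) \<in> l2"
  by (simp add: l2_def norm_mult power_mult_distrib summable_mult)

lemma l2_add:
  assumes "a \<in> l2" "b \<in> l2"
  shows "(\<lambda>m. a m + b m) \<in> l2"
  unfolding l2_def mem_Collect_eq
proof (rule summable_comparison_test'[of "\<lambda>m. 2 * (cmod (a m))\<^sup>2 + 2 * (cmod (b m))\<^sup>2" 0])
  show "summable (\<lambda>m. 2 * (cmod (a m))\<^sup>2 + 2 * (cmod (b m))\<^sup>2)"
    using assms unfolding l2_def by (auto intro: summable_add summable_mult)
  fix m
  have "(cmod (a m + b m))\<^sup>2 \<le> (cmod (a m) + cmod (b m))\<^sup>2"
    by (intro power_mono norm_triangle_ineq) simp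
  also have "\<dots> \<le> 2 * (cmod (a m))\<^sup>2 + 2 * (cmod (b m))\<^sup>2"
    using sum_squares_bound[of "cmod (a m)" "cmod (b m)"] by (simp add: power2_sum)
  finally show "norm ((cmod (a m + b m))\<^sup>2) \<le> 2 * (cmod (a m))\<^sup>2 + 2 * (cmod (b m))\<^sup>2" by simp
qed

lemma l2_diff: "a \<in> l2 \<Longrightarrow> b \<in> l2 \<Longrightarrow> (\<lambda>m. a m - b m) \<in> l2"
  using l2_add[of a "\<lambda>m. -1 * b m"] l2_scale[of b "-1"] by simp

lemma l2_zero: "(\<lambda>m. 0) \<in> l2"
  by (simp add: l2_def)

lemma l2_ip_self: "b \<in> l2 \<Longrightarrow> l2_ip b b = complex_of_real (\<Sum>m. (cmod (b m))\<^sup>2)"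
  unfolding l2_ip_def complex_norm_square[symmetric] l2_def by (simp add: suminf_of_real)

text \<open>The limit is formed coordinatewise; finite partial sums carry the Cauchy estimate over to it.\<close>

lemma l2_complete:
  assumes F: "\<And>n. F n \<in> l2"
    and cauchy: "\<And>e. 0 < e \<Longrightarrow> \<exists>M. \<forall>m\<ge>M. \<forall>n\<ge>M. (\<Sum>j. (cmod (F m j - F n j))\<^sup>2) \<le> e"
  shows "\<exists>b\<in>l2. (\<lambda>n. \<Sum>j. (cmod (F n j - b j))\<^sup>2) \<longlonglongrightarrow> 0"
proof -
  have summ: "summable (\<lambda>j. (cmod (F m j - F n j))\<^sup>2)" for m n
    using l2_diff[OF F F] by (simp add: l2_def)
  have "Cauchy (\<lambda>n. F n j)" for j
  proof (rule metric_CauchyI)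
    fix e :: real assume e: "0 < e"
    then obtain M where M: "\<forall>m\<ge>M. \<forall>n\<ge>M. (\<Sum>j. (cmod (F m j - F n j))\<^sup>2) \<le> (e / 2)\<^sup>2"
      using cauchy[of "(e / 2)\<^sup>2"] by auto
    have "dist (F m j) (F n j) < e" if "m \<ge> M" "n \<ge> M" for m n
    proof -
      have "(cmod (F m j - F n j))\<^sup>2 \<le> (\<Sum>j. (cmod (F m j - F n j))\<^sup>2)"
        using sum_le_suminf[OF summ[of m n], of "{j}"] by simp
      also have "\<dots> \<le> (e / 2)\<^sup>2" using M that by blast
      finally have "cmod (F m j - F n j) \<le> e / 2" by (rule power2_le_imp_le) (use e in simp)
      then show ?thesis using e by (simp add: dist_norm)
    qed
    then show "\<exists>M. \<forall>m\<ge>M. \<forall>n\<ge>M. dist (F m j) (F n j) < e" by blast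
  qed
  then have "\<forall>j. \<exists>l. (\<lambda>n. F n j) \<longlonglongrightarrow> l"
    using Cauchy_convergent convergent_def by blast
  from choice[OF this] obtain b where b: "\<And>j. (\<lambda>n. F n j) \<longlonglongrightarrow> b j" by blast
  have close: "\<exists>M. \<forall>n\<ge>M. summable (\<lambda>j. (cmod (F n j - b j))\<^sup>2) \<and> (\<Sum>j. (cmod (F n j - b j))\<^sup>2) \<le> e"
    if e: "0 < e" for e
  proof -
    obtain M where M: "\<forall>m\<ge>M. \<forall>n\<ge>M. (\<Sum>j. (cmod (F m j - F n j))\<^sup>2) \<le> e"
      using cauchy[OF e] by blast
    have part: "(\<Sum>j<J. (cmod (F n j - b j))\<^sup>2) \<le> e" if n: "n \<ge> M" for n J
    proof (rule LIMSEQ_le_const2)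
      show "(\<lambda>m. \<Sum>j<J. (cmod (F n j - F m j))\<^sup>2) \<longlonglongrightarrow> (\<Sum>j<J. (cmod (F n j - b j))\<^sup>2)"
        by (intro tendsto_intros b)
      have "(\<Sum>j<J. (cmod (F n j - F m j))\<^sup>2) \<le> e" if "m \<ge> M" for m
        using sum_le_suminf[OF summ[of n m], of "{..<J}"] M n that by (meson finite_lessThan order_trans zero_le_power2)
      then show "\<exists>N. \<forall>m\<ge>N. (\<Sum>j<J. (cmod (F n j - F m j))\<^sup>2) \<le> e" by blast
    qed
    have "summable (\<lambda>j. (cmod (F n j - b j))\<^sup>2) \<and> (\<Sum>j. (cmod (F n j - b j))\<^sup>2) \<le> e" if n: "n \<ge> M" for n
    proof -
      have s: "summable (\<lambda>j. (cmod (F n j - b j))\<^sup>2)"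
        by (rule summableI_nonneg_bounded[where x = e]) (use part[OF n] in auto)
      then show ?thesis using suminf_le_const[OF s] part[OF n] by blast
    qed
    then show ?thesis by blast
  qed
  obtain M where "summable (\<lambda>j. (cmod (F M j - b j))\<^sup>2)" using close[of 1] by auto
  then have "(\<lambda>j. F M j - b j) \<in> l2" by (simp add: l2_def)
  from l2_diff[OF F[of M] this] have bl2: "b \<in> l2" by simp
  have "(\<lambda>n. \<Sum>j. (cmod (F n j - b j))\<^sup>2) \<longlonglongrightarrow> 0"
  proof (rule LIMSEQ_I)
    fix e :: real assume e: "0 < e"
    obtain M where M: "\<forall>n\<ge>M. summable (\<lambda>j. (cmod (F n j - b j))\<^sup>2) \<and> (\<Sum>j. (cmod (F n j - b j))\<^sup>2) \<le> e / 2"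
      using close[of "e / 2"] e by auto
    have "norm ((\<Sum>j. (cmod (F n j - b j))\<^sup>2) - 0) < e" if "n \<ge> M" for n
    proof -
      have "0 \<le> (\<Sum>j. (cmod (F n j - b j))\<^sup>2)" using M that by (intro suminf_nonneg) auto
      then show ?thesis using M that e by fastforce
    qed
    then show "\<exists>M. \<forall>n\<ge>M. norm ((\<Sum>j. (cmod (F n j - b j))\<^sup>2) - 0) < e" by blast
  qed
  then show ?thesis using bl2 by blast
qed

text \<open>The space consists of the functions \<open>\<Sum>m. b m * e m x\<close> with \<open>b\<close> in \<open>l2\<close>; injectivity transports the
  inner product from coefficient sequences to functions.\<close>

lemma is_rkhs_feature_map:
  fixes e :: "nat \<Rightarrow> 'x \<Rightarrow> complex"
  assumes e: "\<And>x. x \<in> X \<Longrightarrow> (\<lambda>m. e m x) \<in> l2"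
    and inj: "\<And>b. b \<in> l2 \<Longrightarrow> (\<And>x. x \<in> X \<Longrightarrow> (\<Sum>m. b m * e m x) = 0) \<Longrightarrow> b = (\<lambda>m. 0)"
    and k: "\<And>z w. z \<in> X \<Longrightarrow> w \<in> X \<Longrightarrow> k z w = (\<Sum>m. e m z * cnj (e m w))"
  shows "\<exists>H. is_rkhs X k H"
proof -
  define T where "T b = (\<lambda>x. if x \<in> X then \<Sum>m. b m * e m x else 0)" for b :: "nat \<Rightarrow> complex"
  have T_add: "T (\<lambda>m. a m + b m) = (\<lambda>x. T a x + T b x)" if "a \<in> l2" "b \<in> l2" for a b
    using that by (auto simp: T_def ring_distribs intro!: suminf_add[symmetric] l2_summable_mult e)
  have T_scale: "T (\<lambda>m. c * b m) = (\<lambda>x. c * T b x)" if "b \<in> l2" for b c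
    using that by (auto simp: T_def mult.assoc intro!: suminf_mult l2_summable_mult e)
  have T_diff: "T (\<lambda>m. a m - b m) = (\<lambda>x. T a x - T b x)" if "a \<in> l2" "b \<in> l2" for a b
    using T_add[OF that(1) l2_scale[OF that(2)], of "-1"] T_scale[OF that(2), of "-1"] by simp
  have T_zero: "T (\<lambda>m. 0) = (\<lambda>x. 0)" by (auto simp: T_def)
  have T_inj: "inj_on T l2"
  proof (rule inj_onI)
    fix a b assume ab: "a \<in> l2" "b \<in> l2" and eq: "T a = T b"
    have "(\<lambda>m. a m - b m) = (\<lambda>m. 0)"
    proof (rule inj[OF l2_diff[OF ab]])
      fix x assume x: "x \<in> X"
      have "T (\<lambda>m. a m - b m) x = 0" unfolding T_diff[OF ab] eq by simp
      then show "(\<Sum>m. (a m - b m) * e m x) = 0" using x by (simp add: T_def)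
    qed
    then show "a = b" by (metis eq_iff_diff_eq_0 ext)
  qed
  define R where "R = the_inv_into l2 T"
  have R: "R (T b) = b" if "b \<in> l2" for b
    unfolding R_def by (rule the_inv_into_f_f[OF T_inj that])
  define V where "V = T ` l2"
  have TV: "T b \<in> V" if "b \<in> l2" for b using that by (simp add: V_def)
  have RV: "R f \<in> l2" "T (R f) = f" if "f \<in> V" for f
    using that R by (auto simp: V_def)
  have R_add: "R (\<lambda>x. f x + g x) = (\<lambda>m. R f m + R g m)" if "f \<in> V" "g \<in> V" for f g
    using R[OF l2_add[OF RV(1)[OF that(1)] RV(1)[OF that(2)]]] T_add[OF RV(1)[OF that(1)] RV(1)[OF that(2)]] RV(2) that
    by simp
  have R_diff: "R (\<lambda>x. f x - g x) = (\<lambda>m. R f m - R g m)" if "f \<in> V" "g \<in> V" for f g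
    using R[OF l2_diff[OF RV(1)[OF that(1)] RV(1)[OF that(2)]]] T_diff[OF RV(1)[OF that(1)] RV(1)[OF that(2)]] RV(2) that
    by simp
  have R_scale: "R (\<lambda>x. c * f x) = (\<lambda>m. c * R f m)" if "f \<in> V" for c f
    using R[OF l2_scale[OF RV(1)[OF that]]] T_scale[OF RV(1)[OF that]] RV(2)[OF that] by simp
  have V_diff: "(\<lambda>x. f x - g x) \<in> V" if "f \<in> V" "g \<in> V" for f g
    using TV[OF l2_diff[OF RV(1)[OF that(1)] RV(1)[OF that(2)]]] T_diff[OF RV(1)[OF that(1)] RV(1)[OF that(2)]] RV(2) that
    by simp
  define H where "H = (V, \<lambda>f g. l2_ip (R f) (R g))"
  have fs: "is_function_space X V"
    unfolding is_function_space_def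
  proof (intro conjI ballI allI impI)
    fix f x assume "f \<in> V" "x \<notin> X"
    then show "f x = 0" by (auto simp: V_def T_def)
  next
    show "(\<lambda>x. 0) \<in> V" using TV[OF l2_zero] by (simp add: T_zero)
  next
    fix f g assume "f \<in> V" "g \<in> V"
    then show "(\<lambda>x. f x + g x) \<in> V"
      using TV[OF l2_add[OF RV(1)[of f] RV(1)[of g]]] T_add[OF RV(1)[of f] RV(1)[of g]] RV(2) by simp
  next
    fix c f assume "f \<in> V"
    then show "(\<lambda>x. c * f x) \<in> V"
      using TV[OF l2_scale[OF RV(1)[of f]]] T_scale[OF RV(1)[of f]] RV(2) by simp
  qed
  have summ: "summable (\<lambda>m. R f m * cnj (R g m))" if "f \<in> V" "g \<in> V" for f g
    by (rule l2_summable_mult[OF RV(1)[OF that(1)] l2_cnj[OF RV(1)[OF that(2)]]])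
  have self: "l2_ip (R f) (R f) = complex_of_real (\<Sum>m. (cmod (R f m))\<^sup>2)" if "f \<in> V" for f
    by (rule l2_ip_self[OF RV(1)[OF that]])
  have sq: "summable (\<lambda>m. (cmod (R f m))\<^sup>2)" if "f \<in> V" for f
    using RV(1)[OF that] by (simp add: l2_def)
  have ip: "is_inner_product V (\<lambda>f g. l2_ip (R f) (R g))"
    unfolding is_inner_product_def
  proof (intro conjI ballI allI impI)
    fix f g h assume m: "f \<in> V" "g \<in> V" "h \<in> V"
    show "l2_ip (R (\<lambda>x. f x + g x)) (R h) = l2_ip (R f) (R h) + l2_ip (R g) (R h)"
      unfolding R_add[OF m(1,2)] l2_ip_def ring_distribs
      by (rule suminf_add[symmetric, OF summ[OF m(1,3)] summ[OF m(2,3)]])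
  next
    fix c f h assume m: "f \<in> V" "h \<in> V"
    show "l2_ip (R (\<lambda>x. c * f x)) (R h) = c * l2_ip (R f) (R h)"
      unfolding R_scale[OF m(1)] l2_ip_def mult.assoc by (rule suminf_mult[OF summ[OF m]])
  next
    fix f g assume m: "f \<in> V" "g \<in> V"
    have "(\<lambda>m. cnj (R f m * cnj (R g m))) sums cnj (l2_ip (R f) (R g))"
      unfolding l2_ip_def sums_cnj by (rule summable_sums[OF summ[OF m]])
    then have "(\<lambda>m. R g m * cnj (R f m)) sums cnj (l2_ip (R f) (R g))" by (simp add: mult.commute)
    then show "l2_ip (R g) (R f) = cnj (l2_ip (R f) (R g))"
      unfolding l2_ip_def by (simp add: sums_iff)
  next
    fix f assume m: "f \<in> V"
    show "0 \<le> l2_ip (R f) (R f)"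
      unfolding self[OF m] using suminf_nonneg[OF sq[OF m]] by (simp add: less_eq_complex_def)
  next
    fix f assume m: "f \<in> V" and z: "l2_ip (R f) (R f) = 0"
    have "(\<Sum>m. (cmod (R f m))\<^sup>2) = 0" using z unfolding self[OF m] by simp
    then have "\<forall>m. (cmod (R f m))\<^sup>2 = 0" by (subst (asm) suminf_eq_zero_iff[OF sq[OF m]]) auto
    then have "R f = (\<lambda>m. 0)" by auto
    then show "f = (\<lambda>x. 0)" using RV(2)[OF m] T_zero by simp
  qed
  have norm: "(hf_norm H f)\<^sup>2 = (\<Sum>m. (cmod (R f m))\<^sup>2)" "0 \<le> hf_norm H f" if "f \<in> V" for f
    using suminf_nonneg[OF sq[OF that]] by (simp_all add: hf_norm_def H_def self[OF that])
  have complete: "is_norm_complete H"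
    unfolding is_norm_complete_def
  proof (intro allI impI, elim conjE)
    fix F assume "\<forall>n::nat. F n \<in> fst H"
      and cauchy: "\<forall>e>0. \<exists>M. \<forall>m\<ge>M. \<forall>n\<ge>M. hf_norm H (\<lambda>x. F m x - F n x) < e"
    then have F: "F n \<in> V" for n by (simp add: H_def)
    have "\<exists>b\<in>l2. (\<lambda>n. \<Sum>j. (cmod (R (F n) j - b j))\<^sup>2) \<longlonglongrightarrow> 0"
    proof (rule l2_complete[OF RV(1)[OF F]])
      fix e :: real assume "0 < e"
      then obtain M where M: "\<forall>m\<ge>M. \<forall>n\<ge>M. hf_norm H (\<lambda>x. F m x - F n x) < sqrt e"
        using cauchy by (meson real_sqrt_gt_zero)
      have "(\<Sum>j. (cmod (R (F m) j - R (F n) j))\<^sup>2) \<le> e" if "m \<ge> M" "n \<ge> M" for m n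
      proof -
        have "(hf_norm H (\<lambda>x. F m x - F n x))\<^sup>2 \<le> (sqrt e)\<^sup>2"
          by (rule power_mono[OF less_imp_le norm(2)[OF V_diff[OF F F]]]) (use M that in blast)
        then show ?thesis
          using \<open>0 < e\<close> unfolding norm(1)[OF V_diff[OF F F]] R_diff[OF F F] by simp
      qed
      then show "\<exists>M. \<forall>m\<ge>M. \<forall>n\<ge>M. (\<Sum>j. (cmod (R (F m) j - R (F n) j))\<^sup>2) \<le> e" by blast
    qed
    then obtain b where b: "b \<in> l2" and lim: "(\<lambda>n. \<Sum>j. (cmod (R (F n) j - b j))\<^sup>2) \<longlonglongrightarrow> 0" by blast
    have sqn: "(\<Sum>j. (cmod (R (F n) j - b j))\<^sup>2) = (hf_norm H (\<lambda>x. F n x - T b x))\<^sup>2" for n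
      unfolding norm(1)[OF V_diff[OF F TV[OF b]]] R_diff[OF F TV[OF b]] R[OF b] ..
    have "(\<lambda>n. sqrt ((hf_norm H (\<lambda>x. F n x - T b x))\<^sup>2)) \<longlonglongrightarrow> sqrt 0"
      using tendsto_real_sqrt[OF lim] unfolding sqn .
    then have "(\<lambda>n. hf_norm H (\<lambda>x. F n x - T b x)) \<longlonglongrightarrow> 0"
      using norm(2)[OF V_diff[OF F TV[OF b]]] by simp
    then show "\<exists>f\<in>fst H. (\<lambda>n. hf_norm H (\<lambda>x. F n x - f x)) \<longlonglongrightarrow> 0"
      using TV[OF b] unfolding H_def fst_conv by (rule bexI)
  qed
  have kf: "kernel_fun X k w = T (\<lambda>m. cnj (e m w))" if "w \<in> X" for w
    using that by (auto simp: kernel_fun_def T_def k mult.commute)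
  have kfV: "kernel_fun X k w \<in> V" if "w \<in> X" for w
    unfolding kf[OF that] by (rule TV[OF l2_cnj[OF e[OF that]]])
  have rep: "f w = l2_ip (R f) (R (kernel_fun X k w))" if w: "w \<in> X" and f: "f \<in> V" for f w
  proof -
    have "f w = T (R f) w" by (simp only: RV(2)[OF f])
    also have "\<dots> = l2_ip (R f) (\<lambda>m. cnj (e m w))" using w by (simp add: T_def l2_ip_def)
    finally show ?thesis unfolding kf[OF w] R[OF l2_cnj[OF e[OF w]]] .
  qed
  have "is_rkhs X k H"
    unfolding is_rkhs_def using fs ip complete kfV rep by (simp add: H_def)
  then show ?thesis ..
qed

text \<open>With the features \<open>\<surd>F\<^sub>m z\<^sup>m\<close> the space consists of the power series \<open>\<Sum> a\<^sub>m z\<^sup>m\<close> for which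
  \<open>\<Sum> \<bar>a\<^sub>m\<bar>\<^sup>2 / F\<^sub>m\<close> is finite, and the identity theorem for power series makes the map from
  \<open>l2\<close> injective.\<close>

lemma is_rkhs_rkhs:
  assumes r: "0 < r" and exp: "diag_expansion r F k" and pos: "\<And>m. 0 < fps_nth F m"
  shows "is_rkhs (ball 0 r) k (rkhs (ball 0 r) k)"
proof -
  have conv: "converges_on r F" by (rule diag_expansion_converges[OF exp r])
  define s where "s m = complex_of_real (sqrt (fps_nth F m))" for m
  have ss: "s m * s m = complex_of_real (fps_nth F m)" for m
    using less_imp_le[OF pos[of m]] by (simp add: s_def flip: of_real_mult)
  have s: "cnj (s m) = s m" "s m \<noteq> 0" for m
    using pos[of m] by (simp_all add: s_def less_imp_neq[symmetric])
  define e where "e m z = s m * z ^ m" for m z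
  have el2: "(\<lambda>m. e m z) \<in> l2" if z: "z \<in> ball 0 r" for z
  proof -
    have "(cmod z)\<^sup>2 < r\<^sup>2" using z by (simp add: power_strict_mono)
    then have "summable (\<lambda>m. \<bar>fps_nth F m\<bar> * ((cmod z)\<^sup>2) ^ m)"
      using conv unfolding converges_on_def by simp
    moreover have "(cmod (e m z))\<^sup>2 = \<bar>fps_nth F m\<bar> * ((cmod z)\<^sup>2) ^ m" for m
      using less_imp_le[OF pos[of m]]
      by (simp add: e_def s_def norm_mult norm_power power_mult_distrib flip: power_mult) (simp add: mult.commute)
    ultimately show ?thesis by (simp add: l2_def)
  qed
  have "\<exists>H. is_rkhs (ball 0 r) k H"
  proof (rule is_rkhs_feature_map[of "ball 0 r" e, OF el2])
    fix b assume b: "b \<in> l2" and z0: "\<And>z. z \<in> ball 0 r \<Longrightarrow> (\<Sum>m. b m * e m z) = 0"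
    have sums: "(\<lambda>m. (b m * s m) * (z - 0) ^ m) sums 0" if "norm (z - 0) < r" for z
    proof -
      have z: "z \<in> ball 0 r" using that by simp
      have "(\<lambda>m. b m * e m z) sums 0"
        using summable_sums[OF l2_summable_mult[OF b el2[OF z]]] z0[OF z] by simp
      then show ?thesis by (simp add: e_def mult.assoc)
    qed
    have "b m * s m = 0" for m
    proof (rule ccontr)
      assume ne: "b m * s m \<noteq> 0"
      have "(\<lambda>m. (b m * s m) * (0 - 0) ^ m) sums 0" by (rule sums) (use r in simp)
      then have "b 0 * s 0 = 0" by simp
      with ne have "m > 0" by (cases m) auto
      obtain t where t: "0 < t" "\<And>z::complex. z \<in> cball 0 t - {0} \<Longrightarrow> (0::complex) \<noteq> 0"
        by (rule powser_0_nonzero[of r 0 "\<lambda>m. b m * s m" "\<lambda>_. 0" m, OF r sums refl ne \<open>m > 0\<close>]) blast+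
      have "complex_of_real t \<in> cball 0 t - {0}" using t(1) by simp
      from t(2)[OF this] show False by simp
    qed
    then show "b = (\<lambda>m. 0)" using s(2) by auto
  next
    fix z w :: complex assume zw: "z \<in> ball 0 r" "w \<in> ball 0 r"
    have "e m z * cnj (e m w) = complex_of_real (fps_nth F m) * (z * cnj w) ^ m" for m
    proof -
      have "e m z * cnj (e m w) = (s m * s m) * (z * cnj w) ^ m"
        by (simp add: e_def s(1) power_mult_distrib mult_ac)
      then show ?thesis by (simp only: ss)
    qed
    then show "k z w = (\<Sum>m. e m z * cnj (e m w))"
      using exp zw by (simp add: diag_expansion_def sums_iff)
  qed
  then show ?thesis unfolding rkhs_def by (rule someI_ex)
qed

section \<open>Contractive multipliers as positive kernels\<close>

text \<open>A matrix-valued multiplier acts on vector-valued functions.  If these are read as scalar functions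
  of a point and a component index, then the multiplier becomes an operator of the form
  \<open>f \<mapsto> \<Sum>b<N. \<Phi> y b * f (\<pi> y b)\<close>, and the scalar theory applies.\<close>

locale weighted_composition =
  source: rkhs_on X1 k1 H1 + target: rkhs_on X2 k2 H2
  for X1 :: "'x set" and k1 H1 and X2 :: "'y set" and k2 H2 +
  fixes N :: nat and \<Phi> :: "'y \<Rightarrow> nat \<Rightarrow> complex" and \<pi> :: "'y \<Rightarrow> nat \<Rightarrow> 'x"
  assumes \<pi>: "y \<in> X2 \<Longrightarrow> b < N \<Longrightarrow> \<pi> y b \<in> X1"
begin

definition weighted_comp :: "('x \<Rightarrow> complex) \<Rightarrow> 'y \<Rightarrow> complex" where
  "weighted_comp f y = (if y \<in> X2 then \<Sum>b<N. \<Phi> y b * f (\<pi> y b) else 0)"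

text \<open>The image of \<open>target.combo n x a\<close> under the adjoint of the operator.\<close>

definition adj_combo :: "nat \<Rightarrow> (nat \<Rightarrow> 'y) \<Rightarrow> (nat \<Rightarrow> complex) \<Rightarrow> 'x \<Rightarrow> complex" where
  "adj_combo n x a = (\<lambda>u. \<Sum>i<n. \<Sum>b<N. (a i * cnj (\<Phi> (x i) b)) * source.kf (\<pi> (x i) b) u)"

text \<open>The Gram kernel of the images of the kernel functions of the target under the adjoint.\<close>

definition pullback_kernel :: "'y \<Rightarrow> 'y \<Rightarrow> complex" where
  "pullback_kernel y y' = (\<Sum>b<N. \<Sum>b'<N. \<Phi> y b * cnj (\<Phi> y' b') * k1 (\<pi> y b) (\<pi> y' b'))"

lemma adj_combo_mem:
  assumes "\<forall>i<n. x i \<in> X2"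
  shows "adj_combo n x a \<in> source.V"
  unfolding adj_combo_def
  by (intro source.sum_mem source.scale_mem source.kf_mem) (use assms \<pi> in auto)

lemma ip_adj_combo:
  assumes x: "\<forall>i<n. x i \<in> X2" and f: "f \<in> source.V"
  shows "source.ip f (adj_combo n x a) = (\<Sum>i<n. cnj (a i) * weighted_comp f (x i))"
proof -
  have "source.ip f (adj_combo n x a)
      = (\<Sum>i<n. source.ip f (\<lambda>u. \<Sum>b<N. (a i * cnj (\<Phi> (x i) b)) * source.kf (\<pi> (x i) b) u))"
    unfolding adj_combo_def
    by (rule source.ip_sum_right[OF _ f], rule source.sum_mem, rule source.scale_mem, rule source.kf_mem)
      (use x \<pi> in auto)
  also have "\<dots> = (\<Sum>i<n. cnj (a i) * weighted_comp f (x i))"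
  proof (rule sum.cong[OF refl])
    fix i assume i: "i \<in> {..<n}"
    then have xi: "x i \<in> X2" using x by simp
    have "source.ip f (\<lambda>u. \<Sum>b<N. (a i * cnj (\<Phi> (x i) b)) * source.kf (\<pi> (x i) b) u)
        = (\<Sum>b<N. source.ip f (\<lambda>u. (a i * cnj (\<Phi> (x i) b)) * source.kf (\<pi> (x i) b) u))"
      by (rule source.ip_sum_right[OF _ f], rule source.scale_mem, rule source.kf_mem) (use xi \<pi> in auto)
    also have "\<dots> = (\<Sum>b<N. cnj (a i) * (\<Phi> (x i) b * f (\<pi> (x i) b)))"
    proof (rule sum.cong[OF refl])
      fix b assume "b \<in> {..<N}"
      then have m: "\<pi> (x i) b \<in> X1" using xi \<pi> by simp
      show "source.ip f (\<lambda>u. (a i * cnj (\<Phi> (x i) b)) * source.kf (\<pi> (x i) b) u)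
          = cnj (a i) * (\<Phi> (x i) b * f (\<pi> (x i) b))"
        unfolding source.ip_scale_right[OF source.kf_mem[OF m] f] source.reproducing[OF m f] by simp
    qed
    finally show "source.ip f (\<lambda>u. \<Sum>b<N. (a i * cnj (\<Phi> (x i) b)) * source.kf (\<pi> (x i) b) u)
        = cnj (a i) * weighted_comp f (x i)"
      using xi by (simp add: weighted_comp_def sum_distrib_left)
  qed
  finally show ?thesis .
qed

lemma ip_adj_combo_self:
  assumes x: "\<forall>i<n. x i \<in> X2"
  shows "source.ip (adj_combo n x a) (adj_combo n x a)
    = (\<Sum>i<n. \<Sum>j<n. cnj (a i) * a j * pullback_kernel (x i) (x j))"
proof -
  have "source.ip (adj_combo n x a) (adj_combo n x a) = (\<Sum>i<n. cnj (a i) * weighted_comp (adj_combo n x a) (x i))"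
    by (rule ip_adj_combo[OF x adj_combo_mem[OF x]])
  also have "\<dots> = (\<Sum>i<n. cnj (a i) * (\<Sum>j<n. a j * pullback_kernel (x i) (x j)))"
  proof (intro sum.cong[OF refl] arg_cong2[of _ _ _ _ "(*)"] refl)
    fix i assume "i \<in> {..<n}"
    then have xi: "x i \<in> X2" using x by simp
    have "weighted_comp (adj_combo n x a) (x i)
        = (\<Sum>b<N. \<Sum>j<n. \<Sum>b'<N. \<Phi> (x i) b * ((a j * cnj (\<Phi> (x j) b')) * k1 (\<pi> (x i) b) (\<pi> (x j) b')))"
      unfolding weighted_comp_def adj_combo_def using xi \<pi> by (simp add: kernel_fun_def sum_distrib_left)
    also have "\<dots> = (\<Sum>j<n. \<Sum>b<N. \<Sum>b'<N. \<Phi> (x i) b * ((a j * cnj (\<Phi> (x j) b')) * k1 (\<pi> (x i) b) (\<pi> (x j) b')))"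
      by (rule sum.swap)
    also have "\<dots> = (\<Sum>j<n. a j * pullback_kernel (x i) (x j))"
      unfolding pullback_kernel_def sum_distrib_left by (simp add: mult_ac)
    finally show "weighted_comp (adj_combo n x a) (x i) = (\<Sum>j<n. a j * pullback_kernel (x i) (x j))" .
  qed
  finally show ?thesis by (simp add: sum_distrib_left mult.assoc)
qed

text \<open>The quadratic form of \<open>k2 - pullback_kernel\<close> is the loss of squared norm under the adjoint; so the
  positivity of this kernel says that the adjoint is contractive on the span of the kernel functions.\<close>

lemma nsq_difference:
  assumes x: "\<forall>i<n. x i \<in> X2"
  shows "complex_of_real (target.nsq (target.combo n x a) - source.nsq (adj_combo n x a))
    = (\<Sum>i<n. \<Sum>j<n. cnj (a i) * a j * (k2 (x i) (x j) - pullback_kernel (x i) (x j)))"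
proof -
  have "complex_of_real (target.nsq (target.combo n x a) - source.nsq (adj_combo n x a))
     = target.ip (target.combo n x a) (target.combo n x a) - source.ip (adj_combo n x a) (adj_combo n x a)"
    unfolding target.ip_self[OF target.combo_mem[OF x]] source.ip_self[OF adj_combo_mem[OF x]] by simp
  then show ?thesis
    unfolding target.ip_combo_self[OF x] ip_adj_combo_self[OF x]
    by (simp add: right_diff_distrib sum_subtractf)
qed

lemma pos_kernel_imp_contractive:
  assumes pos: "pos_kernel X2 (\<lambda>y y'. k2 y y' - pullback_kernel y y')" and f: "f \<in> source.V"
  shows "weighted_comp f \<in> target.V" "hf_norm H2 (weighted_comp f) \<le> hf_norm H1 f"
proof -
  have bound: "cmod (\<Sum>i<n. cnj (a i) * weighted_comp f (x i)) \<le> hf_norm H1 f * hf_norm H2 (target.combo n x a)"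
    if x: "\<forall>i<n. x i \<in> X2" for n :: nat and x a
  proof -
    have "0 \<le> complex_of_real (target.nsq (target.combo n x a) - source.nsq (adj_combo n x a))"
      unfolding nsq_difference[OF x] by (rule pos_kernelD[OF pos]) (use x in simp)
    then have "source.nsq (adj_combo n x a) \<le> target.nsq (target.combo n x a)"
      by (simp add: less_eq_complex_def)
    then have le: "hf_norm H1 (adj_combo n x a) \<le> hf_norm H2 (target.combo n x a)"
      by (simp add: hf_norm_def source.nsq_def target.nsq_def)
    have "cmod (\<Sum>i<n. cnj (a i) * weighted_comp f (x i)) \<le> hf_norm H1 f * hf_norm H1 (adj_combo n x a)"
      unfolding ip_adj_combo[OF x f, symmetric] by (rule source.cauchy_schwarz[OF f adj_combo_mem[OF x]])
    also have "\<dots> \<le> hf_norm H1 f * hf_norm H2 (target.combo n x a)"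
      by (rule mult_left_mono[OF le source.hf_norm_nonneg[OF f]])
    finally show ?thesis .
  qed
  have off: "\<And>y. y \<notin> X2 \<Longrightarrow> weighted_comp f y = 0" by (simp add: weighted_comp_def)
  show "weighted_comp f \<in> target.V" "hf_norm H2 (weighted_comp f) \<le> hf_norm H1 f"
    by (rule target.bounded_functional_represented[OF off source.hf_norm_nonneg[OF f] bound]; assumption)+
qed

lemma contractive_imp_pos_kernel:
  assumes contr: "\<And>f. f \<in> source.V \<Longrightarrow> weighted_comp f \<in> target.V \<and> hf_norm H2 (weighted_comp f) \<le> hf_norm H1 f"
  shows "pos_kernel X2 (\<lambda>y y'. k2 y y' - pullback_kernel y y')"
proof (rule pos_kernelI)
  fix n :: nat and x a assume "\<And>i. i < n \<Longrightarrow> x i \<in> X2"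
  then have x: "\<forall>i<n. x i \<in> X2" by blast
  define h e where "h = adj_combo n x a" and "e = target.combo n x a"
  have h: "h \<in> source.V" and e: "e \<in> target.V"
    unfolding h_def e_def using adj_combo_mem[OF x] target.combo_mem[OF x] by auto
  have Th: "weighted_comp h \<in> target.V" "hf_norm H2 (weighted_comp h) \<le> hf_norm H1 h" using contr[OF h] by auto
  have "target.ip (weighted_comp h) e = source.ip h (adj_combo n x a)"
    unfolding e_def target.ip_combo_right[OF x Th(1)] by (rule ip_adj_combo[OF x h, symmetric])
  then have "target.ip (weighted_comp h) e = source.ip h h" by (simp only: h_def)
  then have "source.nsq h = Re (target.ip (weighted_comp h) e)" by (simp add: source.nsq_def)
  also have "\<dots> \<le> cmod (target.ip (weighted_comp h) e)" by (rule complex_Re_le_cmod)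
  also have "\<dots> \<le> hf_norm H2 (weighted_comp h) * hf_norm H2 e" by (rule target.cauchy_schwarz[OF Th(1) e])
  also have "\<dots> \<le> hf_norm H1 h * hf_norm H2 e"
    by (rule mult_right_mono[OF Th(2) target.hf_norm_nonneg[OF e]])
  finally have "hf_norm H1 h * hf_norm H1 h \<le> hf_norm H1 h * hf_norm H2 e"
    using source.hf_norm_nsq[OF h] by (simp add: power2_eq_square)
  then have "hf_norm H1 h \<le> hf_norm H2 e"
    using source.hf_norm_nonneg[OF h] target.hf_norm_nonneg[OF e]
    by (cases "hf_norm H1 h = 0") auto
  then have "source.nsq h \<le> target.nsq e"
    unfolding source.hf_norm_nsq[OF h, symmetric] target.hf_norm_nsq[OF e, symmetric]
    by (rule power_mono[OF _ source.hf_norm_nonneg[OF h]])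
  then show "0 \<le> (\<Sum>i<n. \<Sum>j<n. cnj (a i) * a j * (k2 (x i) (x j) - pullback_kernel (x i) (x j)))"
    unfolding nsq_difference[OF x, symmetric] h_def e_def by (simp add: less_eq_complex_def)
qed

end

definition slice :: "('x \<times> nat \<Rightarrow> complex) \<Rightarrow> nat \<Rightarrow> 'x \<Rightarrow> complex" where
  "slice F a = (\<lambda>x. F (x, a))"

text \<open>The space \<open>H \<otimes> \<complex>\<^sup>N\<close> as a space of scalar functions on \<open>X \<times> {..<N}\<close>.\<close>

definition tensor_rkhs :: "nat \<Rightarrow> 'x hilbert_fun \<Rightarrow> ('x \<times> nat) hilbert_fun" where
  "tensor_rkhs N H = ({F. (\<forall>x a. N \<le> a \<longrightarrow> F (x, a) = 0) \<and> (\<forall>a<N. slice F a \<in> fst H)},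
     \<lambda>F G. \<Sum>a<N. snd H (slice F a) (slice G a))"

definition tensor_kernel :: "('x \<Rightarrow> 'x \<Rightarrow> complex) \<Rightarrow> 'x \<times> nat \<Rightarrow> 'x \<times> nat \<Rightarrow> complex" where
  "tensor_kernel k = (\<lambda>(x, a) (y, b). if a = b then k x y else 0)"

context rkhs_on
begin

lemma tensor_mem_iff: "F \<in> fst (tensor_rkhs N H) \<longleftrightarrow>
    (\<forall>x a. N \<le> a \<longrightarrow> F (x, a) = 0) \<and> (\<forall>a<N. slice F a \<in> V)"
  by (simp add: tensor_rkhs_def)

lemma tensor_ip: "snd (tensor_rkhs N H) F G = (\<Sum>a<N. ip (slice F a) (slice G a))"
  by (simp add: tensor_rkhs_def)

lemma tensor_hf_norm:
  assumes "F \<in> fst (tensor_rkhs N H)"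
  shows "hf_norm (tensor_rkhs N H) F = sqrt (\<Sum>a<N. (hf_norm H (slice F a))\<^sup>2)"
proof -
  have "(\<Sum>a<N. (hf_norm H (slice F a))\<^sup>2) = (\<Sum>a<N. nsq (slice F a))"
    by (intro sum.cong refl hf_norm_nsq) (use assms in \<open>auto simp: tensor_mem_iff\<close>)
  then show ?thesis by (simp add: hf_norm_def[of "tensor_rkhs N H"] tensor_ip nsq_def)
qed

lemma slice_simps:
  "slice (\<lambda>p. F p + G p) a = (\<lambda>x. slice F a x + slice G a x)"
  "slice (\<lambda>p. F p - G p) a = (\<lambda>x. slice F a x - slice G a x)"
  "slice (\<lambda>p. c * F p) a = (\<lambda>x. c * slice F a x)"
  "slice (\<lambda>p. 0) a = (\<lambda>x. 0)"
  by (simp_all add: slice_def)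

lemma is_rkhs_tensor: "is_rkhs (X \<times> {..<N}) (tensor_kernel k) (tensor_rkhs N H)"
proof -
  let ?V = "fst (tensor_rkhs N H)" and ?ip = "snd (tensor_rkhs N H)"
  have slice_mem: "slice F a \<in> V" if "F \<in> ?V" "a < N" for F a
    using that by (simp add: tensor_mem_iff)
  have fs: "is_function_space (X \<times> {..<N}) ?V"
    unfolding is_function_space_def
  proof (intro conjI ballI allI impI)
    fix F and p :: "'x \<times> nat" assume F: "F \<in> ?V" and p: "p \<notin> X \<times> {..<N}"
    obtain x a where xa: "p = (x, a)" by fastforce
    show "F p = 0"
    proof (cases "a < N")
      case True
      then have "slice F a x = 0" using p xa by (intro off[OF slice_mem[OF F]]) auto
      then show ?thesis by (simp add: slice_def xa)
    next
      case False
      then show ?thesis using F by (simp add: tensor_mem_iff xa)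
    qed
  qed (auto simp: tensor_mem_iff slice_simps zero_mem intro: add_mem scale_mem)
  have ip: "is_inner_product ?V ?ip"
    unfolding is_inner_product_def
  proof (intro conjI ballI allI impI)
    fix F G K assume m: "F \<in> ?V" "G \<in> ?V" "K \<in> ?V"
    show "?ip (\<lambda>p. F p + G p) K = ?ip F K + ?ip G K"
      unfolding tensor_ip slice_simps sum.distrib[symmetric]
      by (intro sum.cong refl ip_add_left) (use m slice_mem in auto)
  next
    fix c F K assume m: "F \<in> ?V" "K \<in> ?V"
    show "?ip (\<lambda>p. c * F p) K = c * ?ip F K"
      unfolding tensor_ip slice_simps sum_distrib_left
      by (intro sum.cong refl ip_scale_left) (use m slice_mem in auto)
  next
    fix F G assume m: "F \<in> ?V" "G \<in> ?V"
    show "?ip G F = cnj (?ip F G)"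
      unfolding tensor_ip cnj_sum
      by (intro sum.cong refl ip_cnj) (use m slice_mem in auto)
  next
    fix F assume m: "F \<in> ?V"
    show "0 \<le> ?ip F F"
      unfolding tensor_ip by (intro sum_nonneg ip_nonneg) (use m slice_mem in auto)
  next
    fix F assume m: "F \<in> ?V" and z: "?ip F F = 0"
    have "(\<Sum>a<N. nsq (slice F a)) = Re (?ip F F)" by (simp add: tensor_ip nsq_def)
    then have "(\<Sum>a<N. nsq (slice F a)) = 0" using z by simp
    then have "nsq (slice F a) = 0" if "a < N" for a
      using that m by (subst (asm) sum_nonneg_eq_0_iff) (auto intro: nsq_nonneg slice_mem)
    then have "slice F a = (\<lambda>x. 0)" if "a < N" for a
      using that by (intro ip_definite slice_mem[OF m]) (simp_all add: ip_self slice_mem[OF m])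
    then have "F (x, a) = 0" for x a
      using m by (cases "a < N") (auto simp: tensor_mem_iff slice_def dest: fun_cong)
    then show "F = (\<lambda>p. 0)" by auto
  qed
  have complete: "is_norm_complete (tensor_rkhs N H)"
    unfolding is_norm_complete_def
  proof (intro allI impI, elim conjE)
    fix F assume F: "\<forall>n::nat. F n \<in> ?V"
      and cauchy: "\<forall>e>0. \<exists>M. \<forall>m\<ge>M. \<forall>n\<ge>M. hf_norm (tensor_rkhs N H) (\<lambda>p. F m p - F n p) < e"
    have FV: "slice (F n) a \<in> V" if "a < N" for n a using F that slice_mem by blast
    have diffV: "(\<lambda>p. G p - G' p) \<in> ?V" if "G \<in> ?V" "G' \<in> ?V" for G G'
      using that by (auto simp: tensor_mem_iff slice_simps intro: diff_mem)
    have slice_le: "hf_norm H (slice G a) \<le> hf_norm (tensor_rkhs N H) G" if "G \<in> ?V" "a < N" for G a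
    proof -
      have "(hf_norm H (slice G a))\<^sup>2 \<le> (\<Sum>a<N. (hf_norm H (slice G a))\<^sup>2)"
        by (rule member_le_sum) (use that in auto)
      then have "sqrt ((hf_norm H (slice G a))\<^sup>2) \<le> hf_norm (tensor_rkhs N H) G"
        unfolding tensor_hf_norm[OF that(1)] by (rule real_sqrt_le_mono)
      then show ?thesis using hf_norm_nonneg[OF slice_mem[OF that]] by simp
    qed
    have "\<exists>f\<in>V. (\<lambda>n. hf_norm H (\<lambda>x. slice (F n) a x - f x)) \<longlonglongrightarrow> 0" if a: "a < N" for a
    proof (rule complete[OF FV[OF a]])
      fix e :: real assume "0 < e"
      then obtain M where M: "\<forall>m\<ge>M. \<forall>n\<ge>M. hf_norm (tensor_rkhs N H) (\<lambda>p. F m p - F n p) < e"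
        using cauchy by blast
      have "hf_norm H (\<lambda>x. slice (F m) a x - slice (F n) a x) < e" if "m \<ge> M" "n \<ge> M" for m n
        using slice_le[OF diffV[of "F m" "F n"] a] F M that unfolding slice_simps by fastforce
      then show "\<exists>M. \<forall>m\<ge>M. \<forall>n\<ge>M. hf_norm H (\<lambda>x. slice (F m) a x - slice (F n) a x) < e" by blast
    qed
    then have "\<forall>a. \<exists>f. a < N \<longrightarrow> f \<in> V \<and> (\<lambda>n. hf_norm H (\<lambda>x. slice (F n) a x - f x)) \<longlonglongrightarrow> 0"
      by blast
    from choice[OF this] obtain f where
      "\<forall>a. a < N \<longrightarrow> f a \<in> V \<and> (\<lambda>n. hf_norm H (\<lambda>x. slice (F n) a x - f a x)) \<longlonglongrightarrow> 0" ..
    then have f: "\<And>a. a < N \<Longrightarrow> f a \<in> V"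
      "\<And>a. a < N \<Longrightarrow> (\<lambda>n. hf_norm H (\<lambda>x. slice (F n) a x - f a x)) \<longlonglongrightarrow> 0"
      by simp_all
    define G where "G = (\<lambda>(x, a). if a < N then f a x else 0)"
    have sG: "slice G a = f a" if "a < N" for a using that by (simp add: slice_def G_def)
    have G: "G \<in> ?V"
      using f(1) by (auto simp: tensor_mem_iff sG) (simp add: G_def)
    have "(\<lambda>n. sqrt (\<Sum>a<N. (hf_norm H (\<lambda>x. slice (F n) a x - f a x))\<^sup>2)) \<longlonglongrightarrow> sqrt (\<Sum>a<N. 0\<^sup>2)"
      by (intro tendsto_real_sqrt tendsto_sum tendsto_power f(2)) auto
    moreover have eq: "(\<lambda>n. hf_norm (tensor_rkhs N H) (\<lambda>p. F n p - G p))
        = (\<lambda>n. sqrt (\<Sum>a<N. (hf_norm H (\<lambda>x. slice (F n) a x - f a x))\<^sup>2))"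
      unfolding tensor_hf_norm[OF diffV[OF F[rule_format] G]] slice_simps by (simp add: sG)
    ultimately have "(\<lambda>n. hf_norm (tensor_rkhs N H) (\<lambda>p. F n p - G p)) \<longlonglongrightarrow> 0"
      unfolding eq by simp
    then show "\<exists>G\<in>?V. (\<lambda>n. hf_norm (tensor_rkhs N H) (\<lambda>p. F n p - G p)) \<longlonglongrightarrow> 0"
      using G by (rule bexI)
  qed
  have slice_kf: "slice (kernel_fun (X \<times> {..<N}) (tensor_kernel k) (w, b)) a = (if a = b then kf w else (\<lambda>x. 0))"
    if "w \<in> X" "b < N" for w a b
    using that by (auto simp: slice_def kernel_fun_def tensor_kernel_def)
  have kf: "kernel_fun (X \<times> {..<N}) (tensor_kernel k) p \<in> ?V" if p: "p \<in> X \<times> {..<N}" for p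
  proof -
    obtain w b where "p = (w, b)" "w \<in> X" "b < N" using p by auto
    then show ?thesis
      by (auto simp: tensor_mem_iff slice_kf kf_mem zero_mem) (simp add: kernel_fun_def)
  qed
  have rep: "F p = ?ip F (kernel_fun (X \<times> {..<N}) (tensor_kernel k) p)" if p: "p \<in> X \<times> {..<N}" and F: "F \<in> ?V" for p F
  proof -
    obtain w b where wb: "p = (w, b)" "w \<in> X" "b < N" using p by auto
    have "?ip F (kernel_fun (X \<times> {..<N}) (tensor_kernel k) p) = (\<Sum>a<N. if a = b then ip (slice F b) (kf w) else 0)"
      unfolding tensor_ip wb(1) slice_kf[OF wb(2,3)]
      by (intro sum.cong refl) (use F slice_mem in \<open>auto simp: ip_zero_right\<close>)
    also have "\<dots> = slice F b w"
      using wb reproducing[OF wb(2) slice_mem[OF F wb(3)]] by simp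
    finally show ?thesis by (simp add: slice_def wb(1))
  qed
  show ?thesis
    unfolding is_rkhs_def using fs ip complete kf rep by simp
qed

end

text \<open>The matrix-valued kernel \<open>l I - k \<Phi> \<Phi>\<^sup>*\<close>, as a scalar kernel of pairs of a point and a row index.\<close>

definition multiplier_kernel ::
  "nat \<Rightarrow> ('x \<Rightarrow> 'x \<Rightarrow> complex) \<Rightarrow> ('x \<Rightarrow> 'x \<Rightarrow> complex) \<Rightarrow> ('x \<Rightarrow> complex mat) \<Rightarrow> 'x \<times> nat \<Rightarrow> 'x \<times> nat \<Rightarrow> complex" where
  "multiplier_kernel N k l \<Phi> = (\<lambda>(x, a) (y, b). (if a = b then l x y else 0)
     - k x y * herm N (\<lambda>c. \<Phi> x $$ (a, c)) (\<lambda>c. \<Phi> y $$ (b, c)))"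

definition components :: "nat \<Rightarrow> ('x \<Rightarrow> complex Matrix.vec) \<Rightarrow> 'x \<times> nat \<Rightarrow> complex" where
  "components N f = (\<lambda>(x, a). if a < N then vec_index (f x) a else 0)"

lemma components_mem:
  assumes "is_rkhs X k H" and "f \<in> tensor_space N H"
  shows "components N f \<in> fst (tensor_rkhs N H)"
    and "hf_norm (tensor_rkhs N H) (components N f) = tensor_norm N H f"
proof -
  interpret rkhs_on X k H by standard (rule assms)
  have s: "slice (components N f) a = (\<lambda>x. vec_index (f x) a)" if "a < N" for a
    using that by (simp add: slice_def components_def)
  show m: "components N f \<in> fst (tensor_rkhs N H)"
    using assms(2) by (auto simp: tensor_mem_iff s tensor_space_def) (simp add: components_def)
  show "hf_norm (tensor_rkhs N H) (components N f) = tensor_norm N H f"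
    unfolding tensor_hf_norm[OF m] tensor_norm_def by (simp add: s)
qed

lemma components_surj:
  assumes "F \<in> fst (tensor_rkhs N H)"
  shows "\<exists>f\<in>tensor_space N H. components N f = F"
proof -
  define f where "f x = Matrix.vec N (\<lambda>a. F (x, a))" for x
  have "(\<lambda>x. vec_index (f x) a) = slice F a" if "a < N" for a
    using that by (simp add: f_def slice_def)
  then have "f \<in> tensor_space N H"
    using assms by (simp add: tensor_space_def tensor_rkhs_def) (simp add: f_def)
  moreover have "components N f = F"
    using assms by (auto simp: components_def f_def tensor_rkhs_def)
  ultimately show ?thesis by blast
qed

lemma tensor_space_components:
  assumes "\<And>x. g x \<in> carrier_vec N" "components N g \<in> fst (tensor_rkhs N H)"
  shows "g \<in> tensor_space N H"
proof -
  have "slice (components N g) a = (\<lambda>x. vec_index (g x) a)" if "a < N" for a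
    using that by (simp add: slice_def components_def)
  then show ?thesis using assms by (simp add: tensor_space_def tensor_rkhs_def)
qed

text \<open>Contractivity of the multiplication operator and of its adjoint are equivalent, and on kernel
  functions the adjoint is given by the matrices \<open>\<Phi>\<^sup>*\<close>.\<close>

lemma contractive_multiplier_iff:
  fixes X :: "'x set"
  assumes rk: "is_rkhs X k (rkhs X k)" and rl: "is_rkhs X l (rkhs X l)"
    and \<Phi>: "\<And>x. x \<in> X \<Longrightarrow> \<Phi> x \<in> carrier_mat N N"
  shows "\<Phi> \<in> Mult X N k l \<and> mult_norm X N k l \<Phi> \<le> 1
    \<longleftrightarrow> pos_kernel (X \<times> {..<N}) (multiplier_kernel N k l \<Phi>)"
proof -
  let ?H1 = "tensor_rkhs N (rkhs X k)" and ?H2 = "tensor_rkhs N (rkhs X l)"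
  define M where "M = (\<lambda>(x, a) c. \<Phi> x $$ (a, c))"
  interpret weighted_composition "X \<times> {..<N}" "tensor_kernel k" ?H1 "X \<times> {..<N}" "tensor_kernel l" ?H2 N M "\<lambda>p b. (fst p, b)"
  proof
    show "is_rkhs (X \<times> {..<N}) (tensor_kernel k) ?H1"
      by (rule rkhs_on.is_rkhs_tensor) (unfold_locales, rule rk)
    show "is_rkhs (X \<times> {..<N}) (tensor_kernel l) ?H2"
      by (rule rkhs_on.is_rkhs_tensor) (unfold_locales, rule rl)
  qed auto
  have kernel: "tensor_kernel l p p' - pullback_kernel p p' = multiplier_kernel N k l \<Phi> p p'"
    if "p \<in> X \<times> {..<N}" "p' \<in> X \<times> {..<N}" for p p'
  proof -
    obtain x a y b where p: "p = (x, a)" "p' = (y, b)" by fastforce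
    have "(\<Sum>c'<N. \<Phi> x $$ (a, c) * cnj (\<Phi> y $$ (b, c')) * (if c = c' then k x y else 0))
        = \<Phi> x $$ (a, c) * cnj (\<Phi> y $$ (b, c)) * k x y" if "c < N" for c
    proof -
      have "(\<Sum>c'<N. \<Phi> x $$ (a, c) * cnj (\<Phi> y $$ (b, c')) * (if c = c' then k x y else 0))
        = (\<Sum>c'<N. if c = c' then \<Phi> x $$ (a, c) * cnj (\<Phi> y $$ (b, c)) * k x y else 0)"
        by (intro sum.cong refl) auto
      then show ?thesis using that by simp
    qed
    then show ?thesis
      unfolding pullback_kernel_def
      by (simp add: p multiplier_kernel_def tensor_kernel_def M_def herm_def sum_distrib_left mult_ac)
  qed
  have pos_iff: "pos_kernel (X \<times> {..<N}) (multiplier_kernel N k l \<Phi>)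
      \<longleftrightarrow> pos_kernel (X \<times> {..<N}) (\<lambda>p p'. tensor_kernel l p p' - pullback_kernel p p')"
    using kernel by (auto intro: pos_kernel_cong)
  have comp: "components N (mult_op X N \<Phi> f) = weighted_comp (components N f)" if f: "f \<in> tensor_space N (rkhs X k)" for f
  proof
    fix p :: "'x \<times> nat"
    obtain x a where p: "p = (x, a)" by fastforce
    have fx: "f x \<in> carrier_vec N" using f by (simp add: tensor_space_def)
    show "components N (mult_op X N \<Phi> f) p = weighted_comp (components N f) p"
    proof (cases "x \<in> X \<and> a < N")
      case True
      then have "vec_index (\<Phi> x *\<^sub>v f x) a = (\<Sum>c<N. \<Phi> x $$ (a, c) * vec_index (f x) c)"
        using \<Phi>[of x] fx by (simp add: scalar_prod_def lessThan_atLeast0 Matrix.row_def)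
      then show ?thesis using True unfolding weighted_comp_def by (simp add: components_def mult_op_def M_def p)
    next
      case False
      then show ?thesis unfolding weighted_comp_def by (auto simp: components_def mult_op_def p)
    qed
  qed
  have carrier: "mult_op X N \<Phi> f x \<in> carrier_vec N" if f: "f \<in> tensor_space N (rkhs X k)" for f x
    using \<Phi>[of x] f by (auto simp: mult_op_def tensor_space_def)
  note c1 = components_mem[OF rk] and c2 = components_mem[OF rl]
  show ?thesis
  proof
    assume pos: "pos_kernel (X \<times> {..<N}) (multiplier_kernel N k l \<Phi>)"
    note contr = pos_kernel_imp_contractive[OF pos[unfolded pos_iff]]
    have mem: "mult_op X N \<Phi> f \<in> tensor_space N (rkhs X l)" if f: "f \<in> tensor_space N (rkhs X k)" for f
      by (rule tensor_space_components[OF carrier[OF f]]) (simp add: comp[OF f] contr(1)[OF c1(1)[OF f]])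
    have le: "tensor_norm N (rkhs X l) (mult_op X N \<Phi> f) \<le> tensor_norm N (rkhs X k) f"
      if f: "f \<in> tensor_space N (rkhs X k)" for f
      unfolding c2(2)[OF mem[OF f], symmetric] c1(2)[OF f, symmetric] comp[OF f] by (rule contr(2)[OF c1(1)[OF f]])
    have "mult_norm X N k l \<Phi> \<le> 1"
      unfolding mult_norm_def
    proof (rule SUP_least)
      fix f assume "f \<in> {f \<in> tensor_space N (rkhs X k). tensor_norm N (rkhs X k) f \<le> 1}"
      then have "tensor_norm N (rkhs X l) (mult_op X N \<Phi> f) \<le> 1" using le[of f] by simp
      then show "ennreal (tensor_norm N (rkhs X l) (mult_op X N \<Phi> f)) \<le> 1" by simp
    qed
    then show "\<Phi> \<in> Mult X N k l \<and> mult_norm X N k l \<Phi> \<le> 1"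
      using mem \<Phi> by (simp add: Mult_def)
  next
    assume a: "\<Phi> \<in> Mult X N k l \<and> mult_norm X N k l \<Phi> \<le> 1"
    then have mem: "mult_op X N \<Phi> f \<in> tensor_space N (rkhs X l)" if "f \<in> tensor_space N (rkhs X k)" for f
      using that by (simp add: Mult_def)
    have unit: "weighted_comp F \<in> target.V \<and> (hf_norm ?H1 F \<le> 1 \<longrightarrow> hf_norm ?H2 (weighted_comp F) \<le> 1)" if F: "F \<in> source.V" for F
    proof -
      obtain f where f: "f \<in> tensor_space N (rkhs X k)" "components N f = F"
        using components_surj[OF F] by blast
      have "ennreal (tensor_norm N (rkhs X l) (mult_op X N \<Phi> f)) \<le> 1" if "tensor_norm N (rkhs X k) f \<le> 1"
      proof -
        have "ennreal (tensor_norm N (rkhs X l) (mult_op X N \<Phi> f)) \<le> mult_norm X N k l \<Phi>"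
          unfolding mult_norm_def by (rule SUP_upper) (use f that in simp)
        then show ?thesis using a order_trans by blast
      qed
      then show ?thesis
        using c2[OF mem[OF f(1)]] c1[OF f(1)] unfolding comp[OF f(1)] f(2) by simp
    qed
    have "pos_kernel (X \<times> {..<N}) (\<lambda>p p'. tensor_kernel l p p' - pullback_kernel p p')"
    proof (rule contractive_imp_pos_kernel, rule conjI)
      fix F assume F: "F \<in> source.V"
      show TF: "weighted_comp F \<in> target.V" using unit[OF F] ..
      show "hf_norm ?H2 (weighted_comp F) \<le> hf_norm ?H1 F"
      \<comment> \<open>The operator norm only involves functions of norm at most 1, to which \<open>F\<close> is scaled; the summand \<open>e\<close>
          covers the case \<open>F = 0\<close>.\<close>
      proof (rule field_le_epsilon)
        fix e :: real assume e: "0 < e"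
        define c where "c = 1 / (hf_norm ?H1 F + e)"
        have c: "0 < c" using e source.hf_norm_nonneg[OF F] by (simp add: c_def)
        define G where "G = (\<lambda>p. complex_of_real c * F p)"
        have G: "G \<in> source.V" unfolding G_def by (rule source.scale_mem[OF F])
        have "hf_norm ?H1 G = c * hf_norm ?H1 F"
          using source.nsq_scale[OF F, of "complex_of_real c"] c
          by (simp add: G_def hf_norm_def source.nsq_def real_sqrt_mult)
        also have "\<dots> \<le> 1" using e source.hf_norm_nonneg[OF F] by (simp add: c_def)
        finally have "hf_norm ?H2 (weighted_comp G) \<le> 1" using unit[OF G] by blast
        moreover have "weighted_comp G = (\<lambda>p. complex_of_real c * weighted_comp F p)"
          unfolding weighted_comp_def by (auto simp: G_def sum_distrib_left mult_ac)
        moreover have "hf_norm ?H2 (\<lambda>p. complex_of_real c * weighted_comp F p) = c * hf_norm ?H2 (weighted_comp F)"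
          using target.nsq_scale[OF TF, of "complex_of_real c"] c
          by (simp add: hf_norm_def target.nsq_def real_sqrt_mult)
        ultimately have "c * hf_norm ?H2 (weighted_comp F) \<le> 1" by simp
        then show "hf_norm ?H2 (weighted_comp F) \<le> hf_norm ?H1 F + e"
          using e source.hf_norm_nonneg[OF F] by (simp add: c_def field_simps)
      qed
    qed
    then show "pos_kernel (X \<times> {..<N}) (multiplier_kernel N k l \<Phi>)" by (simp only: pos_iff)
  qed
qed

section \<open>Finite Pick data as positive kernels\<close>

text \<open>Coefficients of a test vector that belong to equal indices are added up.\<close>

lemma psd_mat_iff_pos_kernel:
  assumes A: "A \<in> carrier_mat n n"
  shows "psd_mat n A \<longleftrightarrow> pos_kernel {..<n} (\<lambda>i j. A $$ (i, j))"
proof -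
  have form: "(A *\<^sub>v v) \<bullet>c v = (\<Sum>i<n. \<Sum>j<n. cnj (vec_index v i) * vec_index v j * A $$ (i, j))"
    if "v \<in> carrier_vec n" for v
    using that A by (simp add: scalar_prod_def lessThan_atLeast0 sum_distrib_left sum_distrib_right mult_ac)
  show ?thesis
  proof
    assume psd: "psd_mat n A"
    show "pos_kernel {..<n} (\<lambda>i j. A $$ (i, j))"
    proof (rule pos_kernelI)
      fix m :: nat and y and c :: "nat \<Rightarrow> complex" assume y: "\<And>i. i < m \<Longrightarrow> y i \<in> {..<n}"
      define v where "v = Matrix.vec n (\<lambda>i. \<Sum>s<m. if y s = i then c s else 0)"
      have v: "v \<in> carrier_vec n" by (simp add: v_def)
      have collect: "(\<Sum>s<m. c s * f (y s)) = (\<Sum>i<n. vec_index v i * f i)" for f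
      proof -
        have "(\<Sum>i<n. vec_index v i * f i) = (\<Sum>s<m. \<Sum>i<n. (if y s = i then c s * f i else 0))"
          by (subst sum.swap) (auto simp: v_def sum_distrib_right intro!: sum.cong)
        also have "\<dots> = (\<Sum>s<m. c s * f (y s))"
          by (intro sum.cong refl) (use y in \<open>simp add: sum.delta\<close>)
        finally show ?thesis ..
      qed
      have collect_cnj: "(\<Sum>s<m. cnj (c s) * f (y s)) = (\<Sum>i<n. cnj (vec_index v i) * f i)" for f
        using arg_cong[OF collect[of "\<lambda>i. cnj (f i)"], of cnj] by (simp add: cnj_sum)
      have "(\<Sum>s<m. \<Sum>t<m. cnj (c s) * c t * A $$ (y s, y t)) = (\<Sum>s<m. cnj (c s) * (\<Sum>t<m. c t * A $$ (y s, y t)))"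
        by (simp add: sum_distrib_left mult.assoc)
      also have "\<dots> = (\<Sum>s<m. cnj (c s) * (\<Sum>j<n. vec_index v j * A $$ (y s, j)))"
        unfolding collect[of "\<lambda>j. A $$ (y _, j)"] ..
      also have "\<dots> = (\<Sum>i<n. cnj (vec_index v i) * (\<Sum>j<n. vec_index v j * A $$ (i, j)))"
        by (rule collect_cnj)
      also have "\<dots> = (A *\<^sub>v v) \<bullet>c v"
        unfolding form[OF v] by (simp add: sum_distrib_left mult.assoc)
      finally show "0 \<le> (\<Sum>s<m. \<Sum>t<m. cnj (c s) * c t * A $$ (y s, y t))"
        using psd unfolding psd_mat_def by (simp add: v_def)
    qed
  next
    assume pos: "pos_kernel {..<n} (\<lambda>i j. A $$ (i, j))"
    have "0 \<le> (A *\<^sub>v v) \<bullet>c v" if v: "v \<in> carrier_vec n" for v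
      unfolding form[OF v] by (rule pos_kernelD[OF pos, where z = "\<lambda>i. i"]) simp
    then show "psd_mat n A" using A by (simp add: psd_mat_def)
  qed
qed

lemma is_kernel_of_pos_kernel:
  assumes "X \<noteq> {}" "pos_kernel X k"
  shows "is_kernel X k"
  unfolding is_kernel_def
proof (intro conjI allI impI)
  fix n and z :: "nat \<Rightarrow> 'a" assume z: "\<forall>i<n. z i \<in> X"
  have "pos_kernel {..<n} (\<lambda>i j. k (z i) (z j))"
    by (rule pos_kernel_comp[OF assms(2)]) (use z in auto)
  then have "pos_kernel {..<n} (\<lambda>i j. Matrix.mat n n (\<lambda>(i, j). k (z i) (z j)) $$ (i, j))"
    by (rule pos_kernel_cong) auto
  then show "psd_mat n (Matrix.mat n n (\<lambda>(i, j). k (z i) (z j)))"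
    by (subst psd_mat_iff_pos_kernel) auto
qed (rule assms(1))

lemma mat_adjoint_product_index:
  assumes "A \<in> carrier_mat N N" "B \<in> carrier_mat N N" "a < N" "b < N"
  shows "(A * mat_adjoint B) $$ (a, b) = herm N (\<lambda>c. A $$ (a, c)) (\<lambda>c. B $$ (b, c))"
proof -
  have "mat_adjoint B \<in> carrier_mat N N" using assms(2) by (auto simp: mat_adjoint_def)
  moreover have "mat_adjoint B $$ (c, b) = cnj (B $$ (b, c))" if "c < N" for c
    using assms that by (simp add: mat_adjoint_def mat_of_rows_index)
  ultimately show ?thesis
    using assms by (simp add: scalar_prod_def herm_def lessThan_atLeast0)
qed

lemma block_psd_iff_pos_kernel:
  assumes W: "\<And>i. i < n \<Longrightarrow> W i \<in> carrier_mat N N"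
  shows "psd_mat (n * N) (block_matrix n N (\<lambda>i j.
          l (z i) (z j) \<cdot>\<^sub>m 1\<^sub>m N - k (z i) (z j) \<cdot>\<^sub>m (W i * mat_adjoint (W j))))
    \<longleftrightarrow> pos_kernel {..<n * N} (\<lambda>b b'. (if b mod N = b' mod N then l (z (b div N)) (z (b' div N)) else 0)
       - k (z (b div N)) (z (b' div N)) * herm N (\<lambda>c. W (b div N) $$ (b mod N, c)) (\<lambda>c. W (b' div N) $$ (b' mod N, c)))"
    (is "psd_mat _ ?A \<longleftrightarrow> pos_kernel _ ?E")
proof -
  have eq: "?A $$ (b, b') = ?E b b'" if b: "b \<in> {..<n * N}" and b': "b' \<in> {..<n * N}" for b b'
  proof -
    have N: "0 < N" using b by (cases N) auto
    have d: "b div N < n" "b' div N < n" using b b' by (auto intro: less_mult_imp_div_less)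
    have m: "b mod N < N" "b' mod N < N" using N by auto
    have adj: "mat_adjoint (W (b' div N)) \<in> carrier_mat N N"
      using W[OF d(2)] by (auto simp: mat_adjoint_def)
    define P where "P = W (b div N) * mat_adjoint (W (b' div N))"
    have P: "P \<in> carrier_mat N N" unfolding P_def by (rule mult_carrier_mat[OF W[OF d(1)] adj])
    have entry: "(c \<cdot>\<^sub>m 1\<^sub>m N - c' \<cdot>\<^sub>m P) $$ (b mod N, b' mod N)
        = (if b mod N = b' mod N then c else 0) - c' * P $$ (b mod N, b' mod N)" for c c'
      using m P by simp
    have "?A $$ (b, b') = (if b mod N = b' mod N then l (z (b div N)) (z (b' div N)) else 0)
        - k (z (b div N)) (z (b' div N)) * P $$ (b mod N, b' mod N)"
    proof -
      have "?A $$ (b, b') = (l (z (b div N)) (z (b' div N)) \<cdot>\<^sub>m 1\<^sub>m N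
          - k (z (b div N)) (z (b' div N)) \<cdot>\<^sub>m P) $$ (b mod N, b' mod N)"
        using b b' by (simp add: block_matrix_def P_def)
      then show ?thesis unfolding entry .
    qed
    then show ?thesis
      unfolding P_def mat_adjoint_product_index[OF W[OF d(1)] W[OF d(2)] m] .
  qed
  have "psd_mat (n * N) ?A \<longleftrightarrow> pos_kernel {..<n * N} (\<lambda>b b'. ?A $$ (b, b'))"
    by (rule psd_mat_iff_pos_kernel) (simp add: block_matrix_def)
  also have "\<dots> \<longleftrightarrow> pos_kernel {..<n * N} ?E"
    using eq by (auto elim: pos_kernel_cong)
  finally show ?thesis .
qed

text \<open>If only the first rows \<open>f z\<close> of the matrices differ from zero, then the kernel is the direct sum of
  \<open>l - k f f\<^sup>*\<close> and of \<open>N - 1\<close> copies of \<open>l\<close>.\<close>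

lemma row_data_pos_kernel:
  assumes l: "pos_kernel X l" and lk: "pos_kernel X (\<lambda>z w. l z w - k z w * herm N (f z) (f w))"
  shows "pos_kernel (X \<times> {..<N}) (\<lambda>(z, a) (w, b). (if a = b then l z w else 0)
     - k z w * herm N (\<lambda>c. if a = 0 then f z c else 0) (\<lambda>c. if b = 0 then f w c else 0))"
proof -
  have l': "pos_kernel (X \<times> {..<N}) (\<lambda>p p'. l (fst p) (fst p'))"
    and lk': "pos_kernel (X \<times> {..<N}) (\<lambda>p p'. l (fst p) (fst p') - k (fst p) (fst p') * herm N (f (fst p)) (f (fst p')))"
    by (rule pos_kernel_comp[OF l], simp add: mem_Times_iff) (rule pos_kernel_comp[OF lk], simp add: mem_Times_iff)
  define ind :: "nat \<Rightarrow> 'a \<times> nat \<Rightarrow> complex" where "ind a p = (if snd p = a then 1 else 0)" for a p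
  have "pos_kernel (X \<times> {..<N}) (\<lambda>p p'. (\<Sum>a\<in>{1..<N}. ind a p * cnj (ind a p') * l (fst p) (fst p'))
      + ind 0 p * cnj (ind 0 p') * (l (fst p) (fst p') - k (fst p) (fst p') * herm N (f (fst p)) (f (fst p'))))"
    by (intro pos_kernel_add pos_kernel_sum pos_kernel_conj l' lk')
  then show ?thesis
  proof (rule pos_kernel_cong)
    fix p p' assume pp: "p \<in> X \<times> {..<N}" "p' \<in> X \<times> {..<N}"
    obtain z a w b where p: "p = (z, a)" "p' = (w, b)" by fastforce
    have "(\<Sum>c\<in>{1..<N}. ind c p * cnj (ind c p') * l z w)
       = (\<Sum>c\<in>{1..<N}. if c = a then (if a = b then l z w else 0) else 0)"
      by (intro sum.cong refl) (auto simp: ind_def p)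
    also have "\<dots> = (if a = b \<and> a \<noteq> 0 then l z w else 0)" using pp p by auto
    finally have "(\<Sum>c\<in>{1..<N}. ind c p * cnj (ind c p') * l z w) = (if a = b \<and> a \<noteq> 0 then l z w else 0)" .
    then show "(\<Sum>a\<in>{1..<N}. ind a p * cnj (ind a p') * l (fst p) (fst p'))
      + ind 0 p * cnj (ind 0 p') * (l (fst p) (fst p') - k (fst p) (fst p') * herm N (f (fst p)) (f (fst p')))
      = (case p of (z, a) \<Rightarrow> \<lambda>(w, b). (if a = b then l z w else 0)
     - k z w * herm N (\<lambda>c. if a = 0 then f z c else 0) (\<lambda>c. if b = 0 then f w c else 0)) p'"
      by (simp add: p ind_def) (simp add: herm_def)
  qed
qed

section \<open>Sampling on a small circle\<close>

definition unity_root :: "nat \<Rightarrow> complex" where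
  "unity_root M = exp (2 * of_real pi * \<i> / of_nat M)"

lemma unity_root_power_eq_1_iff:
  assumes "1 \<le> M"
  shows "unity_root M ^ j = 1 \<longleftrightarrow> M dvd j"
proof -
  have "unity_root M ^ j = exp (2 * of_real pi * \<i> * of_nat j / of_nat M)"
    unfolding unity_root_def exp_of_nat_mult[symmetric] by (simp add: mult_ac)
  then show ?thesis using complex_root_unity_eq_1[OF assms, of j] by simp
qed

lemma norm_root_of_unity:
  assumes "1 \<le> M" "u ^ M = 1"
  shows "cmod u = 1"
proof (rule power_eq_imp_eq_base)
  show "cmod u ^ M = 1 ^ M" using assms(2) by (simp flip: norm_power)
qed (use assms(1) in auto)

lemma unity_root_power_M: "1 \<le> M \<Longrightarrow> (unity_root M ^ i) ^ M = 1"
  by (metis dvd_triv_right power_mult unity_root_power_eq_1_iff)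

lemma sum_unity_root_orthogonal:
  assumes M: "1 \<le> M" and ma: "m < M" "a < M"
  shows "(\<Sum>i<M. (unity_root M ^ i) ^ m * cnj ((unity_root M ^ i) ^ a)) = (if m = a then of_nat M else 0)"
proof -
  let ?u = "unity_root M"
  have uM: "?u ^ M = 1" using unity_root_power_eq_1_iff[OF M, of M] by simp
  have u: "?u * cnj ?u = 1" using norm_root_of_unity[OF M uM] by (simp flip: complex_norm_square)
  have "?u ^ (M - a) = ?u ^ (M - a) * (?u * cnj ?u) ^ a" by (simp add: u)
  also have "\<dots> = (?u ^ (M - a) * ?u ^ a) * cnj ?u ^ a" by (simp add: power_mult_distrib)
  also have "\<dots> = cnj ?u ^ a" using ma uM by (simp flip: power_add)
  finally have cnj_u: "cnj ?u ^ a = ?u ^ (M - a)" ..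
  have term_eq: "(?u ^ i) ^ m * cnj ((?u ^ i) ^ a) = (?u ^ (m + (M - a))) ^ i" for i
  proof -
    have "(?u ^ i) ^ m * cnj ((?u ^ i) ^ a) = (?u ^ m) ^ i * (cnj ?u ^ a) ^ i"
      by (simp add: mult.commute flip: power_mult)
    then show ?thesis unfolding cnj_u by (simp add: power_add power_mult_distrib)
  qed
  show ?thesis
  proof (cases "m = a")
    case True
    then have "?u ^ (m + (M - a)) = 1" using ma uM by simp
    then show ?thesis unfolding term_eq using True by simp
  next
    case False
    have "\<not> M dvd m + (M - a)"
    proof
      assume "M dvd m + (M - a)"
      then obtain c where c: "m + (M - a) = M * c" by (auto simp: dvd_def)
      have "0 < m + (M - a)" "m + (M - a) < M * 2" using ma by auto
      then have "c = 1" unfolding c using M by auto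
      then show False using c ma False by simp
    qed
    then have ne: "?u ^ (m + (M - a)) \<noteq> 1" using unity_root_power_eq_1_iff[OF M] by simp
    have "(?u ^ (m + (M - a))) ^ M = 1" using unity_root_power_M[OF M] by simp
    then show ?thesis unfolding term_eq using geometric_sum[OF ne, of M] False by simp
  qed
qed

text \<open>Each monomial is a rank one kernel, so the quadratic form of a diagonal kernel is a series with the
  given coefficients and with non-negative weights.\<close>

lemma diag_quadratic_form_sums:
  fixes n :: nat
  assumes F: "converges_on r F" "0 < r" and z: "\<And>i. i < n \<Longrightarrow> z i \<in> ball 0 r"
  shows "(\<lambda>m. complex_of_real (fps_nth F m * (cmod (\<Sum>i<n. cnj (v i) * z i ^ m))\<^sup>2)) sums
    (\<Sum>i<n. \<Sum>j<n. cnj (v i) * v j * diag_eval F (z i * cnj (z j)))"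
proof -
  have "(\<lambda>m. \<Sum>i<n. \<Sum>j<n. cnj (v i) * v j * (complex_of_real (fps_nth F m) * (z i * cnj (z j)) ^ m)) sums
    (\<Sum>i<n. \<Sum>j<n. cnj (v i) * v j * diag_eval F (z i * cnj (z j)))"
    by (intro sums_sum sums_mult diag_eval_sums[OF F] norm_diag_less) (use z in auto)
  moreover have "(\<Sum>i<n. \<Sum>j<n. cnj (v i) * v j * (complex_of_real (fps_nth F m) * (z i * cnj (z j)) ^ m))
      = complex_of_real (fps_nth F m * (cmod (\<Sum>i<n. cnj (v i) * z i ^ m))\<^sup>2)" for m
    unfolding of_real_mult complex_norm_square quadratic_form_rank_one[symmetric] sum_distrib_left
    by (simp add: power_mult_distrib mult_ac)
  ultimately show ?thesis by simp
qed

lemma summable_weighted: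
  assumes F: "converges_on r F" and x: "0 \<le> x" "x < r\<^sup>2" and g: "\<And>m. 0 \<le> g m" "\<And>m. g m \<le> B"
  shows "summable (\<lambda>m. fps_nth F m * x ^ m * g m)"
proof (rule summable_comparison_test')
  have "summable (\<lambda>m. \<bar>fps_nth F m\<bar> * x ^ m)" using F x unfolding converges_on_def by blast
  then show "summable (\<lambda>m. \<bar>fps_nth F m\<bar> * x ^ m * B)" by (rule summable_mult2)
  show "norm (fps_nth F m * x ^ m * g m) \<le> \<bar>fps_nth F m\<bar> * x ^ m * B" for m
    using g x by (simp add: abs_mult mult_left_mono)
qed

text \<open>The constants do not depend on the weights \<open>g\<close>, which later come from test vectors.\<close>

lemma series_tail_bound:
  assumes F: "converges_on r F" "0 < r"
  shows "\<exists>x0 C. 0 < x0 \<and> x0 < r\<^sup>2 \<and> 0 \<le> C \<and> (\<forall>x g B. 0 < x \<longrightarrow> x \<le> x0 \<longrightarrow> (\<forall>m. 0 \<le> g m \<and> g m \<le> B) \<longrightarrow>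
     \<bar>\<Sum>m. fps_nth F (m + M) * x ^ (m + M) * g (m + M)\<bar> \<le> C * x ^ M * B)"
proof -
  obtain x0 where x0: "0 < x0" "x0 < r\<^sup>2" using dense[of 0 "r\<^sup>2"] F(2) by auto
  have "summable (\<lambda>m. \<bar>fps_nth F m\<bar> * x0 ^ m)" using F x0 unfolding converges_on_def by simp
  then have "summable (\<lambda>m. \<bar>fps_nth F (m + M)\<bar> * x0 ^ (m + M) * (1 / x0 ^ M))"
    by (intro summable_mult2) (rule summable_ignore_initial_segment)
  then have s: "summable (\<lambda>m. \<bar>fps_nth F (m + M)\<bar> * x0 ^ m)"
    using x0 by (simp add: power_add)
  define C where "C = (\<Sum>m. \<bar>fps_nth F (m + M)\<bar> * x0 ^ m)"
  have C: "0 \<le> C" unfolding C_def by (rule suminf_nonneg[OF s]) (use x0 in simp)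
  have "\<bar>\<Sum>m. fps_nth F (m + M) * x ^ (m + M) * g (m + M)\<bar> \<le> C * x ^ M * B"
    if x: "0 < x" "x \<le> x0" and g: "\<forall>m. 0 \<le> g m \<and> g m \<le> B" for x g B
  proof -
    have "norm (fps_nth F (m + M) * x ^ (m + M) * g (m + M)) \<le> \<bar>fps_nth F (m + M)\<bar> * x0 ^ m * (x ^ M * B)" for m
    proof -
      have "norm (fps_nth F (m + M) * x ^ (m + M) * g (m + M)) = \<bar>fps_nth F (m + M)\<bar> * x ^ m * (x ^ M * g (m + M))"
        using x g by (simp add: abs_mult power_add)
      also have "\<dots> \<le> \<bar>fps_nth F (m + M)\<bar> * x0 ^ m * (x ^ M * B)"
        using x g by (intro mult_mono mult_nonneg_nonneg power_mono) auto
      finally show ?thesis .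
    qed
    then have "norm (\<Sum>m. fps_nth F (m + M) * x ^ (m + M) * g (m + M)) \<le> (\<Sum>m. \<bar>fps_nth F (m + M)\<bar> * x0 ^ m * (x ^ M * B))"
      by (rule norm_suminf_le) (rule summable_mult2[OF s])
    also have "\<dots> = C * (x ^ M * B)" unfolding C_def by (rule suminf_mult2[OF s, symmetric])
    finally show ?thesis by (simp add: mult.assoc)
  qed
  then show ?thesis using x0 C by blast
qed

text \<open>As \<open>x\<close> tends to 0 the term of order \<open>a\<close> dominates the terms of higher order.\<close>

lemma leading_coefficient_nonneg:
  assumes F: "converges_on r F" "0 < r"
    and w: "\<And>m. 0 \<le> w m" "\<And>m. w m \<le> B" "\<And>m. m < a \<Longrightarrow> fps_nth F m * w m = 0" "0 < w a"
    and e: "0 < e" and nonneg: "\<And>x. 0 < x \<Longrightarrow> x < e \<Longrightarrow> 0 \<le> (\<Sum>m. fps_nth F m * x ^ m * w m)"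
  shows "0 \<le> fps_nth F a"
proof (rule ccontr)
  assume neg: "\<not> 0 \<le> fps_nth F a"
  obtain x0 C where x0: "0 < x0" "x0 < r\<^sup>2" "0 \<le> C" and
    tail: "\<And>x g B. 0 < x \<Longrightarrow> x \<le> x0 \<Longrightarrow> \<forall>m. 0 \<le> g m \<and> g m \<le> B \<Longrightarrow>
     \<bar>\<Sum>m. fps_nth F (m + Suc a) * x ^ (m + Suc a) * g (m + Suc a)\<bar> \<le> C * x ^ Suc a * B"
    using series_tail_bound[OF F, of "Suc a"] by blast
  have B: "0 \<le> B" using w(1,2)[of 0] by linarith
  define A where "A = - (fps_nth F a * w a)"
  have A: "0 < A" using neg w(4) by (simp add: A_def mult_neg_pos)
  define x where "x = min x0 (min (e / 2) (A / (C * B + 1) / 2))"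
  have CB: "0 < C * B + 1" using x0(3) B by (simp add: add_nonneg_pos)
  have x: "0 < x" "x \<le> x0" "x < e" using x0 e A CB by (auto simp: x_def)
  define D where "D = A / (C * B + 1)"
  have "0 < D" using A CB by (simp add: D_def)
  moreover have "x \<le> D / 2" by (simp add: x_def D_def)
  ultimately have "x < D" by linarith
  then have "x < A / (C * B + 1)" by (simp only: D_def)
  then have xA: "x * (C * B + 1) < A" using CB by (simp add: pos_less_divide_eq)
  have s: "summable (\<lambda>m. fps_nth F m * x ^ m * w m)"
    by (rule summable_weighted[OF F(1) _ _ w(1,2)]) (use x x0 in auto)
  have "(\<Sum>m<Suc a. fps_nth F m * x ^ m * w m) = (\<Sum>m<a. fps_nth F m * w m * x ^ m) + x ^ a * (fps_nth F a * w a)"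
    by (simp add: mult_ac)
  also have "(\<Sum>m<a. fps_nth F m * w m * x ^ m) = 0"
    by (rule sum.neutral) (intro ballI, simp only: lessThan_iff w(3) mult_zero_left)
  finally have head: "(\<Sum>m<Suc a. fps_nth F m * x ^ m * w m) = - (x ^ a * A)" by (simp add: A_def)
  have "(\<Sum>m. fps_nth F m * x ^ m * w m) = (\<Sum>m. fps_nth F (m + Suc a) * x ^ (m + Suc a) * w (m + Suc a)) - x ^ a * A"
    using suminf_split_initial_segment[OF s, of "Suc a"] head by simp
  also have "\<dots> \<le> C * x ^ Suc a * B - x ^ a * A"
    using tail[OF x(1,2), of w B] w by (simp add: abs_le_iff)
  also have "\<dots> = x ^ a * (x * (C * B) - A)" by (simp add: algebra_simps)
  also have "\<dots> < 0"
  proof (rule mult_pos_neg)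
    show "0 < x ^ a" using x by simp
    show "x * (C * B) - A < 0" using xA x by (simp add: algebra_simps)
  qed
  finally show False using nonneg[OF x(1,3)] by simp
qed

lemma circle_point_mem_ball:
  assumes "0 < r" "1 \<le> M" "u ^ M = 1" "0 < x" "x < r\<^sup>2"
  shows "complex_of_real (sqrt x) * u \<in> ball 0 r"
proof -
  have "sqrt x < r" using assms by (metis abs_of_pos real_sqrt_abs real_sqrt_less_iff)
  then show ?thesis using assms norm_root_of_unity[OF assms(2,3)] by (simp add: norm_mult)
qed

lemma circle_form_sums:
  fixes n :: nat
  assumes F: "converges_on r F" "0 < r" and x: "0 < x" "x < r\<^sup>2" and M: "1 \<le> M" and u: "\<And>i. i < n \<Longrightarrow> u i ^ M = 1"
  shows "(\<lambda>m. complex_of_real (fps_nth F m * x ^ m * (cmod (\<Sum>i<n. cnj (v i) * u i ^ m))\<^sup>2)) sums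
    (\<Sum>i<n. \<Sum>j<n. cnj (v i) * v j * diag_eval F ((complex_of_real (sqrt x) * u i) * cnj (complex_of_real (sqrt x) * u j)))"
proof -
  have "(cmod (\<Sum>i<n. cnj (v i) * (complex_of_real (sqrt x) * u i) ^ m))\<^sup>2
      = x ^ m * (cmod (\<Sum>i<n. cnj (v i) * u i ^ m))\<^sup>2" for m
  proof -
    have "(\<Sum>i<n. cnj (v i) * (complex_of_real (sqrt x) * u i) ^ m)
        = complex_of_real (sqrt x) ^ m * (\<Sum>i<n. cnj (v i) * u i ^ m)"
      by (simp add: power_mult_distrib sum_distrib_left mult_ac)
    moreover have "(sqrt x ^ m)\<^sup>2 = x ^ m"
      using x by (metis less_imp_le power_mult mult.commute real_sqrt_pow2)
    ultimately show ?thesis using x by (simp add: norm_mult norm_power power_mult_distrib)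
  qed
  then show ?thesis
    using diag_quadratic_form_sums[OF F, of n "\<lambda>i. complex_of_real (sqrt x) * u i" v]
      circle_point_mem_ball[OF F(2) M u x] by (simp add: mult.assoc)
qed

lemma sums_complex_of_realD:
  fixes f :: "nat \<Rightarrow> real"
  assumes "(\<lambda>m. complex_of_real (f m)) sums S"
  shows "f sums Re S" "Im S = 0"
  using sums_Re[OF assms] sums_Im[OF assms] sums_unique2[of "\<lambda>_. 0 :: real" "Im S" 0] by simp_all

text \<open>Among \<open>M = a + 1\<close> equidistant points of a circle the test vector \<open>(u\<^sub>i\<^sup>a)\<close> annihilates the powers
  \<open>t\<^sup>m\<close> with \<open>m < a\<close>, so the coefficient of \<open>t\<^sup>a\<close> leads.\<close>

lemma diag_kernel_coefficients_nonneg: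
  assumes q: "is_kernel (ball 0 r) q" and r: "0 < r" and exp: "diag_expansion r F q"
  shows "0 \<le> fps_nth F a"
proof -
  have F: "converges_on r F" by (rule diag_expansion_converges[OF exp r])
  define M where "M = Suc a"
  have M: "1 \<le> M" by (simp add: M_def)
  define u where "u i = unity_root M ^ i" for i
  have u: "u i ^ M = 1" for i unfolding u_def by (rule unity_root_power_M[OF M])
  have nu: "cmod (u i) = 1" for i by (rule norm_root_of_unity[OF M u])
  define v where "v i = u i ^ a" for i
  define w where "w m = (cmod (\<Sum>i<M. cnj (v i) * u i ^ m))\<^sup>2" for m
  have ortho: "(\<Sum>i<M. cnj (v i) * u i ^ m) = (if m = a then of_nat M else 0)" if "m < M" for m
    using sum_unity_root_orthogonal[OF M that, of a] by (simp add: u_def v_def M_def mult.commute)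
  show ?thesis
  proof (rule leading_coefficient_nonneg[OF F r, of w "(real M)\<^sup>2" a "r\<^sup>2"])
    fix m
    show "0 \<le> w m" by (simp add: w_def)
    have "cmod (\<Sum>i<M. cnj (v i) * u i ^ m) \<le> (\<Sum>i<M. 1)"
      by (rule sum_norm_le) (simp add: v_def norm_mult norm_power nu)
    then show "w m \<le> (real M)\<^sup>2" unfolding w_def by (intro power_mono) auto
    show "fps_nth F m * w m = 0" if "m < a" using ortho[of m] that by (simp add: w_def M_def)
  next
    show "0 < w a" using ortho[of a] by (simp add: w_def M_def del: of_nat_Suc)
    show "0 < r\<^sup>2" using r by simp
    fix x :: real assume x: "0 < x" "x < r\<^sup>2"
    let ?z = "\<lambda>i. complex_of_real (sqrt x) * u i"
    have z: "?z i \<in> ball 0 r" for i by (rule circle_point_mem_ball[OF r M u x])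
    have "psd_mat M (Matrix.mat M M (\<lambda>(i, j). q (?z i) (?z j)))"
      using q z unfolding is_kernel_def by (elim conjE allE[of _ M] allE[of _ ?z]) simp
    then have "0 \<le> (Matrix.mat M M (\<lambda>(i, j). q (?z i) (?z j)) *\<^sub>v Matrix.vec M v) \<bullet>c Matrix.vec M v"
      unfolding psd_mat_def by simp
    also have "\<dots> = (\<Sum>i<M. \<Sum>j<M. cnj (v i) * v j * q (?z i) (?z j))"
      by (simp add: scalar_prod_def lessThan_atLeast0 sum_distrib_left sum_distrib_right mult_ac)
    also have "\<dots> = (\<Sum>i<M. \<Sum>j<M. cnj (v i) * v j * diag_eval F (?z i * cnj (?z j)))"
      by (simp only: diag_expansion_eval[OF exp F r z z])
    finally have "0 \<le> Re (\<Sum>i<M. \<Sum>j<M. cnj (v i) * v j * diag_eval F (?z i * cnj (?z j)))"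
      by (simp add: less_eq_complex_def)
    then show "0 \<le> (\<Sum>m. fps_nth F m * x ^ m * w m)"
      using sums_complex_of_realD(1)[OF circle_form_sums[OF F r x M u, where n = M and v = v]]
      by (simp add: w_def sums_iff)
  qed
qed

text \<open>At points \<open>\<surd>x u\<close> with \<open>u\<^sup>M = 1\<close> the quadratic form of \<open>t\<^sup>m\<close> is \<open>x\<^sup>m\<close> times a non-negative weight that
  depends only on \<open>m mod M\<close>.  The first \<open>M\<close> coefficients cover all residue classes and are positive,
  so for small \<open>x\<close> they outweigh all others.\<close>

lemma circle_kernel_pos:
  assumes F: "converges_on r F" "0 < r" and M: "1 \<le> M" and pos: "\<And>m. m < M \<Longrightarrow> 0 < fps_nth F m"
  shows "\<exists>x1>0. x1 \<le> r\<^sup>2 \<and> (\<forall>x. 0 < x \<longrightarrow> x < x1 \<longrightarrow> pos_kernel {u. u ^ M = 1}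
      (\<lambda>u u'. diag_eval F ((complex_of_real (sqrt x) * u) * cnj (complex_of_real (sqrt x) * u'))))"
proof -
  obtain x0 C where x0: "0 < x0" "x0 < r\<^sup>2" "0 \<le> C" and
    tail: "\<And>x g B. 0 < x \<Longrightarrow> x \<le> x0 \<Longrightarrow> \<forall>m. 0 \<le> g m \<and> g m \<le> B \<Longrightarrow>
     \<bar>\<Sum>m. fps_nth F (m + M) * x ^ (m + M) * g (m + M)\<bar> \<le> C * x ^ M * B"
    using series_tail_bound[OF F, of M] by blast
  define d where "d = Min (fps_nth F ` {..<M})"
  have d_le: "d \<le> fps_nth F m" if "m < M" for m unfolding d_def using that by (intro Min_le) auto
  have "d \<in> fps_nth F ` {..<M}" unfolding d_def by (rule Min_in) (use M in \<open>auto simp: lessThan_empty_iff\<close>)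
  then have d: "0 < d" using pos by auto
  define x1 where "x1 = min x0 (min 1 (d / (C + 1)))"
  have x1: "0 < x1" "x1 \<le> r\<^sup>2" using x0 d by (auto simp: x1_def)
  have "pos_kernel {u. u ^ M = 1}
      (\<lambda>u u'. diag_eval F ((complex_of_real (sqrt x) * u) * cnj (complex_of_real (sqrt x) * u')))"
    if x: "0 < x" "x < x1" for x
  proof (rule pos_kernelI)
    fix n :: nat and u :: "nat \<Rightarrow> complex" and v :: "nat \<Rightarrow> complex" assume "\<And>i. i < n \<Longrightarrow> u i \<in> {u. u ^ M = 1}"
    then have u: "u i ^ M = 1" if "i < n" for i using that by blast
    have xb: "x \<le> x0" "x < r\<^sup>2" "x \<le> 1" using x x0 by (auto simp: x1_def)
    have "x < d / (C + 1)" using x by (simp add: x1_def)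
    then have "x * (C + 1) < d" using x0(3) by (simp add: pos_less_divide_eq)
    then have xC: "C * x \<le> d" using x(1) by (simp add: algebra_simps)
    define w where "w m = (cmod (\<Sum>i<n. cnj (v i) * u i ^ m))\<^sup>2" for m
    define B where "B = (\<Sum>m<M. w m)"
    have w_mod: "w m = w (m mod M)" for m
    proof -
      have "u i ^ m = u i ^ (m mod M)" if "i < n" for i
      proof -
        have "u i ^ m = u i ^ (M * (m div M) + m mod M)" by simp
        also have "\<dots> = u i ^ (m mod M)" unfolding power_add power_mult u[OF that] by simp
        finally show ?thesis .
      qed
      then show ?thesis unfolding w_def by simp
    qed
    have w: "0 \<le> w m" for m by (simp add: w_def)
    have w_le: "w m \<le> B" for m
    proof -
      have "w (m mod M) \<le> B" unfolding B_def by (rule member_le_sum) (use M w in auto)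
      then show ?thesis using w_mod[of m] by simp
    qed
    have B: "0 \<le> B" unfolding B_def by (rule sum_nonneg) (rule w)
    let ?S = "\<Sum>i<n. \<Sum>j<n. cnj (v i) * v j * diag_eval F ((complex_of_real (sqrt x) * u i) * cnj (complex_of_real (sqrt x) * u j))"
    have S: "(\<lambda>m. complex_of_real (fps_nth F m * x ^ m * w m)) sums ?S"
      unfolding w_def by (rule circle_form_sums[OF F x(1) xb(2) M u])
    have s: "summable (\<lambda>m. fps_nth F m * x ^ m * w m)"
      by (rule summable_weighted[OF F(1) _ xb(2) w w_le]) (use x in simp)
    have "d * x ^ (M - 1) * B \<le> (\<Sum>m<M. fps_nth F m * x ^ m * w m)"
      unfolding B_def sum_distrib_left
    proof (rule sum_mono, rule mult_right_mono[OF _ w])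
      fix m assume "m \<in> {..<M}"
      then show "d * x ^ (M - 1) \<le> fps_nth F m * x ^ m"
        using d d_le[of m] x xb by (intro mult_mono power_decreasing) auto
    qed
    moreover have "- (C * x ^ M * B) \<le> (\<Sum>m. fps_nth F (m + M) * x ^ (m + M) * w (m + M))"
      using tail[OF x(1) xb(1), of w B] w w_le by (simp add: abs_le_iff)
    moreover have "C * x ^ M * B \<le> d * x ^ (M - 1) * B"
    proof (rule mult_right_mono[OF _ B])
      have "C * x ^ M = C * x * x ^ (M - 1)" using M by (cases M) auto
      also have "\<dots> \<le> d * x ^ (M - 1)" using xC x by (intro mult_right_mono) auto
      finally show "C * x ^ M \<le> d * x ^ (M - 1)" .
    qed
    ultimately have "0 \<le> (\<Sum>m. fps_nth F m * x ^ m * w m)"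
      using suminf_split_initial_segment[OF s, of M] by simp
    then show "0 \<le> ?S"
      using sums_complex_of_realD[OF S] by (simp add: less_eq_complex_def sums_iff)
  qed
  then show ?thesis using x1 by blast
qed

section \<open>Coefficient bounds from the Pick property\<close>

text \<open>Let \<open>Q\<close> be the polynomial with coefficients \<open>t * q i\<close>, where \<open>t < 1\<close>, and \<open>c = l - Q * k\<close>.  The factor
  \<open>t\<close> makes the first \<open>M\<close> coefficients of \<open>c\<close> positive, so \<open>c\<close> is positive on \<open>M\<close> equidistant points
  \<open>z i\<close> of a small circle, and matrices with first rows \<open>f i = (\<surd>Q\<^sub>j (z i)\<^sup>j)\<close> are admissible data.
  Let \<open>g\<close> be the first row of the value at 0 of an interpolating multiplier.  The test vector with
  entries 1 at the \<open>z i\<close> and \<open>-M\<close> at 0 eliminates \<open>g\<close> up to a negative square, and the sums of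
  powers of roots of unity leave from \<open>c\<close> only the coefficients whose exponent is a positive
  multiple of \<open>M\<close>.  Hence \<open>c\<^sub>M \<ge> 0\<close> as the radius tends to 0, and \<open>t\<close> tends to 1.\<close>

lemma complete_pick_pair_imp_coefficient_bound:
  fixes ks ls :: "real fps" and q :: "nat \<Rightarrow> real"
  assumes r: "0 < r" and k: "diag_expansion r ks k" and l: "diag_expansion r ls l"
    and ks: "fps_nth ks 0 = 1" and ls: "fps_nth ls 0 = 1" "\<And>m. 0 < fps_nth ls m"
    and rk: "is_rkhs (ball 0 r) k (rkhs (ball 0 r) k)" and rl: "is_rkhs (ball 0 r) l (rkhs (ball 0 r) l)"
    and pick: "complete_pick_pair (ball 0 r) k l"
    and q: "\<And>i. i < M \<Longrightarrow> 0 \<le> q i"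
    and feasible: "\<And>m. m < M \<Longrightarrow> (\<Sum>i\<le>m. q i * fps_nth ks (m - i)) \<le> fps_nth ls m"
  shows "(\<Sum>i<M. q i * fps_nth ks (M - i)) \<le> fps_nth ls M"
proof (cases "M = 0")
  case True
  then show ?thesis using ls(1) by simp
next
  case False
  then have M: "1 \<le> M" by simp
  have ck: "converges_on r ks" and cl: "converges_on r ls"
    using diag_expansion_converges[OF k r] diag_expansion_converges[OF l r] by auto
  define S where "S = (\<Sum>i<M. q i * fps_nth ks (M - i))"
  have "t * S \<le> fps_nth ls M" if t: "0 < t" "t < 1" for t :: real
  proof -
    define Q where "Q = Abs_fps (\<lambda>j. if j < M then t * q j else 0)"
    define c where "c = ls - Q * ks"
    have Q0: "fps_nth Q m = 0" if "M \<le> m" for m using that by (simp add: Q_def)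
    have Q_nonneg: "0 \<le> fps_nth Q m" for m using q t by (simp add: Q_def)
    have cQ: "converges_on r Q" by (rule converges_on_finite_support[OF Q0])
    have cc: "converges_on r c" unfolding c_def by (intro converges_on_diff converges_on_mult cl cQ ck r)
    have ev_c: "diag_eval c z = diag_eval ls z - diag_eval Q z * diag_eval ks z" if "cmod z < r\<^sup>2" for z
      unfolding c_def diag_eval_diff[OF cl converges_on_mult[OF cQ ck r] r that] diag_eval_mult[OF cQ ck r that] ..
    have c_less: "0 < fps_nth c m" if m: "m < M" for m
    proof -
      have "fps_nth (Q * ks) m = (\<Sum>i\<le>m. t * (q i * fps_nth ks (m - i)))"
        unfolding fps_mult_nth atLeast0AtMost using m by (intro sum.cong refl) (simp add: Q_def)
      also have "\<dots> = t * (\<Sum>i\<le>m. q i * fps_nth ks (m - i))" by (simp add: sum_distrib_left)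
      also have "\<dots> \<le> t * fps_nth ls m" using feasible[OF m] t by (intro mult_left_mono) auto
      also have "\<dots> < fps_nth ls m" using t ls(2)[of m] by simp
      finally show ?thesis by (simp add: c_def)
    qed
    have c_M: "fps_nth c M = fps_nth ls M - t * S"
    proof -
      have "fps_nth (Q * ks) M = (\<Sum>i\<le>M. fps_nth Q i * fps_nth ks (M - i))"
        unfolding fps_mult_nth atLeast0AtMost ..
      also have "\<dots> = (\<Sum>i<M. fps_nth Q i * fps_nth ks (M - i))"
        using Q0[of M] by (simp flip: lessThan_Suc_atMost)
      also have "\<dots> = t * S"
        unfolding S_def sum_distrib_left by (intro sum.cong refl) (simp add: Q_def)
      finally show ?thesis by (simp add: c_def)
    qed
    have c_0: "fps_nth c 0 = 1 - fps_nth Q 0" by (simp add: c_def ks ls)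
    define u where "u i = unity_root M ^ i" for i
    have u: "u i ^ M = 1" for i unfolding u_def by (rule unity_root_power_M[OF M])
    have nu: "cmod (u i) = 1" for i by (rule norm_root_of_unity[OF M u])
    have ortho: "(\<Sum>i<M. u i ^ m) = (if m = 0 then of_nat M else 0)" if "m < M" for m
      using sum_unity_root_orthogonal[OF M that, of 0] M by (simp add: u_def)
    define w where "w m = (cmod (\<Sum>i<M. cnj 1 * u i ^ m))\<^sup>2" for m
    have w: "0 \<le> w m" "w m \<le> (real M)\<^sup>2" for m
    proof -
      have "cmod (\<Sum>i<M. cnj 1 * u i ^ m) \<le> (\<Sum>i<M. 1)"
        by (rule sum_norm_le) (simp add: norm_power nu)
      then show "w m \<le> (real M)\<^sup>2" unfolding w_def by (intro power_mono) auto
    qed (simp add: w_def)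
    have w0: "w 0 = (real M)\<^sup>2" by (simp add: w_def)
    obtain x1 where x1: "0 < x1" "x1 \<le> r\<^sup>2" and
      circle: "\<And>x. 0 < x \<Longrightarrow> x < x1 \<Longrightarrow> pos_kernel {u. u ^ M = 1}
        (\<lambda>u u'. diag_eval c ((complex_of_real (sqrt x) * u) * cnj (complex_of_real (sqrt x) * u')))"
      using circle_kernel_pos[OF cc r M c_less] by blast
    have key: "(real M)\<^sup>2 * fps_nth c 0 \<le> (\<Sum>m. fps_nth c m * x ^ m * w m)" if x: "0 < x" "x < x1" for x
    proof -
      have xr: "x < r\<^sup>2" using x x1 by simp
      define z where "z i = complex_of_real (sqrt x) * u i" for i
      have z: "z i \<in> ball 0 r" for i unfolding z_def by (rule circle_point_mem_ball[OF r M u x(1) xr])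
      have tz: "cmod (z i * cnj (z j)) < r\<^sup>2" for i j by (rule norm_diag_less[OF z z])
      define f where "f i c = complex_of_real (sqrt (fps_nth Q c)) * z i ^ c" for i c
      have herm_f: "herm M (f i) (f j) = diag_eval Q (z i * cnj (z j))" for i j
      proof -
        have "complex_of_real (sqrt (fps_nth Q c)) * complex_of_real (sqrt (fps_nth Q c)) = complex_of_real (fps_nth Q c)" for c
          using Q_nonneg[of c] by (simp flip: of_real_mult)
        then have "f i c * cnj (f j c) = complex_of_real (fps_nth Q c) * (z i * cnj (z j)) ^ c" for c
          by (simp add: f_def power_mult_distrib mult_ac)
        moreover have "diag_eval Q (z i * cnj (z j)) = (\<Sum>c<M. complex_of_real (fps_nth Q c) * (z i * cnj (z j)) ^ c)"
          by (rule diag_eval_polynomial[OF Q0 r tz])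
        ultimately show ?thesis by (simp add: herm_def)
      qed
      have kz: "k (z i) (z j) = diag_eval ks (z i * cnj (z j))" and lz: "l (z i) (z j) = diag_eval ls (z i * cnj (z j))" for i j
        using diag_expansion_eval[OF k ck r z z] diag_expansion_eval[OF l cl r z z] by auto
      have pick_form: "l (z i) (z j) - k (z i) (z j) * herm M (f i) (f j) = diag_eval c (z i * cnj (z j))" for i j
        unfolding kz lz herm_f ev_c[OF tz] by simp
      have pos_l: "pos_kernel {..<M} (\<lambda>i j. l (z i) (z j))"
        unfolding lz by (rule pos_kernel_diag_eval[OF cl r less_imp_le[OF ls(2)] z])
      have pos_lk: "pos_kernel {..<M} (\<lambda>i j. l (z i) (z j) - k (z i) (z j) * herm M (f i) (f j))"
        unfolding pick_form unfolding z_def by (rule pos_kernel_comp[OF circle[OF x]]) (simp add: u)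
      define W where "W i = Matrix.mat M M (\<lambda>(a, c). if a = 0 then f i c else 0)" for i
      have W: "W i \<in> carrier_mat M M" for i by (simp add: W_def)
      have "pos_kernel {..<M * M} (\<lambda>b b'. (if b mod M = b' mod M then l (z (b div M)) (z (b' div M)) else 0)
           - k (z (b div M)) (z (b' div M)) * herm M (\<lambda>c. W (b div M) $$ (b mod M, c)) (\<lambda>c. W (b' div M) $$ (b' mod M, c)))"
      proof (rule pos_kernel_cong[OF pos_kernel_comp[OF row_data_pos_kernel[OF pos_l pos_lk], of "{..<M * M}" "\<lambda>b. (b div M, b mod M)"]])
        show "(b div M, b mod M) \<in> {..<M} \<times> {..<M}" if "b \<in> {..<M * M}" for b
          using that M by (auto intro: less_mult_imp_div_less)
      next
        fix b b' :: nat
        have m: "b mod M < M" "b' mod M < M" using M by auto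
        have "herm M (\<lambda>c. W (b div M) $$ (b mod M, c)) (\<lambda>c. W (b' div M) $$ (b' mod M, c))
          = herm M (\<lambda>c. if b mod M = 0 then f (b div M) c else 0) (\<lambda>c. if b' mod M = 0 then f (b' div M) c else 0)"
          by (rule herm_cong) (use m in \<open>simp_all add: W_def\<close>)
        then show "(case (b div M, b mod M) of (i, a) \<Rightarrow> \<lambda>(j, b). (if a = b then l (z i) (z j) else 0) - k (z i) (z j) *
            herm M (\<lambda>c. if a = 0 then f i c else 0) (\<lambda>c. if b = 0 then f j c else 0)) (b' div M, b' mod M)
          = (if b mod M = b' mod M then l (z (b div M)) (z (b' div M)) else 0)
           - k (z (b div M)) (z (b' div M)) * herm M (\<lambda>c. W (b div M) $$ (b mod M, c)) (\<lambda>c. W (b' div M) $$ (b' mod M, c))"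
          by simp
      qed
      then have psd: "psd_mat (M * M) (block_matrix M M (\<lambda>i j.
          l (z i) (z j) \<cdot>\<^sub>m 1\<^sub>m M - k (z i) (z j) \<cdot>\<^sub>m (W i * mat_adjoint (W j))))"
        by (subst block_psd_iff_pos_kernel) (rule W)
      have "\<exists>\<Phi>\<in>Mult (ball 0 r) M k l. mult_norm (ball 0 r) M k l \<Phi> \<le> 1 \<and> (\<forall>i<M. \<Phi> (z i) = W i)"
        by (rule pick[unfolded complete_pick_pair_def, rule_format, OF M M], intro conjI allI impI z W psd)
      then obtain \<Phi> where \<Phi>: "\<Phi> \<in> Mult (ball 0 r) M k l" "mult_norm (ball 0 r) M k l \<Phi> \<le> 1"
        and interp: "\<And>i. i < M \<Longrightarrow> \<Phi> (z i) = W i"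
        by blast
      have carr: "\<Phi> y \<in> carrier_mat M M" if "y \<in> ball 0 r" for y using \<Phi>(1) that by (simp add: Mult_def)
      have pos: "pos_kernel (ball 0 r \<times> {..<M}) (multiplier_kernel M k l \<Phi>)"
        by (subst contractive_multiplier_iff[OF rk rl, symmetric]) (auto intro: carr \<Phi>)
      define g where "g c = \<Phi> 0 $$ (0, c)" for c
      have row: "herm M (\<lambda>c. \<Phi> (z i) $$ (0, c)) y = herm M (f i) y" "herm M y (\<lambda>c. \<Phi> (z i) $$ (0, c)) = herm M y (f i)"
        if "i < M" for i y
        using that M by (auto intro!: herm_cong simp: interp W_def)
      have zero: "diag_eval ks 0 = 1" "diag_eval ls 0 = 1"
        using ks ls(1) by (simp_all add: diag_eval_def eval_fps_at_0 complex_fps_def)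
      have b0: "(0::complex) \<in> ball 0 r" using r by simp
      have k0: "k y 0 = 1" "k 0 y = 1" "l y 0 = 1" "l 0 y = 1" if "y \<in> ball 0 r" for y
        using diag_expansion_eval[OF k ck r that b0] diag_expansion_eval[OF k ck r b0 that]
          diag_expansion_eval[OF l cl r that b0] diag_expansion_eval[OF l cl r b0 that] zero by simp_all
      define Sc where "Sc = (\<Sum>i<M. \<Sum>j<M. diag_eval c (z i * cnj (z j)))"
      define p where "p i = (if i < M then (z i, 0) else (0, 0::nat))" for i
      define a where "a i = (if i < M then 1 else - of_nat M :: complex)" for i
      \<comment> \<open>the mean of the rows \<open>f i\<close>\<close>
      define h where "h c = (if c = 0 then complex_of_real (sqrt (fps_nth Q 0)) else 0)" for c :: nat
      have sum_f: "(\<Sum>i<M. f i c) = of_nat M * h c" if c: "c < M" for c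
      proof -
        have "(\<Sum>i<M. f i c) = complex_of_real (sqrt (fps_nth Q c)) * complex_of_real (sqrt x) ^ c * (\<Sum>i<M. u i ^ c)"
          by (simp add: f_def z_def power_mult_distrib sum_distrib_left mult_ac)
        then show ?thesis unfolding ortho[OF c] by (simp add: h_def)
      qed
      have sum_fg: "(\<Sum>i<M. herm M (f i) g) = of_nat M * herm M h g"
      proof -
        have "(\<Sum>i<M. herm M (f i) g) = herm M (\<lambda>c. of_nat M * h c) g"
          unfolding herm_sum_left[symmetric] by (rule herm_cong) (auto simp: sum_f)
        then show ?thesis by (simp only: herm_scale_left)
      qed
      have sum_gf: "(\<Sum>i<M. herm M g (f i)) = of_nat M * herm M g h"
        using arg_cong[OF sum_fg, of cnj] by (simp add: cnj_herm)
      have hh: "herm M h h = complex_of_real (fps_nth Q 0)"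
      proof -
        have "herm M h h = (\<Sum>c<M. if c = 0 then complex_of_real (fps_nth Q 0) else 0)"
          unfolding herm_def by (intro sum.cong refl) (use Q_nonneg[of 0] in \<open>simp add: h_def flip: of_real_mult\<close>)
        then show ?thesis using M by simp
      qed
      have "0 \<le> (\<Sum>i<Suc M. \<Sum>j<Suc M. cnj (a i) * a j * multiplier_kernel M k l \<Phi> (p i) (p j))"
        by (rule pos_kernelD[OF pos]) (use z b0 M in \<open>auto simp: p_def\<close>)
      also have "\<dots> = Sc + (\<Sum>i<M. - of_nat M * (1 - herm M (f i) g)) + (\<Sum>j<M. - of_nat M * (1 - herm M g (f j)))
           + of_nat M * of_nat M * (1 - herm M g g)"
        by (simp add: a_def p_def multiplier_kernel_def row pick_form k0[OF z] k0[OF b0] g_def[symmetric] g_def[abs_def, symmetric] Sc_def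
             sum.distrib sum_negf sum_subtractf)
      also have "\<dots> = Sc - (of_nat M)\<^sup>2 + (of_nat M)\<^sup>2 * herm M h h - (of_nat M)\<^sup>2 * herm M (\<lambda>c. h c - g c) (\<lambda>c. h c - g c)"
        unfolding sum_distrib_left[symmetric] sum_subtractf sum_fg sum_gf herm_diff_left herm_diff_right
        by (simp add: power2_eq_square algebra_simps)
      finally have "0 \<le> Sc - (of_nat M)\<^sup>2 + (of_nat M)\<^sup>2 * herm M h h
          - (of_nat M)\<^sup>2 * herm M (\<lambda>c. h c - g c) (\<lambda>c. h c - g c)" .
      moreover define D where "D = (\<Sum>c<M. (cmod (h c - g c))\<^sup>2)"
      moreover have "(of_nat M)\<^sup>2 = complex_of_real ((real M)\<^sup>2)" by simp
      ultimately have "0 \<le> Sc - complex_of_real ((real M)\<^sup>2) + complex_of_real ((real M)\<^sup>2 * fps_nth Q 0)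
          - complex_of_real ((real M)\<^sup>2 * D)"
        unfolding hh unfolding herm_self by (simp only: of_real_mult)
      then have "0 \<le> Re Sc - (real M)\<^sup>2 + (real M)\<^sup>2 * fps_nth Q 0 - (real M)\<^sup>2 * D"
        by (simp only: less_eq_complex_def zero_complex.sel minus_complex.sel plus_complex.sel Re_complex_of_real)
      moreover have "0 \<le> (real M)\<^sup>2 * D"
        unfolding D_def by (intro mult_nonneg_nonneg sum_nonneg) auto
      ultimately have "(real M)\<^sup>2 * fps_nth c 0 \<le> Re Sc" unfolding c_0 by (simp add: algebra_simps)
      also have "Re Sc = (\<Sum>m. fps_nth c m * x ^ m * w m)"
        using sums_complex_of_realD(1)[OF circle_form_sums[OF cc r x(1) xr M u, where n = M and v = "\<lambda>_. 1"]]
        by (simp add: w_def Sc_def z_def sums_iff)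
      finally show ?thesis .
    qed
    define c' where "c' = c - fps_const (fps_nth c 0)"
    have cc': "converges_on r c'"
      unfolding c'_def by (intro converges_on_diff cc r converges_on_finite_support[of 1]) auto
    have "0 \<le> fps_nth c' M"
    proof (rule leading_coefficient_nonneg[OF cc' r w, where a = M and e = x1])
      show "fps_nth c' m * w m = 0" if "m < M" for m
        using ortho[OF that] by (cases "m = 0") (simp_all add: c'_def w_def)
      have "u i ^ M = 1" for i by (rule u)
      then show "0 < w M" using M by (simp add: w_def)
    next
      fix x assume x: "0 < x" "x < x1"
      have xr: "0 \<le> x" "x < r\<^sup>2" using x x1 by auto
      have sc: "summable (\<lambda>m. fps_nth c m * x ^ m * w m)" by (rule summable_weighted[OF cc xr w])
      have sc': "summable (\<lambda>m. fps_nth c' m * x ^ m * w m)" by (rule summable_weighted[OF cc' xr w])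
      have "(\<Sum>m. fps_nth c m * x ^ m * w m) = (\<Sum>m. fps_nth c (Suc m) * x ^ Suc m * w (Suc m)) + fps_nth c 0 * w 0"
        using suminf_split_head[OF sc] by simp
      moreover have "(\<Sum>m. fps_nth c' m * x ^ m * w m) = (\<Sum>m. fps_nth c (Suc m) * x ^ Suc m * w (Suc m))"
        using suminf_split_head[OF sc'] by (simp add: c'_def)
      ultimately show "0 \<le> (\<Sum>m. fps_nth c' m * x ^ m * w m)"
        using key[OF x] by (simp add: w0 mult.commute)
    qed (rule x1(1))
    then have "0 \<le> fps_nth c M" using M by (simp add: c'_def)
    then show ?thesis unfolding c_M by simp
  qed
  then have "S \<le> fps_nth ls M" by (rule field_le_mult_one_interval)
  then show ?thesis by (simp add: S_def)
qed

section \<open>The greedy multiplier series\<close>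

text \<open>For \<open>n > 0\<close> and \<open>k 0 = 1\<close> the number \<open>greedy k n\<close> is the least non-negative one that makes the
  coefficient of the product with \<open>k\<close> at \<open>n\<close> at least \<open>k n\<close>, once the previous ones are chosen.\<close>

fun greedy :: "(nat \<Rightarrow> real) \<Rightarrow> nat \<Rightarrow> real" where
  "greedy k n = (if n = 0 then 0 else max 0 (k n - (\<Sum>i<n. greedy k i * k (n - i))))"

declare greedy.simps [simp del]

definition greedy_fps :: "real fps \<Rightarrow> real fps" where
  "greedy_fps K = Abs_fps (greedy (fps_nth K))"

lemma greedy_fps_0: "fps_nth (greedy_fps K) 0 = 0"
  by (simp add: greedy_fps_def greedy.simps[of _ 0])

lemma greedy_fps_nonneg: "0 \<le> fps_nth (greedy_fps K) n"
  by (simp add: greedy_fps_def greedy.simps[of _ n])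

lemma greedy_fps_mult:
  assumes "fps_nth K 0 = 1" "0 < n"
  shows "fps_nth (greedy_fps K * K) n = max (fps_nth K n) (\<Sum>i<n. fps_nth (greedy_fps K) i * fps_nth K (n - i))"
proof -
  have "fps_nth (greedy_fps K * K) n = (\<Sum>i<n. fps_nth (greedy_fps K) i * fps_nth K (n - i)) + fps_nth (greedy_fps K) n"
    using assms(1) unfolding fps_mult_nth atLeast0AtMost lessThan_Suc_atMost[symmetric] by simp
  then show ?thesis
    using assms(2) by (simp add: greedy_fps_def greedy.simps[of _ n] max_def)
qed

lemma greedy_fps_mult_ge:
  assumes "fps_nth K 0 = 1" "0 < n"
  shows "fps_nth K n \<le> fps_nth (greedy_fps K * K) n"
  using greedy_fps_mult[OF assms] by simp

lemma greedy_fps_mult_eq: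
  assumes "fps_nth K 0 = 1" "0 < n" "fps_nth (greedy_fps K) n \<noteq> 0"
  shows "fps_nth (greedy_fps K * K) n = fps_nth K n"
  using assms(2,3) unfolding greedy_fps_mult[OF assms(1,2)]
  by (auto simp: greedy_fps_def greedy.simps[of _ n] max_def split: if_splits)

lemma greedy_fps_le:
  assumes "\<And>m. 0 \<le> fps_nth K m"
  shows "fps_nth (greedy_fps K) n \<le> fps_nth K n"
proof -
  have "0 \<le> (\<Sum>i<n. greedy (fps_nth K) i * fps_nth K (n - i))"
    using greedy_fps_nonneg[of K] assms by (intro sum_nonneg mult_nonneg_nonneg) (auto simp: greedy_fps_def)
  then show ?thesis using assms[of n] by (auto simp: greedy_fps_def greedy.simps[of _ n])
qed

text \<open>Complementary slackness.  The coefficient of \<open>P * Q * K\<close> at \<open>n\<close>, with \<open>P\<close> the greedy series, is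
  computed in two ways.  In \<open>P * (Q * K)\<close> only exponents with \<open>P\<^sub>n\<^sub>-\<^sub>m \<noteq> 0\<close> matter, where
  \<open>Q * K\<close> agrees with \<open>L\<close>.  In \<open>Q * (P * K)\<close> only exponents with \<open>Q\<^sub>m \<noteq> 0\<close> matter, where \<open>P\<^sub>n\<^sub>-\<^sub>m \<noteq> 0\<close>
  and hence \<open>P * K\<close> agrees with \<open>K\<close> at \<open>n - m\<close>; the exponent \<open>m = n\<close> is the exception, since
  \<open>(P * K)\<^sub>0 = 0\<close> and \<open>K\<^sub>0 = 1\<close>, and it produces the slack \<open>Q\<^sub>n\<close>.\<close>

lemma greedy_fps_product_bound:
  assumes K0: "fps_nth K 0 = 1" and n: "0 < n"
    and agree: "\<And>m. m \<le> n \<Longrightarrow> m = n \<or> fps_nth (greedy_fps K) (n - m) \<noteq> 0 \<Longrightarrow> fps_nth (Q * K) m = fps_nth L m"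
    and vanish: "\<And>m. m < n \<Longrightarrow> fps_nth (greedy_fps K) (n - m) = 0 \<Longrightarrow> fps_nth Q m = 0"
    and Qn: "0 \<le> fps_nth Q n"
  shows "fps_nth (greedy_fps K * L) n \<le> fps_nth L n"
proof -
  let ?P = "greedy_fps K"
  have "fps_nth (?P * L) n = fps_nth (L * ?P) n" by (simp only: mult.commute)
  also have "\<dots> = (\<Sum>m\<le>n. fps_nth L m * fps_nth ?P (n - m))"
    unfolding fps_mult_nth atLeast0AtMost ..
  also have "\<dots> = (\<Sum>m\<le>n. fps_nth (Q * K) m * fps_nth ?P (n - m))"
    by (intro sum.cong refl) (use agree in fastforce)
  also have "\<dots> = fps_nth (Q * K * ?P) n"
    unfolding fps_mult_nth[of "Q * K"] atLeast0AtMost ..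
  also have "Q * K * ?P = Q * (?P * K)" by (simp only: mult_ac)
  also have "fps_nth (Q * (?P * K)) n = (\<Sum>m\<le>n. fps_nth Q m * fps_nth (?P * K) (n - m))"
    unfolding fps_mult_nth[of Q] atLeast0AtMost ..
  also have "\<dots> = (\<Sum>m<n. fps_nth Q m * fps_nth (?P * K) (n - m))"
    by (simp add: lessThan_Suc_atMost[symmetric] greedy_fps_0)
  also have "\<dots> = (\<Sum>m<n. fps_nth Q m * fps_nth K (n - m))"
  proof (intro sum.cong refl)
    fix m assume "m \<in> {..<n}"
    then have m: "m < n" "0 < n - m" by auto
    show "fps_nth Q m * fps_nth (?P * K) (n - m) = fps_nth Q m * fps_nth K (n - m)"
      using vanish[OF m(1)] greedy_fps_mult_eq[OF K0 m(2)] by (cases "fps_nth ?P (n - m) = 0") auto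
  qed
  also have "\<dots> = fps_nth (Q * K) n - fps_nth Q n"
    unfolding fps_mult_nth atLeast0AtMost lessThan_Suc_atMost[symmetric] by (simp add: K0)
  also have "fps_nth (Q * K) n = fps_nth L n" by (rule agree) auto
  finally show ?thesis using Qn by simp
qed

lemma fps_divide_mult_cancel:
  fixes f K :: "real fps"
  assumes "fps_nth K 0 = 1"
  shows "f / K * K = f"
  using assms by (simp add: fps_divide_unit mult.assoc inverse_mult_eq_1)

lemma reduced_series_nth:
  "i \<notin> m ` {..j} \<Longrightarrow> fps_nth (reduced_series K L m j) i = fps_nth L i"
proof (induction j)
  case 0
  then show ?case by (simp add: fps_X_power_nth)
next
  case (Suc j)
  then have "i \<notin> m ` {..j}" "i \<noteq> m (Suc j)" by auto
  then show ?case using Suc.IH by (simp add: fps_X_power_nth)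
qed

text \<open>Later steps change the quotient only at larger exponents, so a zero once created persists.\<close>

lemma reduced_series_quotient_vanishes:
  assumes K: "fps_nth K 0 = 1" and m: "strict_mono m"
  shows "i \<le> j \<Longrightarrow> fps_nth (reduced_series K L m j / K) (m i) = 0"
proof (induction j)
  case 0
  have "fps_nth (fps_const c * fps_X ^ n / K) n = c" for c n
    using K by (simp add: fps_divide_unit mult.assoc fps_X_power_mult_nth)
  then show ?case using 0 K by (simp add: fps_divide_unit left_diff_distrib)
next
  case (Suc j)
  define c where "c = fps_nth (reduced_series K L m j / K) (m (Suc j))"
  have split: "fps_nth (reduced_series K L m (Suc j) / K) n
      = fps_nth (reduced_series K L m j / K) n - fps_nth (fps_const c * fps_X ^ m (Suc j) * inverse K) n" for n
    using K by (simp add: fps_divide_unit left_diff_distrib c_def)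
  show ?case
  proof (cases "i = Suc j")
    case True
    then show ?thesis
      unfolding split True using K by (simp add: c_def[symmetric] mult.assoc fps_X_power_mult_nth)
  next
    case False
    then have "i \<le> j" using Suc.prems by simp
    moreover have "m i < m (Suc j)" using m \<open>i \<le> j\<close> by (simp add: strict_mono_less)
    ultimately show ?thesis unfolding split using Suc.IH by (simp add: mult.assoc fps_X_power_mult_nth)
  qed
qed

lemma strict_mono_enumeration:
  assumes "S \<subseteq> {..<n}" "S \<noteq> {}"
  shows "\<exists>(m :: nat \<Rightarrow> nat) j. strict_mono m \<and> m ` {..j} = S"
proof -
  have fin: "finite S" using assms(1) finite_subset by blast
  define xs where "xs = sorted_list_of_set S"
  have len: "length xs = card S" and set: "set xs = S" and sorted: "sorted_wrt (<) xs"
    using fin by (simp_all add: xs_def)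
  have pos: "0 < card S" using assms(2) fin by (simp add: card_gt_0_iff)
  define m where "m i = (if i < card S then xs ! i else n + i)" for i
  have "strict_mono m"
    unfolding strict_mono_Suc_iff
  proof
    fix i
    have "xs ! i < n" if "i < card S" using that assms(1) set len nth_mem by fastforce
    moreover have "xs ! i < xs ! Suc i" if "Suc i < card S"
      by (rule sorted_wrt_nth_less[OF sorted]) (use that len in auto)
    ultimately show "m i < m (Suc i)" by (auto simp: m_def intro: less_le_trans)
  qed
  moreover have "m ` {..card S - 1} = S"
  proof -
    have "{..card S - 1} = {..<length xs}" using pos len by auto
    then have "m ` {..card S - 1} = (!) xs ` {..<length xs}" by (auto simp: m_def len)
    then show ?thesis using set by (auto simp: set_conv_nth)
  qed
  ultimately show ?thesis by blast
qed

text \<open>The bound of the hypothesis, applied to the coefficients below \<open>n\<close>, leaves two possibilities: \<open>Q\<close>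
  vanishes at \<open>n\<close> and the bound is the claim, or \<open>Q * K\<close> agrees with \<open>L\<close> at \<open>n\<close> and the coefficient of
  \<open>Q\<close> is the slack in the bound.\<close>

lemma quotient_coefficients_bounds:
  fixes K L Q :: "real fps"
  assumes K0: "fps_nth K 0 = 1"
    and bound: "\<And>M q. (\<And>i. i < M \<Longrightarrow> (0::real) \<le> q i) \<Longrightarrow>
        (\<And>m. m < M \<Longrightarrow> (\<Sum>i\<le>m. q i * fps_nth K (m - i)) \<le> fps_nth L m) \<Longrightarrow>
        (\<Sum>i<M. q i * fps_nth K (M - i)) \<le> fps_nth L M"
    and Q: "\<And>n. fps_nth Q n = 0 \<or> fps_nth (Q * K) n = fps_nth L n"
  shows "0 \<le> fps_nth Q n \<and> fps_nth (Q * K) n \<le> fps_nth L n"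
proof (induction n rule: less_induct)
  case (less n)
  have mult: "fps_nth (Q * K) m = (\<Sum>i\<le>m. fps_nth Q i * fps_nth K (m - i))" for m
    unfolding fps_mult_nth atLeast0AtMost ..
  have le: "(\<Sum>i<n. fps_nth Q i * fps_nth K (n - i)) \<le> fps_nth L n"
    by (rule bound) (use less.IH in \<open>auto simp: mult[symmetric]\<close>)
  moreover have "fps_nth (Q * K) n = (\<Sum>i<n. fps_nth Q i * fps_nth K (n - i)) + fps_nth Q n"
    unfolding mult lessThan_Suc_atMost[symmetric] by (simp add: K0)
  ultimately show ?case using Q[of n] by auto
qed

text \<open>The quotient converges on the disc, being dominated by \<open>L\<close>.\<close>

lemma quotient_positive_of_bounds:
  assumes r: "0 < r" and L: "converges_on r L" and K: "fps_nth K 0 = 1" "\<And>m. 0 \<le> fps_nth K m"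
    and Q: "\<And>n. 0 \<le> fps_nth (f / K) n" "\<And>n. fps_nth (f / K * K) n \<le> fps_nth L n"
  shows "quotient_positive r f K"
proof -
  have "fps_nth (f / K) n \<le> fps_nth L n" for n
  proof -
    have "fps_nth (f / K) n \<le> (\<Sum>i\<le>n. fps_nth (f / K) i * fps_nth K (n - i))"
      using member_le_sum[of n "{..n}" "\<lambda>i. fps_nth (f / K) i * fps_nth K (n - i)"] K Q(1) by simp
    also have "\<dots> = fps_nth (f / K * K) n" unfolding fps_mult_nth atLeast0AtMost ..
    finally show ?thesis using Q(2)[of n] by simp
  qed
  then have "\<bar>fps_nth (f / K) n\<bar> \<le> \<bar>fps_nth L n\<bar>" for n using Q(1)[of n] by (smt (verit))
  then have conv: "converges_on r (f / K)" by (rule converges_on_dominated[OF L])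
  have "is_kernel (ball 0 r) (\<lambda>z w. diag_eval (f / K) (z * cnj w))"
    by (rule is_kernel_of_pos_kernel[OF _ pos_kernel_diag_eval[OF conv r Q(1)]]) (use r in auto)
  moreover have "diag_expansion r (f / K) (\<lambda>z w. diag_eval (f / K) (z * cnj w))"
    unfolding diag_expansion_def using diag_eval_sums[OF conv r norm_diag_less] by blast
  ultimately show ?thesis unfolding quotient_positive_def by blast
qed

lemma quotient_positive_coefficients:
  assumes "quotient_positive r f K" "0 < r"
  shows "0 \<le> fps_nth (f / K) n"
  using assms diag_kernel_coefficients_nonneg unfolding quotient_positive_def by blast

text \<open>Pick data are indexed by \<open>b < n * N\<close>, with the point \<open>b div N\<close> and the row \<open>b mod N\<close>.\<close>

lemma complete_pick_pair_of_multiplier_series: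
  fixes ks ls p :: "real fps"
  assumes r: "0 < r" and k: "diag_expansion r ks k" and l: "diag_expansion r ls l"
    and ks: "fps_nth ks 0 = 1" "\<And>m. 0 \<le> fps_nth ks m" and ls: "fps_nth ls 0 = 1" "\<And>m. 0 \<le> fps_nth ls m"
    and rk: "is_rkhs (ball 0 r) k (rkhs (ball 0 r) k)" and rl: "is_rkhs (ball 0 r) l (rkhs (ball 0 r) l)"
    and p: "converges_on r p" "fps_nth p 0 = 0" "\<And>m. 0 \<le> fps_nth p m"
      "\<And>m. 0 \<le> fps_nth ((1 - p) * ls) m" "\<And>m. 0 \<le> fps_nth (1 - (1 - p) * ks) m"
  shows "complete_pick_pair (ball 0 r) k l"
  unfolding complete_pick_pair_def
proof (intro allI impI, elim conjE)
  fix n N :: nat and z :: "nat \<Rightarrow> complex" and W :: "nat \<Rightarrow> complex mat"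
  assume z: "\<forall>i<n. z i \<in> ball 0 r" and W: "\<forall>i<n. W i \<in> carrier_mat N N"
    and psd: "psd_mat (n * N) (block_matrix n N (\<lambda>i j.
          l (z i) (z j) \<cdot>\<^sub>m 1\<^sub>m N - k (z i) (z j) \<cdot>\<^sub>m (W i * mat_adjoint (W j))))"
  have ck: "converges_on r ks" and cl: "converges_on r ls"
    using diag_expansion_converges[OF k r] diag_expansion_converges[OF l r] by auto
  have kz: "k x y = diag_eval ks (x * cnj y)" and lz: "l x y = diag_eval ls (x * cnj y)"
    if "x \<in> ball 0 r" "y \<in> ball 0 r" for x y
    using diag_expansion_eval[OF k ck r that] diag_expansion_eval[OF l cl r that] by auto
  define B where "B = {..<n * N}"
  define \<zeta> where "\<zeta> b = z (b div N)" for b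
  define w where "w b c = W (b div N) $$ (b mod N, c)" for b c
  have div: "b div N < n" "b mod N < N" if "b \<in> B" for b
    using that by (cases N; auto simp: B_def intro: less_mult_imp_div_less)+
  have \<zeta>: "\<zeta> b \<in> ball 0 r" if "b \<in> B" for b using z div(1)[OF that] by (simp add: \<zeta>_def)
  have "pos_kernel B (\<lambda>b b'. (if b mod N = b' mod N then l (\<zeta> b) (\<zeta> b') else 0)
       - k (\<zeta> b) (\<zeta> b') * herm N (w b) (w b'))"
    using psd block_psd_iff_pos_kernel[of n W N l z k] W
    unfolding B_def \<zeta>_def w_def by blast
  then have data: "pos_kernel B (\<lambda>b b'. (if b mod N = b' mod N then diag_eval ls (\<zeta> b * cnj (\<zeta> b')) else 0)
       - diag_eval ks (\<zeta> b * cnj (\<zeta> b')) * herm N (w b) (w b'))"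
    by (rule pos_kernel_cong) (simp only: kz[OF \<zeta> \<zeta>] lz[OF \<zeta> \<zeta>])
  obtain \<phi> where \<phi>: "\<forall>b\<in>B. \<forall>c<N. \<phi> (\<zeta> b) (b mod N) c = w b c"
    and pos: "pos_kernel (ball 0 r \<times> {..<N}) (\<lambda>(z, a) (z', a'). (if a = a' then diag_eval ls (z * cnj z') else 0)
       - diag_eval ks (z * cnj z') * herm N (\<phi> z a) (\<phi> z' a'))"
    using complete_pick_extension[OF r ck cl p(1) ks(2) ls(2) p(3) p(4) p(5) ks(1) ls(1) p(2) _ \<zeta> div(2) data]
    by (auto simp: B_def)
  define \<Phi> where "\<Phi> x = Matrix.mat N N (\<lambda>(a, c). \<phi> x a c)" for x
  have carr: "\<Phi> x \<in> carrier_mat N N" for x by (simp add: \<Phi>_def)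
  have "pos_kernel (ball 0 r \<times> {..<N}) (multiplier_kernel N k l \<Phi>)"
  proof (rule pos_kernel_cong[OF pos])
    fix p p' :: "complex \<times> nat" assume pp: "p \<in> ball 0 r \<times> {..<N}" "p' \<in> ball 0 r \<times> {..<N}"
    obtain x a y b where xy: "p = (x, a)" "p' = (y, b)" by fastforce
    have "herm N (\<lambda>c. \<Phi> x $$ (a, c)) (\<lambda>c. \<Phi> y $$ (b, c)) = herm N (\<phi> x a) (\<phi> y b)"
      by (rule herm_cong) (use pp xy in \<open>auto simp: \<Phi>_def\<close>)
    then show "(case p of (z, a) \<Rightarrow> \<lambda>(z', a'). (if a = a' then diag_eval ls (z * cnj z') else 0)
       - diag_eval ks (z * cnj z') * herm N (\<phi> z a) (\<phi> z' a')) p' = multiplier_kernel N k l \<Phi> p p'"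
      using pp unfolding xy multiplier_kernel_def by (simp add: kz lz)
  qed
  then have mult: "\<Phi> \<in> Mult (ball 0 r) N k l \<and> mult_norm (ball 0 r) N k l \<Phi> \<le> 1"
    by (subst contractive_multiplier_iff[OF rk rl]) (rule carr)
  have "\<Phi> (z i) = W i" if i: "i < n" for i
  proof (rule eq_matI)
    show "dim_row (\<Phi> (z i)) = dim_row (W i)" "dim_col (\<Phi> (z i)) = dim_col (W i)"
      using W i carr[of "z i"] by auto
    fix a c assume "a < dim_row (W i)" "c < dim_col (W i)"
    then have ac: "a < N" "c < N" using W i by auto
    have "i * N + a < Suc i * N" using ac by simp
    also have "\<dots> \<le> n * N" using i by (intro mult_le_mono1) simp
    finally have "i * N + a \<in> B" by (simp add: B_def)
    then have "\<phi> (\<zeta> (i * N + a)) ((i * N + a) mod N) c = w (i * N + a) c" using \<phi> ac by blast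
    then show "\<Phi> (z i) $$ (a, c) = W i $$ (a, c)"
      using ac by (simp add: \<zeta>_def w_def \<Phi>_def)
  qed
  then show "\<exists>\<Phi>\<in>Mult (ball 0 r) N k l. mult_norm (ball 0 r) N k l \<Phi> \<le> 1 \<and> (\<forall>i<n. \<Phi> (z i) = W i)"
    using mult by blast
qed

theorem theorem9p1:
  fixes r :: real
    and k l :: "complex \<Rightarrow> complex \<Rightarrow> complex"
    and ks ls :: "real fps"
  assumes "0 < r"
    and "normalized_diagonal_holomorphic_kernel r ks k"
    and "normalized_diagonal_holomorphic_kernel r ls l"
  shows "complete_pick_pair (ball 0 r) k l \<longleftrightarrow>
    quotient_positive r ls ks \<and>
    (\<forall>m :: nat \<Rightarrow> nat. strict_mono m \<longrightarrow>
       (\<forall>j. quotient_positive r (reduced_series ks ls m j) ks))"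
proof -
  note r = assms(1)
  have k: "diag_expansion r ks k" and ks: "fps_nth ks 0 = 1" "\<And>m. 0 < fps_nth ks m"
    and l: "diag_expansion r ls l" and ls: "fps_nth ls 0 = 1" "\<And>m. 0 < fps_nth ls m"
    using assms(2,3) unfolding normalized_diagonal_holomorphic_kernel_def by auto
  note ks' = less_imp_le[OF ks(2)] and ls' = less_imp_le[OF ls(2)]
  note rk = is_rkhs_rkhs[OF r k ks(2)] and rl = is_rkhs_rkhs[OF r l ls(2)]
  have ck: "converges_on r ks" and cl: "converges_on r ls"
    using diag_expansion_converges[OF k r] diag_expansion_converges[OF l r] by auto
  show ?thesis
  proof (intro iffI conjI allI impI)
    assume pick: "complete_pick_pair (ball 0 r) k l"
    have positive: "quotient_positive r f ks"
      if f: "\<And>n. fps_nth (f / ks) n = 0 \<or> fps_nth f n = fps_nth ls n" for f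
    proof -
      have "0 \<le> fps_nth (f / ks) n \<and> fps_nth (f / ks * ks) n \<le> fps_nth ls n" for n
      proof (rule quotient_coefficients_bounds[OF ks(1)])
        show "fps_nth (f / ks) n = 0 \<or> fps_nth (f / ks * ks) n = fps_nth ls n" for n
          using f[of n] by (simp add: fps_divide_mult_cancel[OF ks(1)])
      qed (rule complete_pick_pair_imp_coefficient_bound[OF r k l ks(1) ls rk rl pick]; simp)
      then show ?thesis by (intro quotient_positive_of_bounds[OF r cl ks(1) ks']) auto
    qed
    show "quotient_positive r ls ks" by (rule positive) simp
    fix m :: "nat \<Rightarrow> nat" and j assume m: "strict_mono m"
    show "quotient_positive r (reduced_series ks ls m j) ks"
    proof (rule positive)
      fix n
      show "fps_nth (reduced_series ks ls m j / ks) n = 0 \<or> fps_nth (reduced_series ks ls m j) n = fps_nth ls n"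
        using reduced_series_nth[of n m j ks ls] reduced_series_quotient_vanishes[OF ks(1) m, of _ j ls] by auto
    qed
  next
    assume R: "quotient_positive r ls ks \<and>
      (\<forall>m :: nat \<Rightarrow> nat. strict_mono m \<longrightarrow> (\<forall>j. quotient_positive r (reduced_series ks ls m j) ks))"
    define p where "p = greedy_fps ks"
    have p_le: "fps_nth (p * ls) n \<le> fps_nth ls n" for n
    proof (cases "n = 0")
      case True
      then show ?thesis by (simp add: p_def greedy_fps_0 ls)
    next
      case False
      \<comment> \<open>the exponents to be removed\<close>
      define S where "S = {m. m < n \<and> fps_nth p (n - m) = 0}"
      have "\<exists>f. quotient_positive r f ks \<and> (\<forall>i. i \<notin> S \<longrightarrow> fps_nth f i = fps_nth ls i) \<and> (\<forall>i\<in>S. fps_nth (f / ks) i = 0)"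
      proof (cases "S = {}")
        case True
        then show ?thesis using R by blast
      next
        case False
        have "S \<subseteq> {..<n}" by (auto simp: S_def)
        from strict_mono_enumeration[OF this False]
        obtain m :: "nat \<Rightarrow> nat" and j where m: "strict_mono m" "m ` {..j} = S" by blast
        have "\<forall>i\<in>S. fps_nth (reduced_series ks ls m j / ks) i = 0"
          unfolding m(2)[symmetric] using reduced_series_quotient_vanishes[OF ks(1) m(1)] by auto
        moreover have "\<forall>i. i \<notin> S \<longrightarrow> fps_nth (reduced_series ks ls m j) i = fps_nth ls i"
          using reduced_series_nth[of _ m j] m(2) by auto
        ultimately show ?thesis using R m(1) by blast
      qed
      then obtain f where f: "quotient_positive r f ks" "\<And>i. i \<notin> S \<Longrightarrow> fps_nth f i = fps_nth ls i"
        "\<And>i. i \<in> S \<Longrightarrow> fps_nth (f / ks) i = 0" by blast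
      show ?thesis
        unfolding p_def
      proof (rule greedy_fps_product_bound[OF ks(1), where Q = "f / ks"])
        show "0 < n" using False by simp
        show "0 \<le> fps_nth (f / ks) n" by (rule quotient_positive_coefficients[OF f(1) r])
        show "fps_nth (f / ks) m = 0" if "m < n" "fps_nth (greedy_fps ks) (n - m) = 0" for m
          by (rule f(3)) (use that in \<open>simp add: S_def p_def\<close>)
        show "fps_nth (f / ks * ks) m = fps_nth ls m" if "m \<le> n" "m = n \<or> fps_nth (greedy_fps ks) (n - m) \<noteq> 0" for m
          unfolding fps_divide_mult_cancel[OF ks(1)]
          by (rule f(2)) (use that in \<open>auto simp: S_def p_def\<close>)
      qed
    qed
    show "complete_pick_pair (ball 0 r) k l"
    proof (rule complete_pick_pair_of_multiplier_series[OF r k l ks(1) ks' ls(1) ls' rk rl, of p])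
      have "\<bar>fps_nth p n\<bar> \<le> \<bar>fps_nth ks n\<bar>" for n
        using greedy_fps_nonneg[of ks n] greedy_fps_le[OF ks', of n] by (simp add: p_def)
      then show "converges_on r p" by (rule converges_on_dominated[OF ck])
      show "fps_nth p 0 = 0" "0 \<le> fps_nth p n" for n
        by (simp_all add: p_def greedy_fps_0 greedy_fps_nonneg)
      show "0 \<le> fps_nth ((1 - p) * ls) n" for n
        using p_le[of n] by (simp add: left_diff_distrib)
      show "0 \<le> fps_nth (1 - (1 - p) * ks) n" for n
      proof (cases "n = 0")
        case True
        then show ?thesis using ks(1) by (simp add: p_def greedy_fps_0)
      next
        case False
        then show ?thesis using greedy_fps_mult_ge[OF ks(1), of n] by (simp add: left_diff_distrib p_def)
      qed
    qed
  qed
qed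

end
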